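(* Every model of $\mathrm{PA}$ has an elementary end extension that has an expansion to a model of $\mathrm{PAI}_0$, but has no expansion to a model of $\mathrm{PAI}$.
   Context: $\mathcal{L}_{\mathrm{A}}=\{+,\cdot,\mathrm{S},<,0\}$. $\mathrm{PAI}$ is the $\mathcal{L}_{\mathrm{A}}\cup\{I\}$-theory with axioms: (1) $\mathrm{PA}$ with induction for all $\mathcal{L}_{\mathrm{A}}\cup\{I\}$-formulae; (2) "$I$ is unbounded"; (3) for each $\mathcal{L}_{\mathrm{A}}$-formula $\varphi(v_1,\dots,v_n)$: for all $x_1<\dots<x_n$ and $y_1<\dots<y_n$ in $I$, $\varphi(\bar x)\leftrightarrow\varphi(\bar y)$. $\mathrm{PAI}_0$ is the subsystem whose axioms are $\mathrm{PA}$, the induction scheme for $\Delta_0(I)$-formulae (formulae of $\mathcal{L}_{\mathrm{A}}\cup\{I\}$ all of whose quantifiers are bounded by terms), and axioms (2) and (3). *)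

theory Defs
  imports Main
begin

text \<open>
  Terms of the language \<open>{+, \<cdot>, S, <, 0}\<close> and formulas of that language with an additional unary
  predicate symbol \<open>I\<close>. Variables are de Bruijn indices: under \<open>Ex\<close>, \<open>Var 0\<close> is the bound
  variable and \<open>Var (Suc i)\<close> is the outer \<open>Var i\<close>.
\<close>

datatype tm = Var nat | Zero | Succ tm | Add tm tm | Mul tm tm

datatype fm = Eq tm tm | Lt tm tm | Ind tm | Neg fm | Conj fm fm | Ex fm

abbreviation Disj :: "fm \<Rightarrow> fm \<Rightarrow> fm" where "Disj p q \<equiv> Neg (Conj (Neg p) (Neg q))"
abbreviation Imp :: "fm \<Rightarrow> fm \<Rightarrow> fm" where "Imp p q \<equiv> Neg (Conj p (Neg q))"
abbreviation Iff :: "fm \<Rightarrow> fm \<Rightarrow> fm" where "Iff p q \<equiv> Conj (Imp p q) (Imp q p)"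
abbreviation All :: "fm \<Rightarrow> fm" where "All p \<equiv> Neg (Ex (Neg p))"

primrec is_LA :: "fm \<Rightarrow> bool" where
  "is_LA (Eq s t) = True"
| "is_LA (Lt s t) = True"
| "is_LA (Ind t) = False"
| "is_LA (Neg p) = is_LA p"
| "is_LA (Conj p q) = (is_LA p \<and> is_LA q)"
| "is_LA (Ex p) = is_LA p"

primrec fv_tm :: "tm \<Rightarrow> nat set" where
  "fv_tm (Var i) = {i}"
| "fv_tm Zero = {}"
| "fv_tm (Succ t) = fv_tm t"
| "fv_tm (Add s t) = fv_tm s \<union> fv_tm t"
| "fv_tm (Mul s t) = fv_tm s \<union> fv_tm t"

primrec fv :: "fm \<Rightarrow> nat set" where
  "fv (Eq s t) = fv_tm s \<union> fv_tm t"
| "fv (Lt s t) = fv_tm s \<union> fv_tm t"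
| "fv (Ind t) = fv_tm t"
| "fv (Neg p) = fv p"
| "fv (Conj p q) = fv p \<union> fv q"
| "fv (Ex p) = {i. Suc i \<in> fv p}"

text \<open>Simultaneous capture-avoiding substitution.\<close>

primrec subst_tm :: "(nat \<Rightarrow> tm) \<Rightarrow> tm \<Rightarrow> tm" where
  "subst_tm \<sigma> (Var i) = \<sigma> i"
| "subst_tm \<sigma> Zero = Zero"
| "subst_tm \<sigma> (Succ t) = Succ (subst_tm \<sigma> t)"
| "subst_tm \<sigma> (Add s t) = Add (subst_tm \<sigma> s) (subst_tm \<sigma> t)"
| "subst_tm \<sigma> (Mul s t) = Mul (subst_tm \<sigma> s) (subst_tm \<sigma> t)"

definition lift_tm :: "tm \<Rightarrow> tm" where
  "lift_tm t = subst_tm (\<lambda>i. Var (Suc i)) t"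

primrec subst :: "(nat \<Rightarrow> tm) \<Rightarrow> fm \<Rightarrow> fm" where
  "subst \<sigma> (Eq s t) = Eq (subst_tm \<sigma> s) (subst_tm \<sigma> t)"
| "subst \<sigma> (Lt s t) = Lt (subst_tm \<sigma> s) (subst_tm \<sigma> t)"
| "subst \<sigma> (Ind t) = Ind (subst_tm \<sigma> t)"
| "subst \<sigma> (Neg p) = Neg (subst \<sigma> p)"
| "subst \<sigma> (Conj p q) = Conj (subst \<sigma> p) (subst \<sigma> q)"
| "subst \<sigma> (Ex p) = Ex (subst (case_nat (Var 0) (\<lambda>i. lift_tm (\<sigma> i))) p)"

text \<open>
  The \<open>\<Delta>\<^sub>0(I)\<close>-formulas. In a bounded quantifier \<open>\<exists>x < t\<close> or \<open>\<forall>x < t\<close> the term \<open>t\<close> does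
  not contain \<open>x\<close>; this is expressed by lifting \<open>t\<close>. A bound \<open>x \<le> t\<close> is \<open>x < S t\<close>.
\<close>

inductive Delta0 :: "fm \<Rightarrow> bool" where
  "Delta0 (Eq s t)"
| "Delta0 (Lt s t)"
| "Delta0 (Ind t)"
| "Delta0 p \<Longrightarrow> Delta0 (Neg p)"
| "Delta0 p \<Longrightarrow> Delta0 q \<Longrightarrow> Delta0 (Conj p q)"
| "Delta0 p \<Longrightarrow> Delta0 (Ex (Conj (Lt (Var 0) (lift_tm t)) p))"
| "Delta0 p \<Longrightarrow> Delta0 (All (Imp (Lt (Var 0) (lift_tm t)) p))"


text \<open>
  An axiom with free variables stands for its universal closure: a structure is a model of it
  iff all assignments satisfy it (see \<open>models\<close> below).
\<close>

definition basic_axioms :: "fm set" where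
  "basic_axioms =
    {Neg (Eq (Succ (Var 0)) Zero),
     Imp (Eq (Succ (Var 0)) (Succ (Var 1))) (Eq (Var 0) (Var 1)),
     Eq (Add (Var 0) Zero) (Var 0),
     Eq (Add (Var 0) (Succ (Var 1))) (Succ (Add (Var 0) (Var 1))),
     Eq (Mul (Var 0) Zero) Zero,
     Eq (Mul (Var 0) (Succ (Var 1))) (Add (Mul (Var 0) (Var 1)) (Var 0)),
     Neg (Lt (Var 0) Zero),
     Iff (Lt (Var 0) (Succ (Var 1))) (Disj (Lt (Var 0) (Var 1)) (Eq (Var 0) (Var 1)))}"

text \<open>
  \<open>p(0) \<and> \<forall>x (p(x) \<longrightarrow> p(S x)) \<longrightarrow> \<forall>x p(x)\<close>, where \<open>x\<close> is \<open>Var 0\<close> in \<open>p\<close> and the other free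
  variables of \<open>p\<close> are parameters.
\<close>

definition induction_axiom :: "fm \<Rightarrow> fm" where
  "induction_axiom p =
    Imp (Conj (subst (case_nat Zero Var) p)
              (All (Imp p (subst (case_nat (Succ (Var 0)) (\<lambda>i. Var (Suc i))) p))))
        (All p)"

definition unbounded_axiom :: fm where
  "unbounded_axiom = All (Ex (Conj (Ind (Var 0)) (Lt (Var 1) (Var 0))))"

text \<open>
  For \<open>p\<close> with free variables among \<open>Var 0, \<dots>, Var (n - 1)\<close>: the variables
  \<open>Var 0, \<dots>, Var (n - 1)\<close> play the role of \<open>x\<^sub>1, \<dots>, x\<^sub>n\<close> and
  \<open>Var n, \<dots>, Var (2 * n - 1)\<close> that of \<open>y\<^sub>1, \<dots>, y\<^sub>n\<close>.
\<close>

definition indiscernibility_axiom :: "nat \<Rightarrow> fm \<Rightarrow> fm" where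
  "indiscernibility_axiom n p =
    foldr Imp
      (map (\<lambda>i. Ind (Var i)) [0..<2 * n] @
       map (\<lambda>i. Lt (Var i) (Var (Suc i))) [0..<n - 1] @
       map (\<lambda>i. Lt (Var (n + i)) (Var (n + Suc i))) [0..<n - 1])
      (Iff p (subst (\<lambda>i. Var (n + i)) p))"

definition indiscernibility_axioms :: "fm set" where
  "indiscernibility_axioms = {indiscernibility_axiom n p |n p. is_LA p \<and> fv p \<subseteq> {..<n}}"

definition PA :: "fm set" where
  "PA = basic_axioms \<union> {induction_axiom p |p. is_LA p}"

definition PAI :: "fm set" where
  "PAI = basic_axioms \<union> range induction_axiom \<union> {unbounded_axiom} \<union> indiscernibility_axioms"

definition PAI0 :: "fm set" where
  "PAI0 = PA \<union> {induction_axiom p |p. Delta0 p} \<union> {unbounded_axiom} \<union> indiscernibility_axioms"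


record 'a la_structure =
  universe :: "'a set"
  zeroS :: 'a
  succS :: "'a \<Rightarrow> 'a"
  addS :: "'a \<Rightarrow> 'a \<Rightarrow> 'a"
  mulS :: "'a \<Rightarrow> 'a \<Rightarrow> 'a"
  lessS :: "'a \<Rightarrow> 'a \<Rightarrow> bool"

text \<open>The operations are only relevant on \<open>universe M\<close>, which must be closed under them.\<close>

definition wf_structure :: "'a la_structure \<Rightarrow> bool" where
  "wf_structure M \<longleftrightarrow>
    zeroS M \<in> universe M \<and>
    (\<forall>x\<in>universe M. succS M x \<in> universe M) \<and>
    (\<forall>x\<in>universe M. \<forall>y\<in>universe M. addS M x y \<in> universe M \<and> mulS M x y \<in> universe M)"

primrec eval :: "'a la_structure \<Rightarrow> (nat \<Rightarrow> 'a) \<Rightarrow> tm \<Rightarrow> 'a" where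
  "eval M e (Var i) = e i"
| "eval M e Zero = zeroS M"
| "eval M e (Succ t) = succS M (eval M e t)"
| "eval M e (Add s t) = addS M (eval M e s) (eval M e t)"
| "eval M e (Mul s t) = mulS M (eval M e s) (eval M e t)"

text \<open>Satisfaction in the expansion \<open>(M, X)\<close> of \<open>M\<close>, with \<open>X\<close> the interpretation of \<open>I\<close>.\<close>

primrec sat :: "'a la_structure \<Rightarrow> 'a set \<Rightarrow> (nat \<Rightarrow> 'a) \<Rightarrow> fm \<Rightarrow> bool" where
  "sat M X e (Eq s t) \<longleftrightarrow> eval M e s = eval M e t"
| "sat M X e (Lt s t) \<longleftrightarrow> lessS M (eval M e s) (eval M e t)"
| "sat M X e (Ind t) \<longleftrightarrow> eval M e t \<in> X"
| "sat M X e (Neg p) \<longleftrightarrow> \<not> sat M X e p"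
| "sat M X e (Conj p q) \<longleftrightarrow> sat M X e p \<and> sat M X e q"
| "sat M X e (Ex p) \<longleftrightarrow> (\<exists>a\<in>universe M. sat M X (case_nat a e) p)"

text \<open>On formulas without \<open>I\<close> the set \<open>X\<close> is irrelevant, so we take it to be empty there.\<close>

lemma sat_LA_cong: "is_LA p \<Longrightarrow> sat M X e p \<longleftrightarrow> sat M Y e p"
  by (induction p arbitrary: e) auto

abbreviation sat_LA :: "'a la_structure \<Rightarrow> (nat \<Rightarrow> 'a) \<Rightarrow> fm \<Rightarrow> bool" where
  "sat_LA M \<equiv> sat M {}"

definition models :: "'a la_structure \<Rightarrow> 'a set \<Rightarrow> fm set \<Rightarrow> bool" where
  "models M X T \<longleftrightarrow>
    wf_structure M \<and> X \<subseteq> universe M \<and> (\<forall>p\<in>T. \<forall>e. range e \<subseteq> universe M \<longrightarrow> sat M X e p)"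

abbreviation models_LA :: "'a la_structure \<Rightarrow> fm set \<Rightarrow> bool" where
  "models_LA M \<equiv> models M {}"

definition has_expansion :: "'a la_structure \<Rightarrow> fm set \<Rightarrow> bool" where
  "has_expansion M T \<longleftrightarrow> (\<exists>X. models M X T)"

text \<open>
  \<open>N\<close> is, up to identification of \<open>M\<close> with its image under \<open>j\<close>, an elementary end extension
  of \<open>M\<close>. Injectivity of \<open>j\<close> and preservation of the operations follow from elementarity.
\<close>

definition elementary_embedding :: "('a \<Rightarrow> 'b) \<Rightarrow> 'a la_structure \<Rightarrow> 'b la_structure \<Rightarrow> bool" where
  "elementary_embedding j M N \<longleftrightarrow>
    wf_structure M \<and> wf_structure N \<and> j ` universe M \<subseteq> universe N \<and>
    (\<forall>p e. is_LA p \<longrightarrow> range e \<subseteq> universe M \<longrightarrow> (sat_LA M e p \<longleftrightarrow> sat_LA N (j \<circ> e) p))"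

definition elementary_end_extension ::
    "('a \<Rightarrow> 'b) \<Rightarrow> 'a la_structure \<Rightarrow> 'b la_structure \<Rightarrow> bool" where
  "elementary_end_extension j M N \<longleftrightarrow>
    elementary_embedding j M N \<and>
    (\<forall>a\<in>universe M. \<forall>b\<in>universe N - j ` universe M. lessS N (j a) b)"

end

theory Submission
  imports Defs "HOL-Library.Countable"
begin

text \<open>
  Over \<open>M\<close> one builds, as in Gaifman's work, a parameter-free definable type: a decreasing sequence of
  unbounded definable sets deciding every formula eventually, uniformly in its parameters. Iterating the
  type \<open>\<omega>\<close> times yields an elementary end extension \<open>N\<close> of \<open>M\<close> generated over \<open>M\<close> by indiscernibles
  \<open>c 0 < c 1 < \<dots>\<close> that are cofinal in \<open>N\<close>. Since only finitely many of them lie below any bound, they are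
  definable below any bound, so \<open>\<Delta>\<^sub>0(I)\<close>-induction reduces to induction in \<open>N\<close>.

  Let \<open>N\<^sub>n\<close> be generated by \<open>M\<close> and \<open>c 0, \<dots>, c (n - 1)\<close>. Any two elements of
  \<open>N\<^sub>n\<^sub>+\<^sub>1 - N\<^sub>n\<close> are bounded by parameter-free functions of each other, so an unbounded set \<open>J\<close> of
  indiscernibles has at most one element in each of these layers. Hence \<open>J\<close> has only finitely many elements
  between \<open>c 0\<close> and any given element of \<open>N\<close>. But full induction for \<open>(N, J)\<close> gives a coded injection
  of the infinite initial segment below \<open>c 0\<close> into such a piece of \<open>J\<close>.
\<close>

text \<open>The indiscernibility scheme speaks of formulas without parameters, whereas an element of
  a layer is defined from parameters in \<open>M\<close> and in the layer below. This mismatch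
  shapes both halves. For the positive half the sets that make up the type are parameter-free and
  treat all parameters at once: then holding on the type is a first-order property, can be iterated
  and commutes with negation, and \<open>M\<close> may be uncountable although only countably many
  sets are chosen. For the negative half a parameter is traded for a bound: a definable function
  that is not eventually constant on the type eventually exceeds its own parameter, so quantifying
  over all smaller parameters removes it. The segment below \<open>c 0\<close> contains the numerals
  and is therefore infinite even when \<open>M\<close> is the standard model. The injection is
  obtained by induction on a statement that mentions the predicate and quantifies over codes without
  bound, so it is not a \<open>\<Delta>\<^sub>0(I)\<close>-formula.\<close>

instance tm :: countable by countable_datatype
instance fm :: countable by countable_datatype

section \<open>Definability\<close>

lemma eval_subst_tm: "eval M e (subst_tm \<sigma> t) = eval M (\<lambda>i. eval M e (\<sigma> i)) t"
  by (induction t) auto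

lemma sat_subst: "sat M X e (subst \<sigma> p) \<longleftrightarrow> sat M X (\<lambda>i. eval M e (\<sigma> i)) p"
proof (induction p arbitrary: e \<sigma>)
  case (Ex p)
  have "(\<lambda>i. eval M (case_nat a e) (case_nat (Var 0) (\<lambda>i. lift_tm (\<sigma> i)) i)) =
        case_nat a (\<lambda>i. eval M e (\<sigma> i))" for a
    by (rule ext) (auto simp: lift_tm_def eval_subst_tm split: nat.splits)
  with Ex show ?case by simp
qed (auto simp: eval_subst_tm)

lemma eval_cong_fv: "(\<And>i. i \<in> fv_tm t \<Longrightarrow> e i = e' i) \<Longrightarrow> eval M e t = eval M e' t"
  by (induction t) auto

lemma sat_cong_fv: "(\<And>i. i \<in> fv p \<Longrightarrow> e i = e' i) \<Longrightarrow> sat M X e p \<longleftrightarrow> sat M X e' p"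
proof (induction p arbitrary: e e')
  case (Ex p)
  have "sat M X (case_nat a e) p \<longleftrightarrow> sat M X (case_nat a e') p" for a
    by (rule Ex.IH) (use Ex.prems in \<open>auto split: nat.splits\<close>)
  then show ?case by simp
next
  case (Neg p)
  then show ?case by (metis fv.simps(4) sat.simps(4))
next
  case (Conj p q)
  then show ?case by (metis UnI1 UnI2 fv.simps(5) sat.simps(5))
next
  case (Eq s t)
  then have "eval M e s = eval M e' s" "eval M e t = eval M e' t" by (auto intro!: eval_cong_fv)
  then show ?case by simp
next
  case (Lt s t)
  then have "eval M e s = eval M e' s" "eval M e t = eval M e' t" by (auto intro!: eval_cong_fv)
  then show ?case by simp
next
  case (Ind t)
  then have "eval M e t = eval M e' t" by (auto intro!: eval_cong_fv)
  then show ?case by simp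
qed

lemma finite_fv_tm: "finite (fv_tm t)"
  by (induction t) auto

lemma finite_fv: "finite (fv p)"
proof (induction p)
  case (Ex p)
  have "{i. Suc i \<in> fv p} \<subseteq> (\<lambda>i. i - 1) ` fv p"
    by force
  with Ex show ?case by (auto intro: finite_subset)
qed (auto simp: finite_fv_tm)

lemma is_LA_subst: "is_LA p \<Longrightarrow> is_LA (subst \<sigma> p)"
  by (induction p arbitrary: \<sigma>) auto

text \<open>The class \<open>C\<close> collects the formulas for which induction is available. The
  instances are \<open>is_LA\<close> over \<open>M\<close> and over \<open>N\<close>, and all
  formulas over an expansion satisfying \<open>PAI\<close>, so arithmetic is developed once for all
  of them. The \<open>\<Delta>\<^sub>0(I)\<close>-formulas are no instance, since they are not
  closed under \<open>Ex\<close>; they get a separate treatment.\<close>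

locale arith =
  fixes M :: "'a la_structure" and X :: "'a set" and C :: "fm \<Rightarrow> bool"
  assumes wf: "wf_structure M"
    and basic: "p \<in> basic_axioms \<Longrightarrow> range e \<subseteq> universe M \<Longrightarrow> sat M X e p"
    and induct: "C p \<Longrightarrow> range e \<subseteq> universe M \<Longrightarrow> sat M X e (induction_axiom p)"
    and C_Eq: "C (Eq s t)" and C_Lt: "C (Lt s t)"
    and C_Neg: "C p \<Longrightarrow> C (Neg p)" and C_Conj: "C p \<Longrightarrow> C q \<Longrightarrow> C (Conj p q)"
    and C_Ex: "C p \<Longrightarrow> C (Ex p)" and C_rename: "C p \<Longrightarrow> C (subst (\<lambda>i. Var (\<tau> i)) p)"
begin

abbreviation U where "U \<equiv> universe M"
abbreviation zero ("\<zero>") where "\<zero> \<equiv> zeroS M"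
abbreviation suc ("\<S>") where "\<S> \<equiv> succS M"
abbreviation plus (infixl "\<oplus>" 65) where "x \<oplus> y \<equiv> addS M x y"
abbreviation times (infixl "\<otimes>" 70) where "x \<otimes> y \<equiv> mulS M x y"
abbreviation less (infix "\<prec>" 50) where "x \<prec> y \<equiv> lessS M x y"

definition env :: "(nat \<Rightarrow> 'a) \<Rightarrow> bool" where "env e \<longleftrightarrow> (\<forall>i. e i \<in> U)"

lemma closed [simp, intro]:
  "\<zero> \<in> U" "x \<in> U \<Longrightarrow> \<S> x \<in> U" "x \<in> U \<Longrightarrow> y \<in> U \<Longrightarrow> x \<oplus> y \<in> U" "x \<in> U \<Longrightarrow> y \<in> U \<Longrightarrow> x \<otimes> y \<in> U"
  using wf by (auto simp: wf_structure_def)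

lemma env_range: "env e \<longleftrightarrow> range e \<subseteq> U"
  by (auto simp: env_def)

lemma envD [simp]: "env e \<Longrightarrow> e i \<in> U"
  by (simp add: env_def)

lemma env_case [simp]: "x \<in> U \<Longrightarrow> env e \<Longrightarrow> env (case_nat x e)"
  by (auto simp: env_def split: nat.splits)

lemma case_nat_shift [simp]: "case_nat (e 0) (\<lambda>i. e (Suc i)) = e"
  by (rule ext) (auto split: nat.splits)

lemma env_upd [simp]: "x \<in> U \<Longrightarrow> env e \<Longrightarrow> env (e(i := x))"
  by (auto simp: env_def)

lemma env_comp [simp]: "env e \<Longrightarrow> env (\<lambda>i. e (\<tau> i))"
  by (auto simp: env_def)

lemma env_const [simp]: "x \<in> U \<Longrightarrow> env (\<lambda>_. x)"
  by (auto simp: env_def)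

text \<open>A variable of the defining formula is read either from the environment or from the set
  \<open>A\<close> of parameters, as told by \<open>\<rho>\<close>.\<close>

definition dfn :: "'a set \<Rightarrow> ((nat \<Rightarrow> 'a) \<Rightarrow> bool) \<Rightarrow> bool" where
  "dfn A P \<longleftrightarrow> (\<exists>p \<rho>. C p \<and> (\<forall>i a. \<rho> i = Inr a \<longrightarrow> a \<in> A \<inter> U) \<and>
     (\<forall>e. env e \<longrightarrow> (P e \<longleftrightarrow> sat M X (\<lambda>i. case_sum e id (\<rho> i)) p)))"

text \<open>Not a syntactic term but any function of the assignment with a definable graph; entry 0
  holds the value and the arguments are shifted by one. Least-witness functions are terms in this
  sense.\<close>

definition trm :: "'a set \<Rightarrow> ((nat \<Rightarrow> 'a) \<Rightarrow> 'a) \<Rightarrow> bool" where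
  "trm A t \<longleftrightarrow> (\<forall>e. env e \<longrightarrow> t e \<in> U) \<and> dfn A (\<lambda>e. e 0 = t (\<lambda>i. e (Suc i)))"

lemma trm_in: "trm A t \<Longrightarrow> env e \<Longrightarrow> t e \<in> U"
  by (simp add: trm_def)

lemma dfn_mono: "dfn A P \<Longrightarrow> A \<subseteq> B \<Longrightarrow> dfn B P"
  unfolding dfn_def by blast

lemma dfn_cong: "dfn A P \<Longrightarrow> (\<And>e. env e \<Longrightarrow> P e \<longleftrightarrow> Q e) \<Longrightarrow> dfn A Q"
  unfolding dfn_def by blast

lemma dfn_sat: "C p \<Longrightarrow> dfn A (\<lambda>e. sat M X e p)"
  unfolding dfn_def by (intro exI[of _ p] exI[of _ Inl]) auto

lemma dfn_neg: "dfn A P \<Longrightarrow> dfn A (\<lambda>e. \<not> P e)"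
  unfolding dfn_def
proof (elim exE conjE, intro exI conjI)
  fix p \<rho>
  assume "C p" and "\<forall>i a. \<rho> i = Inr a \<longrightarrow> a \<in> A \<inter> U"
    and *: "\<forall>e. env e \<longrightarrow> P e = sat M X (\<lambda>i. case_sum e id (\<rho> i)) p"
  then show "C (Neg p)" "\<forall>i a. \<rho> i = Inr a \<longrightarrow> a \<in> A \<inter> U" by (auto intro: C_Neg)
  show "\<forall>e. env e \<longrightarrow> (\<not> P e) = sat M X (\<lambda>i. case_sum e id (\<rho> i)) (Neg p)" using * by auto
qed

lemma dfn_conj:
  assumes "dfn A P" "dfn A Q" shows "dfn A (\<lambda>e. P e \<and> Q e)"
proof -
  obtain p \<rho> where p: "C p" "\<forall>i a. \<rho> i = Inr a \<longrightarrow> a \<in> A \<inter> U"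
    "\<And>e. env e \<Longrightarrow> P e \<longleftrightarrow> sat M X (\<lambda>i. case_sum e id (\<rho> i)) p"
    using assms(1) unfolding dfn_def by blast
  obtain q \<rho>' where q: "C q" "\<forall>i a. \<rho>' i = Inr a \<longrightarrow> a \<in> A \<inter> U"
    "\<And>e. env e \<Longrightarrow> Q e \<longleftrightarrow> sat M X (\<lambda>i. case_sum e id (\<rho>' i)) q"
    using assms(2) unfolding dfn_def by blast
  \<comment> \<open>The two formulas may read the same variable differently, so one is moved to the
    even variables and the other to the odd ones.\<close>
  let ?\<rho> = "\<lambda>i. if even i then \<rho> (i div 2) else \<rho>' (i div 2)"
  let ?p = "Conj (subst (\<lambda>i. Var (2 * i)) p) (subst (\<lambda>i. Var (2 * i + 1)) q)"
  show ?thesis unfolding dfn_def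
    by (intro exI[of _ ?p] exI[of _ ?\<rho>]) (use p q in \<open>auto simp: sat_subst intro!: C_Conj C_rename\<close>)
qed

lemma dfn_ex:
  assumes "dfn A (\<lambda>e. P (e 0) (\<lambda>i. e (Suc i)))"
  shows "dfn A (\<lambda>e. \<exists>x\<in>U. P x e)"
proof -
  obtain p \<rho> where p: "C p" "\<forall>i a. \<rho> i = Inr a \<longrightarrow> a \<in> A \<inter> U"
    "\<And>e. env e \<Longrightarrow> P (e 0) (\<lambda>i. e (Suc i)) \<longleftrightarrow> sat M X (\<lambda>i. case_sum e id (\<rho> i)) p"
    using assms(1) unfolding dfn_def by blast
  let ?\<rho> = "\<lambda>i. case \<rho> i of Inl j \<Rightarrow> Inl (j - 1) | Inr a \<Rightarrow> Inr a"
  \<comment> \<open>Every variable that reads entry 0 becomes the bound variable. The value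
    \<open>Inl (0 - 1)\<close> that \<open>?\<rho>\<close> assigns to such a variable is never
    read.\<close>
  let ?\<tau> = "\<lambda>i. if \<rho> i = Inl 0 then 0 else Suc i"
  let ?p = "Ex (subst (\<lambda>i. Var (?\<tau> i)) p)"
  have "(\<exists>x\<in>U. P x e) \<longleftrightarrow> sat M X (\<lambda>i. case_sum e id (?\<rho> i)) ?p" if "env e" for e
  proof -
    have "(\<lambda>i. case_sum (case_nat x e) id (\<rho> i)) =
       (\<lambda>i. eval M (case_nat x (\<lambda>i. case_sum e id (?\<rho> i))) (Var (?\<tau> i)))" for x
      by (rule ext) (auto split: sum.splits nat.splits)
    then have "P x e \<longleftrightarrow> sat M X (case_nat x (\<lambda>i. case_sum e id (?\<rho> i))) (subst (\<lambda>i. Var (?\<tau> i)) p)"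
      if "x \<in> U" for x
      using p(3)[of "case_nat x e"] that \<open>env e\<close> by (simp add: sat_subst)
    then show ?thesis by auto
  qed
  then show ?thesis unfolding dfn_def using p(1,2)
    by (intro exI[of _ ?p] exI[of _ ?\<rho>]) (auto intro!: C_Ex C_rename split: sum.splits)
qed

lemma dfn_rename: "dfn A P \<Longrightarrow> dfn A (\<lambda>e. P (\<lambda>i. e (\<tau> i)))"
proof -
  assume "dfn A P"
  then obtain p \<rho> where p: "C p" "\<forall>i a. \<rho> i = Inr a \<longrightarrow> a \<in> A \<inter> U"
    "\<And>e. env e \<Longrightarrow> P e \<longleftrightarrow> sat M X (\<lambda>i. case_sum e id (\<rho> i)) p"
    unfolding dfn_def by blast
  let ?\<rho> = "\<lambda>i. map_sum \<tau> id (\<rho> i)"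
  have "(\<lambda>i. case_sum (\<lambda>i. e (\<tau> i)) id (\<rho> i)) = (\<lambda>i. case_sum e id (?\<rho> i))" for e :: "nat \<Rightarrow> 'a"
    by (rule ext) (auto split: sum.splits simp: map_sum_def)
  moreover have "\<forall>i a. ?\<rho> i = Inr a \<longrightarrow> a \<in> A \<inter> U"
  proof (intro allI impI)
    fix i a assume "?\<rho> i = Inr a"
    then have "\<rho> i = Inr a" by (cases "\<rho> i") auto
    then show "a \<in> A \<inter> U" using p by blast
  qed
  ultimately show ?thesis unfolding dfn_def using p(1)
    by (intro exI[of _ p] exI[of _ ?\<rho>]) (simp add: p(3))
qed

definition mrg :: "nat \<Rightarrow> (nat \<Rightarrow> 'a) \<Rightarrow> (nat \<Rightarrow> 'a) \<Rightarrow> nat \<Rightarrow> 'a" where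
  "mrg n e r = (\<lambda>i. if i < n then e i else r i)"

lemma env_mrg [simp]: "env e \<Longrightarrow> env r \<Longrightarrow> env (mrg n e r)"
  by (auto simp: env_def mrg_def)

text \<open>Arguments and parameters are put into disjoint blocks of variables. The formula
  \<open>p\<close> is the same for all \<open>e\<close>, and only the tail \<open>r\<close> varies
  with \<open>e\<close>; \<open>merge\<close> inherits this uniformity.\<close>

lemma dfn_split:
  assumes "dfn A P"
  obtains p where "C p"
    "\<And>e. env e \<Longrightarrow> \<exists>r. env r \<and> (\<forall>e'. env e' \<longrightarrow> (P (mrg n e' e) \<longleftrightarrow> sat M X (mrg n e' r) p))"
proof -
  obtain p \<rho> where p: "C p" "\<forall>i a. \<rho> i = Inr a \<longrightarrow> a \<in> A \<inter> U"
    "\<And>e. env e \<Longrightarrow> P e \<longleftrightarrow> sat M X (\<lambda>i. case_sum e id (\<rho> i)) p"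
    using assms(1) unfolding dfn_def by blast
  \<comment> \<open>A variable that reads one of the first \<open>n\<close> entries is renamed to
    that entry. Any other variable \<open>i\<close> moves to \<open>n + i\<close>, where
    \<open>?r\<close> stores what it read.\<close>
  let ?\<tau> = "\<lambda>i. case \<rho> i of Inl j \<Rightarrow> if j < n then j else n + i | Inr _ \<Rightarrow> n + i"
  let ?r = "\<lambda>e i. case_sum e id (\<rho> (i - n))"
  have 1: "env (?r e)" if "env e" for e
    using that p(2) by (auto simp: env_def split: sum.splits)
  have 2: "P (mrg n e' e) \<longleftrightarrow> sat M X (mrg n e' (?r e)) (subst (\<lambda>i. Var (?\<tau> i)) p)"
    if "env e" "env e'" for e e'
  proof -
    have "(\<lambda>i. case_sum (mrg n e' e) id (\<rho> i)) = (\<lambda>i. eval M (mrg n e' (?r e)) (Var (?\<tau> i)))"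
      by (rule ext) (auto simp: mrg_def split: sum.splits)
    then show ?thesis using p(3)[of "mrg n e' e"] that by (simp add: sat_subst)
  qed
  have "C (subst (\<lambda>i. Var (?\<tau> i)) p)" by (rule C_rename[OF p(1)])
  then show ?thesis
  proof (rule that)
    fix e assume e: "env e"
    show "\<exists>r. env r \<and> (\<forall>e'. env e' \<longrightarrow> (P (mrg n e' e) \<longleftrightarrow>
        sat M X (mrg n e' r) (subst (\<lambda>i. Var (?\<tau> i)) p)))"
      using 1[OF e] 2[OF e] by blast
  qed
qed

lemma dfn_support:
  assumes "dfn A P"
  obtains n where "\<And>e e'. env e \<Longrightarrow> env e' \<Longrightarrow> (\<And>i. i < n \<Longrightarrow> e i = e' i) \<Longrightarrow> P e \<longleftrightarrow> P e'"
proof -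
  obtain p \<rho> where p: "C p" "\<forall>i a. \<rho> i = Inr a \<longrightarrow> a \<in> A \<inter> U"
    "\<And>e. env e \<Longrightarrow> P e \<longleftrightarrow> sat M X (\<lambda>i. case_sum e id (\<rho> i)) p"
    using assms(1) unfolding dfn_def by blast
  have "finite (\<Union>i\<in>fv p. {j. \<rho> i = Inl j})"
  proof (intro finite_UN_I finite_fv)
    fix i
    show "finite {j. \<rho> i = Inl j}"
      by (rule finite_subset[where B = "{projl (\<rho> i)}"]) auto
  qed
  then obtain n where n: "\<And>i j. i \<in> fv p \<Longrightarrow> \<rho> i = Inl j \<Longrightarrow> j < n"
    unfolding finite_nat_set_iff_bounded by blast
  have "P e \<longleftrightarrow> P e'" if "env e" "env e'" and "\<And>i. i < n \<Longrightarrow> e i = e' i" for e e'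
  proof -
    have "sat M X (\<lambda>i. case_sum e id (\<rho> i)) p \<longleftrightarrow> sat M X (\<lambda>i. case_sum e' id (\<rho> i)) p"
      using n by (intro sat_cong_fv) (auto split: sum.splits intro!: that(3))
    then show ?thesis using p(3) that by simp
  qed
  then show ?thesis using that by blast
qed

lemma trm_rename: "trm A t \<Longrightarrow> trm A (\<lambda>e. t (\<lambda>i. e (\<tau> i)))"
  using dfn_rename[of A "\<lambda>e. e 0 = t (\<lambda>i. e (Suc i))" "case_nat 0 (\<lambda>i. Suc (\<tau> i))"]
  by (auto simp: trm_def)

lemma dfn_comp:
  assumes "trm A t" "dfn A P" shows "dfn A (\<lambda>e. P (case_nat (t e) e))"
proof -
  have "dfn A (\<lambda>e. \<exists>x\<in>U. x = t e \<and> P (case_nat x e))"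
    by (rule dfn_ex, rule dfn_conj) (use assms in \<open>simp_all add: trm_def\<close>)
  then show ?thesis
    by (rule dfn_cong) (use assms in \<open>auto dest: trm_in\<close>)
qed

lemma dfn_subst_upto:
  "(\<And>i. trm A (f i)) \<Longrightarrow> dfn A P \<Longrightarrow> dfn A (\<lambda>e. P (\<lambda>i. if i < j then f i e else e (i - j)))"
proof (induction j arbitrary: f)
  case (Suc j)
  let ?f = "\<lambda>i e. f i (\<lambda>i. e (Suc i))"
  have "dfn A (\<lambda>e. P (\<lambda>i. if i < j then ?f i e else e (i - j)))"
    using Suc.prems by (intro Suc.IH) (auto intro: trm_rename)
  from dfn_comp[OF Suc.prems(1)[of j] this] show ?case
  proof (rule dfn_cong, goal_cases)
    case (1 e)
    have "(\<lambda>i. if i < j then ?f i (case_nat (f j e) e) else case_nat (f j e) e (i - j)) =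
        (\<lambda>i. if i < Suc j then f i e else e (i - Suc j))"
    proof
      fix i
      show "(if i < j then ?f i (case_nat (f j e) e) else case_nat (f j e) e (i - j)) =
        (if i < Suc j then f i e else e (i - Suc j))"
      proof (cases "i \<le> j")
        case False
        then have "i - j = Suc (i - Suc j)" by simp
        with False show ?thesis by simp
      qed auto
    qed
    then show ?case by simp
  qed
qed simp

text \<open>\<open>dfn_comp\<close> replaces one entry at a time and so handles finitely many of
  them; finite support makes the remaining entries irrelevant.\<close>

lemma dfn_subst:
  assumes "\<And>i. trm A (f i)" "dfn A P" shows "dfn A (\<lambda>e. P (\<lambda>i. f i e))"
proof -
  obtain n where n: "\<And>e e'. env e \<Longrightarrow> env e' \<Longrightarrow> (\<And>i. i < n \<Longrightarrow> e i = e' i) \<Longrightarrow> P e \<longleftrightarrow> P e'"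
    using dfn_support[OF assms(2)] by blast
  show ?thesis
    by (rule dfn_cong[OF dfn_subst_upto[OF assms, where j = n]])
      (rule n, auto simp: env_def intro!: trm_in[OF assms(1)])
qed

lemma trm_var: "trm A (\<lambda>e. e i)"
  using dfn_sat[OF C_Eq[of "Var 0" "Var (Suc i)"]] by (simp add: trm_def)

lemma trm_const: "a \<in> A \<Longrightarrow> a \<in> U \<Longrightarrow> trm A (\<lambda>e. a)"
  unfolding trm_def dfn_def
  by (auto intro!: exI[of _ "Eq (Var 0) (Var 1)"] C_Eq exI[of _ "\<lambda>i. if i = 0 then Inl 0 else Inr a"] split: if_splits)

lemma dfn_app1:
  assumes "dfn A (\<lambda>e. R (e 0))" "trm A s" shows "dfn A (\<lambda>e. R (s e))"
  using dfn_subst[of A "\<lambda>i. if i = 0 then s else (\<lambda>e. e 0)", OF _ assms(1)] assms trm_var by simp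

lemma dfn_app2:
  assumes "dfn A (\<lambda>e. R (e 0) (e 1))" "trm A s" "trm A t" shows "dfn A (\<lambda>e. R (s e) (t e))"
  using dfn_subst[of A "\<lambda>i. if i = 0 then s else if i = 1 then t else (\<lambda>e. e 0)", OF _ assms(1)]
    assms trm_var by simp

lemma dfn_app3:
  assumes "dfn A (\<lambda>e. R (e 0) (e 1) (e 2))" "trm A s" "trm A t" "trm A u"
  shows "dfn A (\<lambda>e. R (s e) (t e) (u e))"
  using dfn_subst[of A "\<lambda>i. if i = 0 then s else if i = 1 then t else if i = 2 then u else (\<lambda>e. e 0)", OF _ assms(1)]
    assms trm_var by simp

lemma dfn_eq: "trm A s \<Longrightarrow> trm A t \<Longrightarrow> dfn A (\<lambda>e. s e = t e)"
  using dfn_sat[OF C_Eq[of "Var 0" "Var 1"], of A] by (simp add: dfn_app2[of A "\<lambda>x y. x = y"])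

lemma dfn_less: "trm A s \<Longrightarrow> trm A t \<Longrightarrow> dfn A (\<lambda>e. s e \<prec> t e)"
  using dfn_sat[OF C_Lt[of "Var 0" "Var 1"], of A] by (simp add: dfn_app2[of A "\<lambda>x y. x \<prec> y"])

lemma dfn_const: "dfn A (\<lambda>e. Q)"
proof (cases Q)
  case True
  then show ?thesis using dfn_sat[OF C_Eq[of "Var 0" "Var 0"], of A] by simp
next
  case False
  then show ?thesis using dfn_neg[OF dfn_sat[OF C_Eq[of "Var 0" "Var 0"]], of A] by simp
qed

lemma dfn_disj:
  assumes "dfn A P" "dfn A Q" shows "dfn A (\<lambda>e. P e \<or> Q e)"
  using dfn_neg[OF dfn_conj[OF dfn_neg[OF assms(1)] dfn_neg[OF assms(2)]]] by simp

lemma dfn_imp: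
  assumes "dfn A P" "dfn A Q" shows "dfn A (\<lambda>e. P e \<longrightarrow> Q e)"
  using dfn_disj[OF dfn_neg[OF assms(1)] assms(2)] by (simp only: imp_conv_disj)

lemma dfn_iff:
  assumes "dfn A P" "dfn A Q" shows "dfn A (\<lambda>e. P e \<longleftrightarrow> Q e)"
  using dfn_conj[OF dfn_imp[OF assms] dfn_imp[OF assms(2,1)]] by (simp only: iff_conv_conj_imp)

lemma dfn_all:
  assumes "dfn A (\<lambda>e. P (e 0) (\<lambda>i. e (Suc i)))" shows "dfn A (\<lambda>e. \<forall>x\<in>U. P x e)"
  using dfn_neg[OF dfn_ex[of A "\<lambda>x e. \<not> P x e", OF dfn_neg[OF assms]]] by simp

lemma trm_zero: "trm A (\<lambda>e. \<zero>)"
  using dfn_sat[OF C_Eq[of "Var 0" "Zero"]] by (simp add: trm_def)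

lemma trm_suc:
  assumes "trm A s" shows "trm A (\<lambda>e. \<S> (s e))"
proof -
  have "dfn A (\<lambda>e. e 0 = \<S> (e 1))"
    using dfn_sat[OF C_Eq[of "Var 0" "Succ (Var 1)"]] by simp
  from dfn_app2[OF this trm_var trm_rename[OF assms]] show ?thesis
    using trm_in[OF assms] by (simp add: trm_def)
qed

lemma trm_plus:
  assumes "trm A s" "trm A t" shows "trm A (\<lambda>e. s e \<oplus> t e)"
proof -
  have "dfn A (\<lambda>e. e 0 = e 1 \<oplus> e 2)"
    using dfn_sat[OF C_Eq[of "Var 0" "Add (Var 1) (Var 2)"]] by simp
  from dfn_app3[OF this trm_var trm_rename[OF assms(1)] trm_rename[OF assms(2)]] show ?thesis
    using trm_in[OF assms(1)] trm_in[OF assms(2)] by (simp add: trm_def)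
qed

lemma trm_times:
  assumes "trm A s" "trm A t" shows "trm A (\<lambda>e. s e \<otimes> t e)"
proof -
  have "dfn A (\<lambda>e. e 0 = e 1 \<otimes> e 2)"
    using dfn_sat[OF C_Eq[of "Var 0" "Mul (Var 1) (Var 2)"]] by simp
  from dfn_app3[OF this trm_var trm_rename[OF assms(1)] trm_rename[OF assms(2)]] show ?thesis
    using trm_in[OF assms(1)] trm_in[OF assms(2)] by (simp add: trm_def)
qed

lemmas dfn_intros = dfn_neg dfn_conj dfn_ex dfn_eq dfn_less dfn_disj dfn_imp dfn_iff dfn_all
  trm_zero trm_suc trm_plus trm_times trm_var trm_const dfn_const closed

text \<open>The induction axiom as a proof rule. The parameters of \<open>P\<close> sit in the tail
  \<open>s\<close> of the assignment, and definability of \<open>P\<close> becomes the case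
  \<open>dfn\<close>.\<close>

lemma dfn_induct [consumes 1, case_names dfn zero suc]:
  assumes "x \<in> U" and P: "dfn U (\<lambda>e. P (e 0))"
    and "P \<zero>" and "\<And>x. x \<in> U \<Longrightarrow> P x \<Longrightarrow> P (\<S> x)"
  shows "P x"
proof -
  obtain p r where p: "C p" "env r"
    and *: "\<And>e'. env e' \<Longrightarrow> P (mrg 1 e' (\<lambda>_. \<zero>) 0) \<longleftrightarrow> sat M X (mrg 1 e' r) p"
    using dfn_split[OF P, of 1] by (metis closed(1) env_const)
  define s where "s = (\<lambda>i. r (Suc i))"
  have s: "mrg 1 (\<lambda>_. y) r = case_nat y s" for y
    by (rule ext) (auto simp: mrg_def s_def split: nat.splits)
  have sat: "P y \<longleftrightarrow> sat M X (case_nat y s) p" if "y \<in> U" for y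
    using *[of "\<lambda>_. y"] that unfolding s by (simp add: mrg_def)
  have sub: "(\<lambda>i. eval M (case_nat y s) (case_nat (Succ (Var 0)) (\<lambda>i. Var (Suc i)) i)) = case_nat (\<S> y) s"
    "(\<lambda>i. eval M s (case_nat Zero Var i)) = case_nat \<zero> s" for y
    by (rule ext, simp split: nat.splits)+
  have "env s" using p by (simp add: s_def)
  then have "sat M X s (induction_axiom p)" using induct[OF p(1)] by (simp add: env_range)
  then show ?thesis using assms(1,3,4)
    by (auto simp: induction_axiom_def sat_subst sub sat[symmetric])
qed

section \<open>Arithmetic\<close>

lemma sat_basic:
  assumes "p \<in> basic_axioms" "x \<in> U" "y \<in> U" shows "sat M X (case_nat x (\<lambda>_. y)) p"
  by (rule basic[OF assms(1)]) (use assms in \<open>simp add: env_range[symmetric]\<close>)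

lemma S_neq_0 [simp]: "x \<in> U \<Longrightarrow> \<S> x \<noteq> \<zero>"
  using sat_basic[of "Neg (Eq (Succ (Var 0)) Zero)" x x] by (simp add: basic_axioms_def)

lemma zero_neq_S [simp]: "x \<in> U \<Longrightarrow> \<zero> \<noteq> \<S> x"
  by (metis S_neq_0)

lemma S_inj [simp]: "x \<in> U \<Longrightarrow> y \<in> U \<Longrightarrow> \<S> x = \<S> y \<longleftrightarrow> x = y"
  using sat_basic[of "Imp (Eq (Succ (Var 0)) (Succ (Var 1))) (Eq (Var 0) (Var 1))" x y]
  by (auto simp add: basic_axioms_def)

lemma add_0 [simp]: "x \<in> U \<Longrightarrow> x \<oplus> \<zero> = x"
  using sat_basic[of "Eq (Add (Var 0) Zero) (Var 0)" x x] by (simp add: basic_axioms_def)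

lemma add_S [simp]: "x \<in> U \<Longrightarrow> y \<in> U \<Longrightarrow> x \<oplus> \<S> y = \<S> (x \<oplus> y)"
  using sat_basic[of "Eq (Add (Var 0) (Succ (Var 1))) (Succ (Add (Var 0) (Var 1)))" x y]
  by (simp add: basic_axioms_def)

lemma mul_0 [simp]: "x \<in> U \<Longrightarrow> x \<otimes> \<zero> = \<zero>"
  using sat_basic[of "Eq (Mul (Var 0) Zero) Zero" x x] by (simp add: basic_axioms_def)

lemma mul_S [simp]: "x \<in> U \<Longrightarrow> y \<in> U \<Longrightarrow> x \<otimes> \<S> y = x \<otimes> y \<oplus> x"
  using sat_basic[of "Eq (Mul (Var 0) (Succ (Var 1))) (Add (Mul (Var 0) (Var 1)) (Var 0))" x y]
  by (simp add: basic_axioms_def)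

lemma not_less_0 [simp]: "x \<in> U \<Longrightarrow> \<not> x \<prec> \<zero>"
  using sat_basic[of "Neg (Lt (Var 0) Zero)" x x] by (simp add: basic_axioms_def)

lemma less_S: "x \<in> U \<Longrightarrow> y \<in> U \<Longrightarrow> x \<prec> \<S> y \<longleftrightarrow> x \<prec> y \<or> x = y"
  using sat_basic[of "Iff (Lt (Var 0) (Succ (Var 1))) (Disj (Lt (Var 0) (Var 1)) (Eq (Var 0) (Var 1)))" x y]
  by (auto simp add: basic_axioms_def)

lemma cases_U:
  assumes "x \<in> U" shows "x = \<zero> \<or> (\<exists>y\<in>U. x = \<S> y)"
  using assms(1)
proof (induction rule: dfn_induct)
  case dfn show ?case by (intro dfn_intros assms)
qed (use assms in auto)

lemma add_0_left [simp]:
  assumes "x \<in> U" shows "\<zero> \<oplus> x = x"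
  using assms(1)
proof (induction rule: dfn_induct)
  case dfn show ?case by (intro dfn_intros assms)
qed (use assms in auto)

lemma add_S_left [simp]:
  assumes "y \<in> U" "x \<in> U" shows "\<S> x \<oplus> y = \<S> (x \<oplus> y)"
  using assms(1)
proof (induction rule: dfn_induct)
  case dfn show ?case by (intro dfn_intros assms)
qed (use assms in auto)

lemma add_comm:
  assumes "y \<in> U" "x \<in> U" shows "x \<oplus> y = y \<oplus> x"
  using assms(1)
proof (induction rule: dfn_induct)
  case dfn show ?case by (intro dfn_intros assms)
qed (use assms in auto)

lemma add_assoc:
  assumes "z \<in> U" "x \<in> U" "y \<in> U" shows "x \<oplus> y \<oplus> z = x \<oplus> (y \<oplus> z)"
  using assms(1)
proof (induction rule: dfn_induct)
  case dfn show ?case by (intro dfn_intros assms)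
qed (use assms in auto)

lemma add_left_comm: "x \<in> U \<Longrightarrow> y \<in> U \<Longrightarrow> z \<in> U \<Longrightarrow> x \<oplus> (y \<oplus> z) = y \<oplus> (x \<oplus> z)"
  by (metis add_assoc add_comm)

lemmas add_ac = add_assoc add_comm add_left_comm

lemma add_cancel_right [simp]:
  assumes "z \<in> U" "x \<in> U" "y \<in> U" shows "x \<oplus> z = y \<oplus> z \<longleftrightarrow> x = y"
  using assms(1)
proof (induction rule: dfn_induct)
  case dfn show ?case by (intro dfn_intros assms)
qed (use assms in auto)

lemma add_cancel_left [simp]: "z \<in> U \<Longrightarrow> x \<in> U \<Longrightarrow> y \<in> U \<Longrightarrow> z \<oplus> x = z \<oplus> y \<longleftrightarrow> x = y"
  by (metis add_cancel_right add_comm)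

lemma add_eq_0 [simp]: "x \<in> U \<Longrightarrow> y \<in> U \<Longrightarrow> x \<oplus> y = \<zero> \<longleftrightarrow> x = \<zero> \<and> y = \<zero>"
  using cases_U[of y] by auto

lemma add_eq_self [simp]: "x \<in> U \<Longrightarrow> y \<in> U \<Longrightarrow> x \<oplus> y = x \<longleftrightarrow> y = \<zero>"
  by (metis add_0 add_cancel_left closed(1))

lemma less_iff:
  assumes "y \<in> U" "x \<in> U" shows "x \<prec> y \<longleftrightarrow> (\<exists>z\<in>U. y = x \<oplus> \<S> z)"
  using assms(1)
proof (induction rule: dfn_induct)
  case dfn show ?case by (intro dfn_intros assms)
next
  case (suc y)
  have "(\<exists>z\<in>U. \<S> y = x \<oplus> \<S> z) \<longleftrightarrow> (\<exists>z\<in>U. y = x \<oplus> z)"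
    using suc(1) assms by simp
  also have "\<dots> \<longleftrightarrow> y = x \<or> (\<exists>z\<in>U. y = x \<oplus> \<S> z)"
    using add_0[OF assms(2)] cases_U by (metis closed(1,2))
  finally show ?case using suc(2) less_S[OF assms(2) suc(1)] by blast
qed (use assms in auto)

lemma less_irrefl [simp]: "x \<in> U \<Longrightarrow> \<not> x \<prec> x"
  by (metis S_neq_0 add_eq_self closed(2) less_iff)

lemma less_trans: "x \<prec> y \<Longrightarrow> y \<prec> z \<Longrightarrow> x \<in> U \<Longrightarrow> y \<in> U \<Longrightarrow> z \<in> U \<Longrightarrow> x \<prec> z"
  by (auto simp: less_iff) (metis add_S add_assoc closed(2,3))

lemma less_asym: "x \<prec> y \<Longrightarrow> y \<prec> x \<Longrightarrow> x \<in> U \<Longrightarrow> y \<in> U \<Longrightarrow> False"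
  using less_irrefl less_trans by blast

lemma zero_less_S [simp]: "x \<in> U \<Longrightarrow> \<zero> \<prec> \<S> x"
  by (auto simp: less_iff)

lemma zero_less: "x \<in> U \<Longrightarrow> \<zero> \<prec> x \<longleftrightarrow> x \<noteq> \<zero>"
  using cases_U by fastforce

lemma less_self_S [simp]: "x \<in> U \<Longrightarrow> x \<prec> \<S> x"
  by (simp add: less_S)

lemma linear:
  assumes "x \<in> U" "y \<in> U" shows "x \<prec> y \<or> x = y \<or> y \<prec> x"
  using assms(1)
proof (induction rule: dfn_induct)
  case dfn show ?case by (intro dfn_intros assms)
next
  case zero then show ?case using assms by (auto simp: zero_less)
next
  case (suc x)
  show ?case
  proof (cases "x \<prec> y")
    case True
    then obtain z where z: "z \<in> U" "y = x \<oplus> \<S> z" using less_iff suc assms by blast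
    then have "y = \<S> x \<oplus> z" using suc by simp
    then show ?thesis using cases_U[OF z(1)] suc less_iff[of y "\<S> x"] assms by auto
  next
    case False
    then show ?thesis using suc assms by (auto simp: less_S)
  qed
qed

lemma not_less: "x \<in> U \<Longrightarrow> y \<in> U \<Longrightarrow> \<not> x \<prec> y \<longleftrightarrow> y \<prec> x \<or> y = x"
  by (metis linear less_asym less_irrefl)

lemma S_less_S [simp]: "x \<in> U \<Longrightarrow> y \<in> U \<Longrightarrow> \<S> x \<prec> \<S> y \<longleftrightarrow> x \<prec> y"
  by (simp add: less_iff)

lemma add_less_right [simp]:
  assumes "x \<in> U" "y \<in> U" "z \<in> U" shows "x \<oplus> z \<prec> y \<oplus> z \<longleftrightarrow> x \<prec> y"
proof -
  have "x \<oplus> z \<oplus> \<S> w = (x \<oplus> \<S> w) \<oplus> z" if "w \<in> U" for w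
    using that assms by (simp add: add_ac)
  then have "y \<oplus> z = x \<oplus> z \<oplus> \<S> w \<longleftrightarrow> y = x \<oplus> \<S> w" if "w \<in> U" for w
    using that assms by (simp del: add_S)
  then show ?thesis using assms by (simp add: less_iff del: add_S)
qed

lemma least:
  assumes P: "dfn U (\<lambda>e. P (e 0))" and "x \<in> U" "P x"
  obtains y where "y \<in> U" "P y" "\<And>z. z \<in> U \<Longrightarrow> z \<prec> y \<Longrightarrow> \<not> P z"
proof (rule ccontr)
  assume neg: "\<not> thesis"
  have P': "dfn U (\<lambda>e. P (e i))" for i by (rule dfn_app1[OF P trm_var])
  have "x \<in> U \<Longrightarrow> \<forall>y\<in>U. y \<prec> x \<longrightarrow> \<not> P y" for x
  proof (induction rule: dfn_induct)
    case dfn show ?case by (intro dfn_intros P')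
  next
    case (suc x)
    have "\<not> P x"
    proof
      assume "P x"
      with suc have thesis by (intro that[of x]) auto
      with neg show False by blast
    qed
    with suc show ?case by (auto simp: less_S)
  qed auto
  from this[of "\<S> x"] show False using assms by auto
qed

text \<open>Since \<open>P y b\<close> persists when \<open>b\<close> grows, it can express that
  \<open>b\<close> exceeds everything attached to \<open>y\<close>, and two bounds are merged by
  exceeding their sum. The induction stops at \<open>x\<close>, because bounds are only known to
  exist below it.\<close>

lemma collection:
  assumes P: "dfn U (\<lambda>e. P (e 0) (e 1))" and "x \<in> U"
    and "\<And>y. y \<in> U \<Longrightarrow> y \<prec> x \<Longrightarrow> \<exists>b\<in>U. P y b"
    and mono: "\<And>y b b'. y \<in> U \<Longrightarrow> b \<in> U \<Longrightarrow> b' \<in> U \<Longrightarrow> b \<prec> b' \<Longrightarrow> P y b \<Longrightarrow> P y b'"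
  shows "\<exists>b\<in>U. \<forall>y\<in>U. y \<prec> x \<longrightarrow> P y b"
proof -
  have P': "dfn U (\<lambda>e. P (e i) (e j))" for i j by (rule dfn_app2[OF P trm_var trm_var])
  have "z \<in> U \<Longrightarrow> (z \<prec> x \<or> z = x) \<longrightarrow> (\<exists>b\<in>U. \<forall>y\<in>U. y \<prec> z \<longrightarrow> P y b)" for z
  proof (induction rule: dfn_induct)
    case dfn show ?case by (intro dfn_intros P' \<open>x \<in> U\<close>)
  next
    case (suc z)
    show ?case
    proof
      assume "\<S> z \<prec> x \<or> \<S> z = x"
      then have "z \<prec> x" using suc less_self_S less_trans assms(2) by (metis closed(2))
      then obtain b where b: "b \<in> U" "\<And>y. y \<in> U \<Longrightarrow> y \<prec> z \<Longrightarrow> P y b" using suc by blast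
      obtain b' where b': "b' \<in> U" "P z b'" using assms(3) suc \<open>z \<prec> x\<close> by blast
      have "b \<prec> \<S> (b \<oplus> b')" "b' \<prec> \<S> (b \<oplus> b')"
        using b b' less_iff[of "\<S> (b \<oplus> b')" b] less_iff[of "\<S> (b \<oplus> b')" b'] add_comm by auto
      then have "\<forall>y\<in>U. y \<prec> \<S> z \<longrightarrow> P y (\<S> (b \<oplus> b'))"
        using mono b b' suc(1) by (auto simp: less_S)
      moreover have "\<S> (b \<oplus> b') \<in> U" using b b' by simp
      ultimately show "\<exists>b\<in>U. \<forall>y\<in>U. y \<prec> \<S> z \<longrightarrow> P y b" by blast
    qed
  qed auto
  then show ?thesis using assms(2) by blast
qed

lemma mul_0_left [simp]:
  assumes "x \<in> U" shows "\<zero> \<otimes> x = \<zero>"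
  using assms(1)
proof (induction rule: dfn_induct)
  case dfn show ?case by (intro dfn_intros assms)
qed (use assms in auto)

lemma mul_S_left [simp]:
  assumes "y \<in> U" "x \<in> U" shows "\<S> x \<otimes> y = x \<otimes> y \<oplus> y"
  using assms(1)
proof (induction rule: dfn_induct)
  case dfn show ?case by (intro dfn_intros assms)
qed (use assms in \<open>auto simp: add_ac\<close>)

lemma mul_comm:
  assumes "y \<in> U" "x \<in> U" shows "x \<otimes> y = y \<otimes> x"
  using assms(1)
proof (induction rule: dfn_induct)
  case dfn show ?case by (intro dfn_intros assms)
qed (use assms in auto)

lemma mul_add:
  assumes "z \<in> U" "x \<in> U" "y \<in> U" shows "x \<otimes> (y \<oplus> z) = x \<otimes> y \<oplus> x \<otimes> z"
  using assms(1)
proof (induction rule: dfn_induct)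
  case dfn show ?case by (intro dfn_intros assms)
qed (use assms in \<open>auto simp: add_ac\<close>)

lemma add_mul: "z \<in> U \<Longrightarrow> x \<in> U \<Longrightarrow> y \<in> U \<Longrightarrow> (y \<oplus> z) \<otimes> x = y \<otimes> x \<oplus> z \<otimes> x"
  by (metis mul_add mul_comm closed(3))

lemma mul_assoc:
  assumes "z \<in> U" "x \<in> U" "y \<in> U" shows "x \<otimes> y \<otimes> z = x \<otimes> (y \<otimes> z)"
  using assms(1)
proof (induction rule: dfn_induct)
  case dfn show ?case by (intro dfn_intros assms)
qed (use assms in \<open>auto simp: mul_add\<close>)

lemma mul_eq_0 [simp]: "x \<in> U \<Longrightarrow> y \<in> U \<Longrightarrow> x \<otimes> y = \<zero> \<longleftrightarrow> x = \<zero> \<or> y = \<zero>"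
  using cases_U[of x] cases_U[of y] by auto

abbreviation leq (infix "\<preceq>" 50) where "x \<preceq> y \<equiv> x \<prec> y \<or> x = y"

lemma leq_iff:
  assumes "x \<in> U" "y \<in> U" shows "x \<preceq> y \<longleftrightarrow> (\<exists>z\<in>U. y = x \<oplus> z)"
proof
  assume "x \<preceq> y"
  then show "\<exists>z\<in>U. y = x \<oplus> z"
  proof
    assume "x \<prec> y"
    then show ?thesis using less_iff assms closed(2) by blast
  next
    assume "x = y"
    then show ?thesis using assms by (intro bexI[of _ \<zero>]) auto
  qed
next
  assume "\<exists>z\<in>U. y = x \<oplus> z"
  then obtain z where z: "z \<in> U" "y = x \<oplus> z" by blast
  then show "x \<preceq> y" using cases_U[OF z(1)] less_iff[of y x] assms by auto
qed

lemma leqE: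
  assumes "x \<preceq> y" "x \<in> U" "y \<in> U" obtains z where "z \<in> U" "y = x \<oplus> z"
  using assms leq_iff by blast

lemma leq_less_trans: "x \<preceq> y \<Longrightarrow> y \<prec> z \<Longrightarrow> x \<in> U \<Longrightarrow> y \<in> U \<Longrightarrow> z \<in> U \<Longrightarrow> x \<prec> z"
  using less_trans by blast

lemma less_leq_trans: "x \<prec> y \<Longrightarrow> y \<preceq> z \<Longrightarrow> x \<in> U \<Longrightarrow> y \<in> U \<Longrightarrow> z \<in> U \<Longrightarrow> x \<prec> z"
  using less_trans by blast

lemma S_leq_iff: "x \<in> U \<Longrightarrow> y \<in> U \<Longrightarrow> \<S> x \<preceq> y \<longleftrightarrow> x \<prec> y"
  by (metis not_less less_S closed(2))

lemma leq_trans: "x \<preceq> y \<Longrightarrow> y \<preceq> z \<Longrightarrow> x \<in> U \<Longrightarrow> y \<in> U \<Longrightarrow> z \<in> U \<Longrightarrow> x \<preceq> z"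
  using less_trans by blast

lemma leq_add: "x \<in> U \<Longrightarrow> y \<in> U \<Longrightarrow> x \<preceq> x \<oplus> y" "x \<in> U \<Longrightarrow> y \<in> U \<Longrightarrow> x \<preceq> y \<oplus> x"
  using leq_iff[of x "x \<oplus> y"] add_comm[of x y] by auto

lemma mul_mono:
  assumes "x \<preceq> x'" "y \<preceq> y'" and U: "x \<in> U" "y \<in> U" "x' \<in> U" "y' \<in> U"
  shows "x \<otimes> y \<preceq> x' \<otimes> y'"
proof -
  obtain z where z: "z \<in> U" "x' = x \<oplus> z" using leqE[OF assms(1) U(1,3)] .
  obtain w where w: "w \<in> U" "y' = y \<oplus> w" using leqE[OF assms(2) U(2,4)] .
  from z w have "x' \<otimes> y' = x \<otimes> y \<oplus> (z \<otimes> y \<oplus> (x \<oplus> z) \<otimes> w)" "z \<otimes> y \<oplus> (x \<oplus> z) \<otimes> w \<in> U"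
    using U by (auto simp: mul_add add_mul add_ac)
  then show ?thesis using U leq_iff[of "x \<otimes> y" "x' \<otimes> y'"] by auto
qed

lemma add_mono:
  assumes "x \<preceq> x'" "y \<preceq> y'" and U: "x \<in> U" "y \<in> U" "x' \<in> U" "y' \<in> U"
  shows "x \<oplus> y \<preceq> x' \<oplus> y'"
proof -
  obtain z where z: "z \<in> U" "x' = x \<oplus> z" using leqE[OF assms(1) U(1,3)] .
  obtain w where w: "w \<in> U" "y' = y \<oplus> w" using leqE[OF assms(2) U(2,4)] .
  from z w have "x' \<oplus> y' = x \<oplus> y \<oplus> (z \<oplus> w)" "z \<oplus> w \<in> U"
    using U by (auto simp: add_ac)
  then show ?thesis using U leq_iff[of "x \<oplus> y" "x' \<oplus> y'"] by auto
qed

text \<open>A variant of Cantor's pairing that avoids halving. It is injective and monotone but not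
  onto, which suffices for coding.\<close>

definition pr :: "'a \<Rightarrow> 'a \<Rightarrow> 'a" where "pr x y = (x \<oplus> y) \<otimes> (x \<oplus> y) \<oplus> x"

lemma pr_in [simp]: "x \<in> U \<Longrightarrow> y \<in> U \<Longrightarrow> pr x y \<in> U"
  by (simp add: pr_def)

lemma trm_pr: "trm A s \<Longrightarrow> trm A t \<Longrightarrow> trm A (\<lambda>e. pr (s e) (t e))"
  unfolding pr_def by (intro dfn_intros)

lemma pr_mono: "x \<preceq> x' \<Longrightarrow> y \<preceq> y' \<Longrightarrow> x \<in> U \<Longrightarrow> y \<in> U \<Longrightarrow> x' \<in> U \<Longrightarrow> y' \<in> U \<Longrightarrow> pr x y \<preceq> pr x' y'"
  unfolding pr_def by (intro add_mono mul_mono) auto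

text \<open>\<open>pr x y\<close> lies between the squares of \<open>x + y\<close> and \<open>x + y + 1\<close>.\<close>

lemma pr_less:
  assumes "x \<in> U" "y \<in> U" "x' \<in> U" "y' \<in> U" "x \<oplus> y \<prec> x' \<oplus> y'"
  shows "pr x y \<prec> pr x' y'"
proof -
  define s where "s = x \<oplus> y"
  have s: "s \<in> U" "x \<preceq> s" using assms by (auto simp: s_def leq_add)
  have "\<S> s \<preceq> x' \<oplus> y'"
    using assms s S_leq_iff[of s "x' \<oplus> y'"] by (simp add: s_def)
  then have "\<S> s \<otimes> \<S> s \<preceq> (x' \<oplus> y') \<otimes> (x' \<oplus> y')" using assms s by (intro mul_mono) auto
  moreover have "(x' \<oplus> y') \<otimes> (x' \<oplus> y') \<preceq> pr x' y'" using assms unfolding pr_def by (intro leq_add) auto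
  ultimately have 1: "\<S> s \<otimes> \<S> s \<preceq> pr x' y'" by (rule leq_trans) (use assms s in auto)
  have "pr x y \<preceq> s \<otimes> s \<oplus> s" using s assms unfolding pr_def s_def[symmetric] by (intro add_mono) auto
  moreover have "s \<otimes> s \<oplus> s \<prec> \<S> s \<otimes> \<S> s"
    using s by (auto simp: less_S leq_add)
  ultimately have "pr x y \<prec> \<S> s \<otimes> \<S> s" by (rule leq_less_trans) (use assms s in auto)
  then show ?thesis using 1 by (rule less_leq_trans) (use assms s in auto)
qed

lemma pr_inj [simp]:
  assumes "x \<in> U" "y \<in> U" "x' \<in> U" "y' \<in> U"
  shows "pr x y = pr x' y' \<longleftrightarrow> x = x' \<and> y = y'"
proof
  assume eq: "pr x y = pr x' y'"
  have s: "x \<oplus> y = x' \<oplus> y'"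
    using linear[of "x \<oplus> y" "x' \<oplus> y'"] pr_less[of x y x' y'] pr_less[of x' y' x y] eq assms
      less_irrefl[of "pr x' y'"] by simp blast
  then have "x = x'" using eq assms unfolding pr_def s by simp
  with s show "x = x' \<and> y = y'" using assms by simp
qed simp

section \<open>Divisibility and the coding of bounded definable sets\<close>

definition dv :: "'a \<Rightarrow> 'a \<Rightarrow> bool" where "dv d x \<longleftrightarrow> (\<exists>q\<in>U. x = d \<otimes> q)"

lemma dfn_dv:
  assumes "trm A s" "trm A t" shows "dfn A (\<lambda>e. dv (s e) (t e))"
  by (rule dfn_app2[OF _ assms], unfold dv_def, intro dfn_intros)

lemma dv_refl [simp]: "x \<in> U \<Longrightarrow> dv x x"
  unfolding dv_def by (rule bexI[of _ "\<S> \<zero>"]) auto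

lemma dv_0 [simp]: "x \<in> U \<Longrightarrow> dv x \<zero>"
  unfolding dv_def by (rule bexI[of _ "\<zero>"]) auto

lemma dv_mul: "dv d x \<Longrightarrow> d \<in> U \<Longrightarrow> x \<in> U \<Longrightarrow> y \<in> U \<Longrightarrow> dv d (x \<otimes> y)"
  unfolding dv_def by (metis closed(4) mul_assoc)

lemma dv_mul2: "dv d y \<Longrightarrow> d \<in> U \<Longrightarrow> x \<in> U \<Longrightarrow> y \<in> U \<Longrightarrow> dv d (x \<otimes> y)"
  by (metis dv_mul mul_comm)

lemma dv_trans: "dv d x \<Longrightarrow> dv x y \<Longrightarrow> d \<in> U \<Longrightarrow> x \<in> U \<Longrightarrow> y \<in> U \<Longrightarrow> dv d y"
  using dv_mul[of d x] unfolding dv_def[of x] by blast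

lemma dv_diff:
  assumes "dv d (x \<oplus> y)" "dv d x" "d \<in> U" "x \<in> U" "y \<in> U" shows "dv d y"
proof -
  obtain q r where q: "q \<in> U" "r \<in> U" "x \<oplus> y = d \<otimes> q" "x = d \<otimes> r"
    using assms unfolding dv_def by blast
  show ?thesis
  proof (cases "r \<preceq> q")
    case True
    then obtain z where z: "z \<in> U" "q = r \<oplus> z" using leqE q by blast
    then have "y = d \<otimes> z" using q assms by (metis add_cancel_left closed(4) mul_add)
    then show ?thesis using z dv_def by blast
  next
    case False
    then have "q \<preceq> r" using linear q by blast
    then obtain z where z: "z \<in> U" "r = q \<oplus> z" using leqE q by blast
    then have "x = x \<oplus> y \<oplus> d \<otimes> z" using q assms by (metis mul_add)
    then have "x \<oplus> (y \<oplus> d \<otimes> z) = x" using assms z by (simp add: add_assoc)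
    then have "y = \<zero>" using assms z by simp
    then show ?thesis using assms by simp
  qed
qed

lemma division:
  assumes "d \<in> U" "d \<noteq> \<zero>" "x \<in> U" shows "\<exists>q\<in>U. \<exists>r\<in>U. r \<prec> d \<and> x = d \<otimes> q \<oplus> r"
  using assms(3)
proof (induction rule: dfn_induct)
  case dfn show ?case by (intro dfn_intros assms)
next
  case zero show ?case using assms zero_less by (intro bexI[of _ \<zero>]) auto
next
  case (suc x)
  then obtain q r where q: "q \<in> U" "r \<in> U" "r \<prec> d" "x = d \<otimes> q \<oplus> r" by blast
  show ?case
  proof (cases "\<S> r = d")
    case True
    then have "\<S> x = d \<otimes> \<S> q \<oplus> \<zero>" using q assms by auto
    then show ?thesis using q assms by (metis closed(1,2) zero_less)
  next
    case False
    then have "\<S> r \<prec> d" using q assms by (metis S_less_S closed(2) less_S not_less)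
    moreover have "\<S> x = d \<otimes> q \<oplus> \<S> r" using q assms by simp
    ultimately show ?thesis using q by (metis closed(2))
  qed
qed

text \<open>The least \<open>t > 0\<close> with \<open>p\<close> dividing \<open>a t\<close> divides every such \<open>t\<close>, in particular \<open>p\<close> and \<open>q\<close>.\<close>

lemma coprime_dv:
  assumes U: "p \<in> U" "q \<in> U" "a \<in> U" "p \<noteq> \<zero>" "q \<noteq> \<zero>"
    and dv: "dv p (a \<otimes> q)"
    and coprime: "\<And>d. d \<in> U \<Longrightarrow> dv d p \<Longrightarrow> dv d q \<Longrightarrow> d = \<S> \<zero>"
  shows "dv p a"
proof -
  define P where "P = (\<lambda>t. t \<noteq> \<zero> \<and> dv p (a \<otimes> t))"
  have "dfn U (\<lambda>e. P (e 0))" unfolding P_def by (intro dfn_intros dfn_dv U)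
  moreover have "P p" "P q" using U dv by (auto simp: P_def dv_mul2)
  ultimately obtain t where t: "t \<in> U" "P t" "\<And>z. z \<in> U \<Longrightarrow> z \<prec> t \<Longrightarrow> \<not> P z"
    using least U(1) by metis
  have div: "dv t x" if x: "x \<in> U" "P x" for x
  proof -
    obtain k r where k: "k \<in> U" "r \<in> U" "r \<prec> t" "x = t \<otimes> k \<oplus> r"
      using division[of t x] t x P_def by blast
    have "a \<otimes> x = a \<otimes> t \<otimes> k \<oplus> a \<otimes> r" using k U t by (simp add: mul_add mul_assoc)
    moreover have "dv p (a \<otimes> t \<otimes> k)" using t k U by (auto simp: P_def intro: dv_mul)
    moreover have "dv p (a \<otimes> x)" using x P_def by blast
    ultimately have "dv p (a \<otimes> r)" using dv_diff U k t by (metis closed(4))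
    then have "r = \<zero>" using t(3)[of r] k by (auto simp: P_def)
    then show ?thesis using k t by (auto simp: dv_def)
  qed
  have "t = \<S> \<zero>" using coprime t(1) div \<open>P p\<close> \<open>P q\<close> U by blast
  then show ?thesis using t(2) U by (simp add: P_def)
qed

lemma dv_one:
  assumes "dv d (\<S> \<zero>)" "d \<in> U" shows "d = \<S> \<zero>"
proof -
  obtain q where q: "q \<in> U" "\<S> \<zero> = d \<otimes> q" using assms dv_def by blast
  then obtain d' q' where "d' \<in> U" "d = \<S> d'" "q' \<in> U" "q = \<S> q'"
    using cases_U[of d] cases_U[of q] assms(2) by fastforce
  then have "d' \<oplus> (q' \<oplus> d' \<otimes> q') = \<zero>" using q by (auto simp: add_ac)
  then show ?thesis using \<open>d' \<in> U\<close> \<open>q' \<in> U\<close> \<open>d = \<S> d'\<close> by simp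
qed

text \<open>Goedel's coding of finite sets by a pair of numbers.\<close>

definition elt :: "'a \<Rightarrow> 'a \<Rightarrow> 'a \<Rightarrow> bool" where "elt a b x \<longleftrightarrow> dv (\<S> (\<S> x \<otimes> b)) a"

lemma dfn_elt: "trm A s \<Longrightarrow> trm A t \<Longrightarrow> trm A u \<Longrightarrow> dfn A (\<lambda>e. elt (s e) (t e) (u e))"
  unfolding elt_def by (intro dfn_intros dfn_dv)

text \<open>Stands in for the factorial of \<open>x\<close>, whose definition by recursion would
  already require coded sequences.\<close>

lemma common_multiple:
  assumes "x \<in> U" shows "\<exists>b\<in>U. b \<noteq> \<zero> \<and> (\<forall>y\<in>U. y \<preceq> x \<longrightarrow> y \<noteq> \<zero> \<longrightarrow> dv y b)"
  using assms
proof (induction rule: dfn_induct)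
  case dfn show ?case by (intro dfn_intros dfn_dv)
next
  case zero show ?case by (rule bexI[of _ "\<S> \<zero>"]) auto
next
  case (suc x)
  then obtain b where b: "b \<in> U" "b \<noteq> \<zero>" "\<And>y. y \<in> U \<Longrightarrow> y \<preceq> x \<Longrightarrow> y \<noteq> \<zero> \<Longrightarrow> dv y b" by blast
  show ?case
  proof (intro bexI[of _ "b \<otimes> \<S> x"] conjI ballI impI)
    fix y assume y: "y \<in> U" "y \<preceq> \<S> x" "y \<noteq> \<zero>"
    then show "dv y (b \<otimes> \<S> x)"
      using suc(1) b by (auto simp: less_S simp del: mul_S intro: dv_mul dv_mul2)
  qed (use b suc(1) in \<open>auto simp del: mul_S\<close>)
qed

text \<open>With \<open>y = x \<oplus> \<S> z\<close>, a common divisor \<open>d\<close> of the two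
  moduli divides their difference \<open>\<S> z \<otimes> b\<close>. As \<open>d\<close> is coprime
  to \<open>b\<close>, it divides \<open>\<S> z\<close>, which is at most \<open>B\<close> and so
  divides \<open>b\<close>. Hence \<open>d\<close> divides both \<open>b\<close> and a multiple of
  \<open>b\<close> plus one.\<close>

lemma moduli_coprime:
  assumes U: "b \<in> U" "x \<in> U" "y \<in> U" "d \<in> U"
    and b: "\<And>y. y \<in> U \<Longrightarrow> y \<preceq> B \<Longrightarrow> y \<noteq> \<zero> \<Longrightarrow> dv y b" and "b \<noteq> \<zero>" "B \<in> U"
    and "x \<prec> y" "y \<preceq> B" and d: "dv d (\<S> (\<S> x \<otimes> b))" "dv d (\<S> (\<S> y \<otimes> b))"
  shows "d = \<S> \<zero>"
proof -
  obtain z where z: "z \<in> U" "y = x \<oplus> \<S> z" using less_iff assms by blast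
  have co: "c = \<S> \<zero>" if "c \<in> U" "dv c d" "dv c b" for c
  proof -
    have "dv c (\<S> x \<otimes> b \<oplus> \<S> \<zero>)"
      using dv_trans[of c d] that d U by simp
    moreover have "dv c (\<S> x \<otimes> b)" using that U by (intro dv_mul2) auto
    ultimately have "dv c (\<S> \<zero>)" using dv_diff that U by (metis closed(1,2,4))
    then show ?thesis using dv_one that by blast
  qed
  have "\<S> (\<S> y \<otimes> b) = \<S> (\<S> x \<otimes> b) \<oplus> \<S> z \<otimes> b"
    using z U by (simp add: add_mul add_ac)
  then have "dv d (\<S> z \<otimes> b)" using d dv_diff U z by (metis closed(2,4))
  moreover have "d \<noteq> \<zero>" using d(1) U by (auto simp: dv_def)
  ultimately have "dv d (\<S> z)"
    using coprime_dv[of d b "\<S> z", OF _ _ _ _ _ _ co] U z \<open>b \<noteq> \<zero>\<close> by simp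
  moreover have "dv (\<S> z) b"
  proof (rule b)
    have "\<S> z \<preceq> y" unfolding z(2) using z U by (intro leq_add) auto
    then show "\<S> z \<preceq> B" using assms z leq_trans by (metis closed(2))
  qed (use z in auto)
  ultimately have "dv d b" using dv_trans z U by (metis closed(2))
  then show ?thesis using co[of d] U by simp
qed

text \<open>The code is multiplied by the modulus of each element of \<open>P\<close> in turn. The
  moduli are pairwise coprime, so a multiplication changes the membership of one element only
  (\<open>same\<close> and \<open>ne\<close>). The induction asserts that a suitable product exists
  and thus gets by without a product function.\<close>

lemma comprehension:
  assumes P: "dfn U (\<lambda>e. P (e 0))" and "B \<in> U"
  shows "\<exists>a\<in>U. \<exists>b\<in>U. \<forall>z\<in>U. z \<preceq> B \<longrightarrow> (elt a b z \<longleftrightarrow> P z)"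
proof -
  have P': "dfn U (\<lambda>e. P (e i))" for i by (rule dfn_app1[OF P trm_var])
  obtain b where b: "b \<in> U" "b \<noteq> \<zero>" "\<And>y. y \<in> U \<Longrightarrow> y \<preceq> B \<Longrightarrow> y \<noteq> \<zero> \<Longrightarrow> dv y b"
    using common_multiple[OF \<open>B \<in> U\<close>] by blast
  have ne: "elt a b z \<longleftrightarrow> elt (a \<otimes> \<S> (\<S> x \<otimes> b)) b z"
    if "x \<in> U" "z \<in> U" "a \<in> U" "x \<noteq> z" "x \<preceq> B" "z \<preceq> B" for x z a
  proof
    assume "elt a b z"
    then show "elt (a \<otimes> \<S> (\<S> x \<otimes> b)) b z" using that b by (simp add: elt_def dv_mul del: mul_S mul_S_left)
  next
    assume "elt (a \<otimes> \<S> (\<S> x \<otimes> b)) b z"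
    moreover have "d = \<S> \<zero>" if "d \<in> U" "dv d (\<S> (\<S> z \<otimes> b))" "dv d (\<S> (\<S> x \<otimes> b))" for d
      using moduli_coprime[of b x z d B] moduli_coprime[of b z x d B] linear[of x z]
        \<open>x \<noteq> z\<close> \<open>x \<in> U\<close> \<open>z \<in> U\<close> \<open>x \<preceq> B\<close> \<open>z \<preceq> B\<close> b \<open>B \<in> U\<close> that by blast
    ultimately show "elt a b z" using that b unfolding elt_def
      by (intro coprime_dv[of "\<S> (\<S> z \<otimes> b)" "\<S> (\<S> x \<otimes> b)" a]) (auto simp del: mul_S mul_S_left)
  qed
  have same: "elt (a \<otimes> \<S> (\<S> x \<otimes> b)) b x" if "a \<in> U" "x \<in> U" for a x
    using that b by (simp add: elt_def dv_mul2 del: mul_S mul_S_left)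
  have "y \<in> U \<Longrightarrow> y \<preceq> \<S> B \<longrightarrow> (\<exists>a\<in>U. \<forall>z\<in>U. z \<preceq> B \<longrightarrow> (elt a b z \<longleftrightarrow> z \<prec> y \<and> P z))" for y
  proof (induction rule: dfn_induct)
    case dfn show ?case by (intro dfn_intros dfn_elt P' b \<open>B \<in> U\<close>)
  next
    case zero
    \<comment> \<open>The code 1 represents the empty set, because every modulus exceeds 1.\<close>
    have "\<not> elt (\<S> \<zero>) b z" if "z \<in> U" for z
      using dv_one[of "\<S> (\<S> z \<otimes> b)"] that b by (auto simp: elt_def)
    then show ?case by (auto intro!: bexI[of _ "\<S> \<zero>"])
  next
    case (suc y)
    show ?case
    proof
      assume "\<S> y \<preceq> \<S> B"
      then have y: "y \<preceq> B" "y \<prec> \<S> B" using suc(1) \<open>B \<in> U\<close> by (auto simp: less_S intro: less_trans[OF less_self_S])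
      then obtain a where a: "a \<in> U" "\<And>z. z \<in> U \<Longrightarrow> z \<preceq> B \<Longrightarrow> elt a b z \<longleftrightarrow> z \<prec> y \<and> P z"
        using suc by blast
      show "\<exists>a\<in>U. \<forall>z\<in>U. z \<preceq> B \<longrightarrow> (elt a b z \<longleftrightarrow> z \<prec> \<S> y \<and> P z)"
      proof (cases "P y")
        case True
        have "elt (a \<otimes> \<S> (\<S> y \<otimes> b)) b z \<longleftrightarrow> z \<prec> \<S> y \<and> P z" if "z \<in> U" "z \<preceq> B" for z
          using True ne[of y z a] same[of a y] a that suc(1) y by (cases "z = y") (auto simp: less_S)
        then show ?thesis using a b suc(1) by (intro bexI[of _ "a \<otimes> \<S> (\<S> y \<otimes> b)"]) auto
      next
        case False
        then show ?thesis using a suc(1) by (intro bexI[of _ a]) (auto simp: less_S)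
      qed
    qed
  qed
  from this[of "\<S> B"] obtain a where "a \<in> U" "\<forall>z\<in>U. z \<preceq> B \<longrightarrow> (elt a b z \<longleftrightarrow> z \<prec> \<S> B \<and> P z)"
    using \<open>B \<in> U\<close> by auto
  then have "\<forall>z\<in>U. z \<preceq> B \<longrightarrow> (elt a b z \<longleftrightarrow> P z)" using \<open>B \<in> U\<close> by (auto simp: less_S)
  with \<open>a \<in> U\<close> \<open>b \<in> U\<close> show ?thesis by blast
qed

end

context arith
begin

section \<open>Finite support of predicates and functions\<close>

definition supp :: "nat \<Rightarrow> ((nat \<Rightarrow> 'a) \<Rightarrow> 'b) \<Rightarrow> bool" where
  "supp n P \<longleftrightarrow> (\<forall>e e'. env e \<longrightarrow> env e' \<longrightarrow> (\<forall>i<n. e i = e' i) \<longrightarrow> P e = P e')"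

lemma suppD: "supp n P \<Longrightarrow> env e \<Longrightarrow> env e' \<Longrightarrow> (\<And>i. i < n \<Longrightarrow> e i = e' i) \<Longrightarrow> P e = P e'"
  unfolding supp_def by blast

lemma supp_mono: "supp n P \<Longrightarrow> n \<le> m \<Longrightarrow> supp m P"
  unfolding supp_def by (meson less_le_trans)

lemma dfn_supp: "dfn A P \<Longrightarrow> \<exists>n. supp n P"
  unfolding supp_def using dfn_support by metis

lemma trm_supp:
  assumes "trm A t" shows "\<exists>n. supp n t"
proof -
  obtain n where n: "supp n (\<lambda>e. e 0 = t (\<lambda>i. e (Suc i)))"
    using dfn_supp assms unfolding trm_def by blast
  have "supp n t" unfolding supp_def
  proof (intro allI impI)
    fix e e' :: "nat \<Rightarrow> 'a"
    assume e: "env e" "env e'" "\<forall>i<n. e i = e' i"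
    then have "t e \<in> U" using assms trm_in by blast
    with e show "t e = t e'"
      using suppD[OF n, of "case_nat (t e) e" "case_nat (t e) e'"] by (auto split: nat.splits)
  qed
  then show ?thesis ..
qed

lemma dfn_formula:
  assumes "dfn {} P" obtains p where "C p" "\<And>e. env e \<Longrightarrow> P e \<longleftrightarrow> sat M X e p"
proof -
  obtain p \<rho> where p: "C p" "\<And>i a. \<rho> i \<noteq> Inr a"
    "\<And>e. env e \<Longrightarrow> P e \<longleftrightarrow> sat M X (\<lambda>i. case_sum e id (\<rho> i)) p"
    using assms(1) unfolding dfn_def by blast
  have "(\<lambda>i. case_sum e id (\<rho> i)) = (\<lambda>i. e (projl (\<rho> i)))" for e :: "nat \<Rightarrow> 'a"
    by (rule ext) (use p(2) in \<open>auto split: sum.splits\<close>)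
  then have "P e \<longleftrightarrow> sat M X e (subst (\<lambda>i. Var (projl (\<rho> i))) p)" if "env e" for e
    using p(3)[OF that] by (simp add: sat_subst)
  with C_rename[OF p(1)] show ?thesis by (rule that)
qed

section \<open>Definable types\<close>

text \<open>Pairing turns the last two parameters into one until a single parameter \<open>w\<close>
  is left. The predicate \<open>Q\<close> is chosen before the parameters.\<close>

lemma merge_supp:
  assumes "dfn {} P" "supp (n + Suc m) P"
  shows "\<exists>Q. dfn {} Q \<and> (\<forall>r. env r \<longrightarrow>
    (\<exists>w\<in>U. \<forall>e. env e \<longrightarrow> (P (mrg n e r) \<longleftrightarrow> Q (mrg n e (\<lambda>_. w)))))"
  using assms
proof (induction m arbitrary: P)
  case 0
  have "P (mrg n e r) \<longleftrightarrow> P (mrg n e (\<lambda>_. r n))" if "env e" "env r" for e r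
    by (intro suppD[OF 0(2)] env_mrg env_const envD) (use that in \<open>auto simp: mrg_def less_Suc_eq\<close>)
  then show ?case using 0(1) by (metis envD)
next
  case (Suc m)
  define k where "k = n + m"
  \<comment> \<open>\<open>P'\<close> decodes entry \<open>k\<close> into the last two entries that
    \<open>P\<close> reads, so its support is shorter by one.\<close>
  define P' where "P' e = (\<exists>x\<in>U. \<exists>y\<in>U. e k = pr x y \<and> P (e(k := x, Suc k := y)))" for e
  have "dfn {} (\<lambda>e. P ((\<lambda>i. e (Suc (Suc i)))(k := e (Suc 0), Suc k := e 0)))"
    using dfn_rename[OF Suc(2), of "(\<lambda>i. Suc (Suc i))(k := Suc 0, Suc k := 0)"]
    by (rule back_subst[of "dfn {}"]) (auto intro!: ext arg_cong[of _ _ P])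
  then have "dfn {} P'" unfolding P'_def by (intro dfn_intros trm_pr)
  moreover have "supp (n + Suc m) P'" unfolding supp_def
  proof (intro allI impI)
    fix e e' :: "nat \<Rightarrow> 'a"
    assume e: "env e" "env e'" "\<forall>i<n + Suc m. e i = e' i"
    have "P (e(k := x, Suc k := y)) = P (e'(k := x, Suc k := y))" if "x \<in> U" "y \<in> U" for x y
      using e that by (intro suppD[OF Suc(3)] env_upd) (auto simp: k_def)
    moreover have "e k = e' k" using e by (simp add: k_def)
    ultimately show "P' e = P' e'" by (simp add: P'_def)
  qed
  ultimately obtain Q where Q: "dfn {} Q"
    "\<And>r. env r \<Longrightarrow> \<exists>w\<in>U. \<forall>e. env e \<longrightarrow> (P' (mrg n e r) \<longleftrightarrow> Q (mrg n e (\<lambda>_. w)))"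
    using Suc(1) by blast
  have "P (mrg n e r) \<longleftrightarrow> P' (mrg n e (r(k := pr (r k) (r (Suc k)))))" if "env e" "env r" for e r
  proof -
    have "P ((mrg n e (r(k := pr (r k) (r (Suc k)))))(k := r k, Suc k := r (Suc k))) = P (mrg n e r)"
      using that by (intro suppD[OF Suc(3)] env_upd env_mrg) (auto simp: mrg_def k_def)
    then show ?thesis using that by (auto simp: P'_def) (auto simp: mrg_def k_def)
  qed
  then have "\<exists>w\<in>U. \<forall>e. env e \<longrightarrow> (P (mrg n e r) \<longleftrightarrow> Q (mrg n e (\<lambda>_. w)))" if "env r" for r
    using Q(2)[of "r(k := pr (r k) (r (Suc k)))"] that by simp
  with Q(1) show ?case by blast
qed

text \<open>The parameters from \<open>A\<close> and all entries from \<open>n\<close> on collapse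
  to one element \<open>w\<close>, while \<open>Q\<close> is parameter-free and serves every
  \<open>r\<close>. So it is enough that the type decides formulas with a single parameter.\<close>

lemma merge:
  assumes "dfn A P"
  obtains Q where "dfn {} Q"
    "\<And>r. env r \<Longrightarrow> \<exists>w\<in>U. \<forall>e. env e \<longrightarrow> (P (mrg n e r) \<longleftrightarrow> Q (mrg n e (\<lambda>_. w)))"
proof -
  obtain p where p: "C p"
    "\<And>e. env e \<Longrightarrow> \<exists>r. env r \<and> (\<forall>e'. env e' \<longrightarrow> (P (mrg n e' e) \<longleftrightarrow> sat M X (mrg n e' r) p))"
    using dfn_split[OF assms, of n] by blast
  have d: "dfn {} (\<lambda>e. sat M X e p)" by (rule dfn_sat[OF p(1)])
  obtain m where m: "supp m (\<lambda>e. sat M X e p)" using dfn_supp[OF d] by blast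
  obtain Q where Q: "dfn {} Q"
    "\<And>r. env r \<Longrightarrow> \<exists>w\<in>U. \<forall>e. env e \<longrightarrow> (sat M X (mrg n e r) p \<longleftrightarrow> Q (mrg n e (\<lambda>_. w)))"
    using merge_supp[OF d supp_mono[OF m], of n m] by auto
  show ?thesis
  proof (rule that[OF Q(1)])
    fix e assume "env e"
    then obtain r where "env r" "\<And>e'. env e' \<Longrightarrow> P (mrg n e' e) \<longleftrightarrow> sat M X (mrg n e' r) p"
      using p(2) by blast
    with Q(2)[of r] show "\<exists>w\<in>U. \<forall>e'. env e' \<longrightarrow> (P (mrg n e' e) \<longleftrightarrow> Q (mrg n e' (\<lambda>_. w)))" by auto
  qed
qed

text \<open>Definable Skolem functions: the least witness, and \<open>\<zero>\<close> where there is
  none. By the last property \<open>g\<close> depends on \<open>e\<close> only through the set of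
  witnesses, which is used to bound the support of \<open>g\<close>.\<close>

lemma trm_choice:
  assumes P: "dfn A (\<lambda>e. P (e 0) (\<lambda>i. e (Suc i)))"
  obtains g where "trm A g" "\<And>e x. env e \<Longrightarrow> x \<in> U \<Longrightarrow> P x e \<Longrightarrow> P (g e) e"
    "\<And>e e'. env e \<Longrightarrow> env e' \<Longrightarrow> (\<And>x. x \<in> U \<Longrightarrow> P x e \<longleftrightarrow> P x e') \<Longrightarrow> g e = g e'"
proof -
  define L where "L x e \<longleftrightarrow> P x e \<and> (\<forall>y\<in>U. y \<prec> x \<longrightarrow> \<not> P y e)" for x e
  define g where "g e = (if \<exists>x\<in>U. P x e then (THE x. x \<in> U \<and> L x e) else \<zero>)" for e
  have g: "g e \<in> U \<and> L (g e) e" if ex: "\<exists>x\<in>U. P x e" and "env e" for e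
  proof -
    obtain x where x: "x \<in> U" "P x e" using ex by blast
    have "dfn A (\<lambda>e. P (e 0) (\<lambda>i. e (Suc i)))" by fact
    then have "dfn U (\<lambda>e. P (e 0) (\<lambda>i. e (Suc i)))" unfolding dfn_def by blast
    moreover have "trm U (case_nat (\<lambda>e. e 0) (\<lambda>i _. e i) i)" for i
      using \<open>env e\<close> by (cases i) (simp_all add: trm_var trm_const)
    ultimately have "dfn U (\<lambda>e'. P (e' 0) e)"
      using dfn_subst[of U "case_nat (\<lambda>e. e 0) (\<lambda>i _. e i)"] by fastforce
    then obtain y where "y \<in> U" "P y e" "\<And>z. z \<in> U \<Longrightarrow> z \<prec> y \<Longrightarrow> \<not> P z e"
      using x by (rule least[of "\<lambda>x. P x e"]) blast
    then have y: "y \<in> U" "L y e" by (auto simp: L_def)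
    have "z = y" if "z \<in> U" "L z e" for z
      using that y linear[of z y] by (auto simp: L_def)
    then have "(THE x. x \<in> U \<and> L x e) = y" using y by blast
    then show ?thesis using ex y by (simp add: g_def)
  qed
  have g0: "g e = \<zero>" if "\<not> (\<exists>x\<in>U. P x e)" for e
    using that by (simp add: g_def)
  have in_U: "g e \<in> U" if "env e" for e
    using g[of e] g0[of e] that by fastforce
  have graph: "x = g e \<longleftrightarrow> L x e \<or> \<not> (\<exists>x\<in>U. P x e) \<and> x = \<zero>" if "env e" "x \<in> U" for x e
  proof (cases "\<exists>x\<in>U. P x e")
    case True
    then have "L x e \<longrightarrow> x = g e"
      using g[OF True \<open>env e\<close>] that linear[of x "g e"] by (auto simp: L_def)
    with True show ?thesis using g[OF True \<open>env e\<close>] by auto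
  next
    case False
    then show ?thesis using g0 that by (auto simp: L_def)
  qed
  have P2: "dfn A (\<lambda>e. P (e 0) (\<lambda>i. e (Suc (Suc i))))"
    using dfn_rename[OF P, of "case_nat 0 (\<lambda>i. Suc (Suc i))"] by simp
  have L: "dfn A (\<lambda>e. L (e 0) (\<lambda>i. e (Suc i)))" unfolding L_def by (intro dfn_intros P P2)
  have "dfn A (\<lambda>e. L (e 0) (\<lambda>i. e (Suc i)) \<or> \<not> (\<exists>x\<in>U. P x (\<lambda>i. e (Suc i))) \<and> e 0 = \<zero>)"
    by (intro dfn_intros L P2)
  then have "dfn A (\<lambda>e. e 0 = g (\<lambda>i. e (Suc i)))"
    by (rule dfn_cong) (simp add: graph)
  then have "trm A g" using in_U by (simp add: trm_def)
  moreover have "P (g e) e" if "env e" "x \<in> U" "P x e" for e x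
    using g[of e] that by (auto simp: L_def)
  moreover have "g e = g e'" if "env e" "env e'" "\<And>x. x \<in> U \<Longrightarrow> P x e \<longleftrightarrow> P x e'" for e e'
  proof -
    have "(\<exists>x\<in>U. P x e) \<longleftrightarrow> (\<exists>x\<in>U. P x e')" "(\<lambda>x. x \<in> U \<and> L x e) = (\<lambda>x. x \<in> U \<and> L x e')"
      using that by (auto simp: L_def)
    then show ?thesis by (simp add: g_def)
  qed
  ultimately show ?thesis by (rule that)
qed

text \<open>The elements of \<open>Y\<close> are compared through the truth values \<open>R v 0, R v 1, \<dots>\<close>. The elements
  \<open>v\<close> with \<open>G y v\<close> are those whose first \<open>y\<close> values follow, at every stage, the value \<open>True\<close> if it
  is taken unboundedly often on \<open>Y\<close> among the elements with the same previous values, and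
  \<open>False\<close> otherwise.\<close>

lemma thin:
  assumes Y: "dfn {} (\<lambda>e. Y (e 0))" and unb: "\<And>b. b \<in> U \<Longrightarrow> \<exists>v\<in>U. b \<prec> v \<and> Y v"
    and R: "dfn {} (\<lambda>e. R (e 0) (e 1))"
  shows "\<exists>Y'. dfn {} (\<lambda>e. Y' (e 0)) \<and> (\<forall>v\<in>U. Y' v \<longrightarrow> Y v) \<and> (\<forall>b\<in>U. \<exists>v\<in>U. b \<prec> v \<and> Y' v) \<and>
    (\<forall>y\<in>U. \<exists>b\<in>U. (\<forall>v\<in>U. b \<prec> v \<longrightarrow> Y' v \<longrightarrow> R v y) \<or> (\<forall>v\<in>U. b \<prec> v \<longrightarrow> Y' v \<longrightarrow> \<not> R v y))"
proof -
  define sim where "sim z v u \<longleftrightarrow> (\<forall>w\<in>U. w \<prec> z \<longrightarrow> (R v w \<longleftrightarrow> R u w))" for z v u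
  define Big where "Big z u \<longleftrightarrow> (\<forall>b\<in>U. \<exists>v\<in>U. b \<prec> v \<and> Y v \<and> sim z v u \<and> R v z)" for z u
  define G where "G y u \<longleftrightarrow> Y u \<and> (\<forall>z\<in>U. z \<prec> y \<longrightarrow> (R u z \<longleftrightarrow> Big z u))" for y u
  \<comment> \<open>A diagonal intersection of the sets \<open>G n\<close>: each \<open>n\<close>
    contributes at most one element, the first one of \<open>G n\<close> above \<open>n\<close>.
    Only the contributions of \<open>n \<preceq> y\<close> can lie outside
    \<open>G (\<S> y)\<close>, and collection bounds them.\<close>
  define Y' where "Y' v \<longleftrightarrow> (\<exists>n\<in>U. n \<prec> v \<and> G n v \<and> (\<forall>u\<in>U. u \<prec> v \<longrightarrow> n \<prec> u \<longrightarrow> \<not> G n u))" for v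
  note R' = dfn_app2[OF dfn_mono[OF R empty_subsetI]] and Y1 = dfn_app1[OF dfn_mono[OF Y empty_subsetI]]
  have sim: "dfn A (\<lambda>e. sim (s e) (t e) (u e))" if "trm A s" "trm A t" "trm A u" for A s t u
    by (rule dfn_app3[OF _ that], unfold sim_def, intro dfn_intros R')
  have Big: "dfn A (\<lambda>e. Big (s e) (t e))" if "trm A s" "trm A t" for A s t
    by (rule dfn_app2[OF _ that], unfold Big_def, intro dfn_intros R' Y1 sim)
  have G: "dfn A (\<lambda>e. G (s e) (t e))" if "trm A s" "trm A t" for A s t
    by (rule dfn_app2[OF _ that], unfold G_def, intro dfn_intros R' Y1 Big)
  have Y': "dfn {} (\<lambda>e. Y' (e 0))"
    unfolding Y'_def by (intro dfn_intros G)
  have sim_sym: "sim z u v \<Longrightarrow> sim z v u" and sim_trans: "sim z u v \<Longrightarrow> sim z v w \<Longrightarrow> sim z u w"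
    for z u v w by (auto simp: sim_def)
  have sim_mono: "sim z u v" if "sim y u v" "z \<prec> y" "z \<in> U" "y \<in> U" for z y u v
    using that less_trans unfolding sim_def by blast
  have Big_sim: "Big z u \<longleftrightarrow> Big z v" if "sim z u v" for z u v
    using sim_trans sim_sym that unfolding Big_def by meson
  have G_mono: "G z u" if "G y u" "z \<prec> y \<or> z = y" "z \<in> U" "y \<in> U" for z y u
    using that less_trans unfolding G_def by blast
  \<comment> \<open>At the least place of disagreement the two elements are still similar, so
    \<open>Big\<close> prescribes the same value for both.\<close>
  have G_sim: "sim y u v" if "G y u" "G y v" "y \<in> U" "u \<in> U" "v \<in> U" for y u v
  proof (rule ccontr)
    assume "\<not> sim y u v"
    then obtain z where z: "z \<in> U" "z \<prec> y" "\<not> (R u z \<longleftrightarrow> R v z)" by (auto simp: sim_def)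
    have "dfn U (\<lambda>e. \<not> (R u (e 0) \<longleftrightarrow> R v (e 0)))" by (intro dfn_intros R' that)
    then obtain z' where z': "z' \<in> U" "\<not> (R u z' \<longleftrightarrow> R v z')"
      "\<And>w. w \<in> U \<Longrightarrow> w \<prec> z' \<Longrightarrow> \<not> \<not> (R u w \<longleftrightarrow> R v w)"
      using z(1,3) by (rule least[of "\<lambda>w. \<not> (R u w \<longleftrightarrow> R v w)"]) blast
    then have "\<not> z \<prec> z'" using z by blast
    then have "z' \<prec> y" using z z' not_less[of z z'] less_trans[of z' z y] that by blast
    moreover have "sim z' u v" using z' by (simp add: sim_def)
    ultimately show False using that z' Big_sim unfolding G_def by blast
  qed
  have sim_G: "G y v" if "G y u" "Y v" "sim y v u" "y \<in> U" for y u v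
    unfolding G_def
  proof (intro conjI ballI impI)
    fix z assume z: "z \<in> U" "z \<prec> y"
    then have "R v z \<longleftrightarrow> R u z" using that by (simp add: sim_def)
    also have "\<dots> \<longleftrightarrow> Big z u" using that z by (simp add: G_def)
    also have "\<dots> \<longleftrightarrow> Big z v" using Big_sim sim_mono that z by blast
    finally show "R v z \<longleftrightarrow> Big z v" .
  qed fact
  \<comment> \<open>All elements of \<open>G y\<close> agree below \<open>y\<close>, hence
    \<open>Big y\<close> has one truth value on them. If \<open>R v y\<close> holds unboundedly
    often on \<open>G y\<close>, those elements remain; otherwise everything in \<open>G y\<close>
    beyond some bound remains.\<close>
  have G_unb: "y \<in> U \<Longrightarrow> \<forall>b\<in>U. \<exists>v\<in>U. b \<prec> v \<and> G y v" for y
  proof (induction rule: dfn_induct)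
    case dfn show ?case by (intro dfn_intros G)
  next
    case zero show ?case using unb by (auto simp: G_def)
  next
    case (suc y)
    show ?case
    proof (cases "\<forall>b\<in>U. \<exists>v\<in>U. b \<prec> v \<and> G y v \<and> R v y")
      case True
      have "G (\<S> y) v" if v: "v \<in> U" "G y v" "R v y" for v
      proof -
        have "Big y v" unfolding Big_def
        proof
          fix b assume "b \<in> U"
          then obtain w where w: "w \<in> U" "b \<prec> w" "G y w" "R w y" using True by blast
          then show "\<exists>v'\<in>U. b \<prec> v' \<and> Y v' \<and> sim y v' v \<and> R v' y"
            using G_sim[of y w v] v suc(1) by (auto simp: G_def)
        qed
        then show ?thesis using v suc(1) by (auto simp: G_def less_S)
      qed
      then show ?thesis using True by blast
    next
      case False
      then obtain b0 where b0: "b0 \<in> U" "\<And>v. v \<in> U \<Longrightarrow> b0 \<prec> v \<Longrightarrow> G y v \<Longrightarrow> \<not> R v y" by blast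
      have GS: "G (\<S> y) v" if v: "v \<in> U" "G y v" "b0 \<prec> v" for v
      proof -
        have "\<not> Big y v"
        proof
          assume "Big y v"
          then obtain w where "w \<in> U" "b0 \<prec> w" "Y w" "sim y w v" "R w y"
            using b0(1) unfolding Big_def by blast
          then show False using b0(2)[of w] sim_G[of y v w] v suc(1) by blast
        qed
        then show ?thesis using v b0 suc(1) by (auto simp: G_def less_S)
      qed
      show ?thesis
      proof
        fix b assume b: "b \<in> U"
        then obtain v where v: "v \<in> U" "b \<oplus> b0 \<prec> v" "G y v" using suc(2) b0 by (meson closed(3))
        have "b \<prec> v" using leq_add(1)[OF b b0(1)] v(2) by (rule leq_less_trans) (use b b0 v in auto)
        moreover have "b0 \<prec> v" using leq_add(2)[OF b0(1) b] v(2) by (rule leq_less_trans) (use b b0 v in auto)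
        ultimately show "\<exists>v\<in>U. b \<prec> v \<and> G (\<S> y) v" using GS v by blast
      qed
    qed
  qed
  have Y'_unb: "\<exists>v\<in>U. b \<prec> v \<and> Y' v" if b: "b \<in> U" for b
  proof -
    obtain v where v: "v \<in> U" "b \<prec> v \<and> G b v" using G_unb b by blast
    have "dfn U (\<lambda>e. b \<prec> e 0 \<and> G b (e 0))" by (intro dfn_intros G b)
    then obtain v' where "v' \<in> U" "b \<prec> v' \<and> G b v'" "\<And>u. u \<in> U \<Longrightarrow> u \<prec> v' \<Longrightarrow> \<not> (b \<prec> u \<and> G b u)"
      using v by (rule least[of "\<lambda>v. b \<prec> v \<and> G b v"]) blast
    then show ?thesis using b unfolding Y'_def by blast
  qed
  have decided: "\<exists>b\<in>U. (\<forall>v\<in>U. b \<prec> v \<longrightarrow> Y' v \<longrightarrow> R v y) \<or> (\<forall>v\<in>U. b \<prec> v \<longrightarrow> Y' v \<longrightarrow> \<not> R v y)"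
    if y: "y \<in> U" for y
  proof -
    \<comment> \<open>\<open>W n b\<close> says that the element contributed by \<open>n\<close>, if
      any, does not exceed \<open>b\<close>; this is monotone in \<open>b\<close>, as collection
      demands.\<close>
    define W where "W n b \<longleftrightarrow> (\<forall>v\<in>U. n \<prec> v \<longrightarrow> G n v \<longrightarrow> (\<forall>u\<in>U. u \<prec> v \<longrightarrow> n \<prec> u \<longrightarrow> \<not> G n u) \<longrightarrow> \<not> b \<prec> v)" for n b
    have "\<exists>b\<in>U. \<forall>n\<in>U. n \<prec> \<S> y \<longrightarrow> W n b"
    proof (rule collection)
      show "dfn U (\<lambda>e. W (e 0) (e 1))" unfolding W_def by (intro dfn_intros G)
      fix n assume n: "n \<in> U"
      show "\<exists>b\<in>U. W n b"
      proof (cases "\<exists>v\<in>U. n \<prec> v \<and> G n v \<and> (\<forall>u\<in>U. u \<prec> v \<longrightarrow> n \<prec> u \<longrightarrow> \<not> G n u)")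
        case True
        then obtain v where v: "v \<in> U" "n \<prec> v" "G n v" "\<forall>u\<in>U. u \<prec> v \<longrightarrow> n \<prec> u \<longrightarrow> \<not> G n u" by blast
        have "W n v" unfolding W_def using v by blast
        with v show ?thesis by blast
      next
        case False
        then have "W n \<zero>" unfolding W_def by blast
        then show ?thesis by blast
      qed
    next
      fix n b b' assume "n \<in> U" "b \<in> U" "b' \<in> U" "b \<prec> b'" "W n b"
      then show "W n b'" using less_trans[of b b'] unfolding W_def by meson
    qed (use y in auto)
    then obtain b where b: "b \<in> U" "\<And>n. n \<in> U \<Longrightarrow> n \<prec> \<S> y \<Longrightarrow> W n b" by blast
    have "G (\<S> y) v" if v: "v \<in> U" "b \<prec> v" "Y' v" for v
    proof -
      obtain n where n: "n \<in> U" "n \<prec> v" "G n v" "\<forall>u\<in>U. u \<prec> v \<longrightarrow> n \<prec> u \<longrightarrow> \<not> G n u"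
        using v Y'_def by blast
      then have "\<not> W n b" using v unfolding W_def by blast
      then have "\<not> n \<prec> \<S> y" using b n by blast
      then show ?thesis using G_mono n y not_less[of n "\<S> y"] by auto
    qed
    then have "R v y \<longleftrightarrow> R v' y" if "v \<in> U" "b \<prec> v" "Y' v" "v' \<in> U" "b \<prec> v'" "Y' v'" for v v'
      using that G_sim[of "\<S> y" v v'] y by (auto simp: sim_def)
    then show ?thesis using b(1) by blast
  qed
  have "\<forall>v\<in>U. Y' v \<longrightarrow> Y v" by (auto simp: Y'_def G_def)
  then show ?thesis using Y' Y'_unb decided by blast
qed

text \<open>The standard numerals. They name formulas inside the model, and later they supply
  infinitely many elements below \<open>c 0\<close>.\<close>

definition num :: "nat \<Rightarrow> 'a" where "num n = (\<S> ^^ n) \<zero>"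

lemma num_in [simp]: "num n \<in> U"
  by (induction n) (auto simp: num_def)

lemma num_less: "m < n \<Longrightarrow> num m \<prec> num n"
proof (induction n)
  case (Suc n)
  have "num (Suc n) = \<S> (num n)" by (simp add: num_def)
  with Suc show ?case by (auto simp: less_S less_Suc_eq)
qed simp

lemma num_inj: "num m = num n \<longleftrightarrow> m = n"
  using num_less[of m n] num_less[of n m] less_irrefl[of "num n"] by (cases m n rule: linorder_cases) auto

text \<open>There are countably many formulas, and \<open>thin\<close> treats one of them for all
  parameters simultaneously. Stage \<open>Suc k\<close> handles the formula with code
  \<open>k\<close>.\<close>

lemma definable_type:
  obtains Y :: "nat \<Rightarrow> 'a \<Rightarrow> bool" where
    "\<And>k. dfn {} (\<lambda>e. Y k (e 0))" "\<And>k v. v \<in> U \<Longrightarrow> Y (Suc k) v \<Longrightarrow> Y k v"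
    "\<And>k b. b \<in> U \<Longrightarrow> \<exists>v\<in>U. b \<prec> v \<and> Y k v"
    "\<And>R. dfn {} (\<lambda>e. R (e 0) (e 1)) \<Longrightarrow> \<exists>k. \<forall>y\<in>U. \<exists>b\<in>U.
       (\<forall>v\<in>U. b \<prec> v \<longrightarrow> Y k v \<longrightarrow> R v y) \<or> (\<forall>v\<in>U. b \<prec> v \<longrightarrow> Y k v \<longrightarrow> \<not> R v y)"
proof -
  \<comment> \<open>A code of a formula outside \<open>C\<close> gives the empty relation, so that
    \<open>R k\<close> is definable for every \<open>k\<close>.\<close>
  define R where "R k v y \<longleftrightarrow> C (from_nat k) \<and> sat M X (case_nat v (\<lambda>_. y)) (from_nat k)" for k v y
  have R: "dfn {} (\<lambda>e. R k (e 0) (e 1))" for k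
  proof (cases "C (from_nat k)")
    case True
    have "(\<lambda>i. e (if i = 0 then 0 else 1)) = case_nat (e 0) (\<lambda>_. e 1)" for e :: "nat \<Rightarrow> 'a"
      by (rule ext) (auto split: nat.splits)
    then show ?thesis
      using dfn_rename[OF dfn_sat[OF True], of "{}" "\<lambda>i. if i = 0 then 0 else 1"] True
      unfolding R_def by simp
  qed (simp add: R_def dfn_const)
  define good where "good Y \<longleftrightarrow> dfn {} (\<lambda>e. Y (e 0)) \<and> (\<forall>b\<in>U. \<exists>v\<in>U. b \<prec> v \<and> Y v)" for Y
  define decides where "decides k Y \<longleftrightarrow> (\<forall>y\<in>U. \<exists>b\<in>U.
       (\<forall>v\<in>U. b \<prec> v \<longrightarrow> Y v \<longrightarrow> R k v y) \<or> (\<forall>v\<in>U. b \<prec> v \<longrightarrow> Y v \<longrightarrow> \<not> R k v y))" for k Y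
  have "\<exists>Y. \<forall>k. good (Y k) \<and> ((\<forall>v\<in>U. Y (Suc k) v \<longrightarrow> Y k v) \<and> decides k (Y (Suc k)))"
  proof (rule dependent_nat_choice)
    show "\<exists>Y. good Y"
      by (intro exI[of _ "\<lambda>_. True"]) (simp add: good_def dfn_const, metis closed(2) less_self_S)
  next
    fix Y k assume "good Y"
    then show "\<exists>Y'. good Y' \<and> ((\<forall>v\<in>U. Y' v \<longrightarrow> Y v) \<and> decides k Y')"
      using thin[of Y "R k", OF _ _ R] unfolding good_def decides_def by blast
  qed
  then obtain Y where Y: "\<And>k. good (Y k)" "\<And>k. \<forall>v\<in>U. Y (Suc k) v \<longrightarrow> Y k v"
    "\<And>k. decides k (Y (Suc k))" by blast
  show ?thesis
  proof (rule that[of Y])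
    fix R' assume "dfn {} (\<lambda>e. R' (e 0) (e 1))"
    then obtain p where p: "C p" "\<And>e. env e \<Longrightarrow> R' (e 0) (e 1) \<longleftrightarrow> sat M X e p"
      by (rule dfn_formula) blast
    have "R' v y \<longleftrightarrow> R (to_nat p) v y" if "v \<in> U" "y \<in> U" for v y
      using p(2)[of "case_nat v (\<lambda>_. y)"] that p(1) by (simp add: R_def)
    then show "\<exists>k. \<forall>y\<in>U. \<exists>b\<in>U. (\<forall>v\<in>U. b \<prec> v \<longrightarrow> Y k v \<longrightarrow> R' v y) \<or>
        (\<forall>v\<in>U. b \<prec> v \<longrightarrow> Y k v \<longrightarrow> \<not> R' v y)"
      using Y(3)[of "to_nat p"] unfolding decides_def by (intro exI[of _ "Suc (to_nat p)"]) simp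
  qed (use Y in \<open>auto simp: good_def\<close>)
qed

end

locale dtype = arith M "{}" is_LA for M :: "'a la_structure" +
  fixes Y :: "nat \<Rightarrow> 'a \<Rightarrow> bool"
  assumes Y_dfn: "dfn {} (\<lambda>e. Y k (e 0))"
    and Y_Suc: "v \<in> U \<Longrightarrow> Y (Suc k) v \<Longrightarrow> Y k v"
    and Y_unbounded: "b \<in> U \<Longrightarrow> \<exists>v\<in>U. b \<prec> v \<and> Y k v"
    and Y_decides: "dfn {} (\<lambda>e. R (e 0) (e 1)) \<Longrightarrow> \<exists>k. \<forall>y\<in>U. \<exists>b\<in>U.
       (\<forall>v\<in>U. b \<prec> v \<longrightarrow> Y k v \<longrightarrow> R v y) \<or> (\<forall>v\<in>U. b \<prec> v \<longrightarrow> Y k v \<longrightarrow> \<not> R v y)"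
begin

lemma Y_mono: "v \<in> U \<Longrightarrow> k \<le> l \<Longrightarrow> Y l v \<Longrightarrow> Y k v"
  by (induction l) (auto simp: le_Suc_eq intro: Y_Suc)

lemma dfn_Y: "trm A s \<Longrightarrow> dfn A (\<lambda>e. Y k (s e))"
  by (rule dfn_app1[OF dfn_mono[OF Y_dfn]]) auto

text \<open>The type generated by the sets \<open>Y k\<close>, as a quantifier.\<close>

definition most :: "('a \<Rightarrow> bool) \<Rightarrow> bool" where
  "most P \<longleftrightarrow> (\<exists>k. \<exists>b\<in>U. \<forall>v\<in>U. b \<prec> v \<longrightarrow> Y k v \<longrightarrow> P v)"

lemma most_mono: "most P \<Longrightarrow> (\<And>v. v \<in> U \<Longrightarrow> P v \<Longrightarrow> Q v) \<Longrightarrow> most Q"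
  unfolding most_def by blast

lemma most_cong: "(\<And>v. v \<in> U \<Longrightarrow> P v \<longleftrightarrow> Q v) \<Longrightarrow> most P \<longleftrightarrow> most Q"
  using most_mono[of P Q] most_mono[of Q P] by blast

lemma above_both:
  assumes "b \<in> U" "b' \<in> U" "v \<in> U" "b \<oplus> b' \<prec> v" shows "b \<prec> v" "b' \<prec> v"
  using leq_add(1)[of b b'] leq_add(2)[of b' b] assms leq_less_trans[of _ "b \<oplus> b'" v] by blast+

lemma most_conj:
  assumes "most P" "most Q" shows "most (\<lambda>v. P v \<and> Q v)"
proof -
  obtain k b where b: "b \<in> U" "\<And>v. v \<in> U \<Longrightarrow> b \<prec> v \<Longrightarrow> Y k v \<Longrightarrow> P v"
    using assms most_def by blast
  obtain k' b' where b': "b' \<in> U" "\<And>v. v \<in> U \<Longrightarrow> b' \<prec> v \<Longrightarrow> Y k' v \<Longrightarrow> Q v"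
    using assms most_def by blast
  have "P v \<and> Q v" if "v \<in> U" "b \<oplus> b' \<prec> v" "Y (max k k') v" for v
    using that above_both[OF b(1) b'(1)] Y_mono[of v k "max k k'"] Y_mono[of v k' "max k k'"] b b' by auto
  then show ?thesis unfolding most_def
    by (intro exI[of _ "max k k'"] bexI[of _ "b \<oplus> b'"]) (use b b' in auto)
qed

lemma most_above: "b \<in> U \<Longrightarrow> most (\<lambda>v. b \<prec> v)"
  unfolding most_def by blast

lemma most_const [simp]: "most (\<lambda>_. Q) \<longleftrightarrow> Q"
  unfolding most_def using Y_unbounded by blast

lemma most_exists: "most P \<Longrightarrow> \<exists>v\<in>U. P v"
  unfolding most_def using Y_unbounded by blast

text \<open>After \<open>merge\<close> the predicate has one parameter, so a single stage
  \<open>k\<close> decides it for every environment; only the bound \<open>b\<close> varies with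
  \<open>e\<close>.\<close>

lemma decide:
  assumes "dfn A (\<lambda>e. P (e 0) (\<lambda>i. e (Suc i)))"
  obtains k where "\<And>e. env e \<Longrightarrow> \<exists>b\<in>U. (\<forall>v\<in>U. b \<prec> v \<longrightarrow> Y k v \<longrightarrow> P v e) \<or>
    (\<forall>v\<in>U. b \<prec> v \<longrightarrow> Y k v \<longrightarrow> \<not> P v e)"
proof -
  obtain Q where Q: "dfn {} Q" "\<And>r. env r \<Longrightarrow> \<exists>w\<in>U. \<forall>e. env e \<longrightarrow>
      (P (mrg 1 e r 0) (\<lambda>i. mrg 1 e r (Suc i)) \<longleftrightarrow> Q (mrg 1 e (\<lambda>_. w)))"
    using merge[OF assms, of 1] by blast
  define R where "R v w = Q (mrg 1 (\<lambda>_. v) (\<lambda>_. w))" for v w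
  have "(\<lambda>i. e (if i < 1 then 0 else 1)) = mrg 1 (\<lambda>_. e 0) (\<lambda>_. e 1)" for e :: "nat \<Rightarrow> 'a"
    by (rule ext) (auto simp: mrg_def)
  then have "dfn {} (\<lambda>e. R (e 0) (e 1))"
    using dfn_rename[OF Q(1), of "\<lambda>i. if i < 1 then 0 else 1"] by (simp add: R_def)
  then obtain k where k: "\<And>y. y \<in> U \<Longrightarrow> \<exists>b\<in>U. (\<forall>v\<in>U. b \<prec> v \<longrightarrow> Y k v \<longrightarrow> R v y) \<or>
      (\<forall>v\<in>U. b \<prec> v \<longrightarrow> Y k v \<longrightarrow> \<not> R v y)"
    using Y_decides[of R] by blast
  show ?thesis
  proof (rule that)
    fix e assume e: "env e"
    then obtain w where w: "w \<in> U" "\<And>e'. env e' \<Longrightarrow>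
      P (mrg 1 e' (case_nat \<zero> e) 0) (\<lambda>i. mrg 1 e' (case_nat \<zero> e) (Suc i)) \<longleftrightarrow> Q (mrg 1 e' (\<lambda>_. w))"
      using Q(2)[of "case_nat \<zero> e"] by auto
    have "P v e \<longleftrightarrow> R v w" if "v \<in> U" for v
      using w(2)[of "\<lambda>_. v"] that unfolding R_def by (simp add: mrg_def)
    then show "\<exists>b\<in>U. (\<forall>v\<in>U. b \<prec> v \<longrightarrow> Y k v \<longrightarrow> P v e) \<or> (\<forall>v\<in>U. b \<prec> v \<longrightarrow> Y k v \<longrightarrow> \<not> P v e)"
      using k[OF w(1)] by simp
  qed
qed

lemma most_not:
  assumes "dfn A (\<lambda>e. P (e 0) (\<lambda>i. e (Suc i)))" "env e"
  shows "most (\<lambda>v. \<not> P v e) \<longleftrightarrow> \<not> most (\<lambda>v. P v e)"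
proof -
  obtain k where "\<And>e. env e \<Longrightarrow> \<exists>b\<in>U. (\<forall>v\<in>U. b \<prec> v \<longrightarrow> Y k v \<longrightarrow> P v e) \<or>
    (\<forall>v\<in>U. b \<prec> v \<longrightarrow> Y k v \<longrightarrow> \<not> P v e)"
    using decide[OF assms(1)] by blast
  then have "most (\<lambda>v. P v e) \<or> most (\<lambda>v. \<not> P v e)" unfolding most_def using assms(2) by blast
  moreover have False if "most (\<lambda>v. P v e)" "most (\<lambda>v. \<not> P v e)"
    using most_conj[OF that] by simp
  ultimately show ?thesis by blast
qed

text \<open>As it stands, \<open>most\<close> quantifies over stages from outside the model. The
  stage given by \<open>decide\<close> serves all environments, and with it fixed the quantifier is
  first-order. This is definability of the type, and it is what permits the iteration.\<close>

lemma dfn_most: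
  assumes "dfn A (\<lambda>e. P (e 0) (\<lambda>i. e (Suc i)))" shows "dfn A (\<lambda>e. most (\<lambda>v. P v e))"
proof -
  obtain k where k: "\<And>e. env e \<Longrightarrow> \<exists>b\<in>U. (\<forall>v\<in>U. b \<prec> v \<longrightarrow> Y k v \<longrightarrow> P v e) \<or>
    (\<forall>v\<in>U. b \<prec> v \<longrightarrow> Y k v \<longrightarrow> \<not> P v e)"
    using decide[OF assms(1)] by blast
  have eq: "most (\<lambda>v. P v e) \<longleftrightarrow> (\<exists>b\<in>U. \<forall>v\<in>U. b \<prec> v \<longrightarrow> Y k v \<longrightarrow> P v e)" if e: "env e" for e
  proof
    assume P: "most (\<lambda>v. P v e)"
    then have "\<not> most (\<lambda>v. \<not> P v e)" using most_not[OF assms e] by blast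
    then show "\<exists>b\<in>U. \<forall>v\<in>U. b \<prec> v \<longrightarrow> Y k v \<longrightarrow> P v e" using k[OF e] unfolding most_def by blast
  qed (auto simp: most_def)
  have "dfn A (\<lambda>e. P (e 0) (\<lambda>i. e (Suc (Suc i))))"
    using dfn_rename[OF assms, of "case_nat 0 (\<lambda>i. Suc (Suc i))"] by simp
  then have "dfn A (\<lambda>e. \<exists>b\<in>U. \<forall>v\<in>U. b \<prec> v \<longrightarrow> Y k v \<longrightarrow> P v e)"
    by (intro dfn_intros dfn_Y)
  then show ?thesis by (rule dfn_cong) (simp add: eq)
qed

text \<open>This is what makes \<open>N\<close> an end extension.\<close>

lemma most_bounded:
  assumes t: "trm A (\<lambda>e. t (e 0))" and A: "A \<subseteq> U" and b: "b \<in> U" "most (\<lambda>v. t v \<prec> b)"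
  shows "\<exists>u\<in>U. most (\<lambda>v. t v = u)"
proof (rule ccontr)
  assume neg: "\<not> (\<exists>u\<in>U. most (\<lambda>v. t v = u))"
  have t': "dfn A (\<lambda>e. t (e i) = e j)" for i j
    by (intro dfn_eq trm_var) (use trm_rename[OF t, of "\<lambda>_. i"] in simp)
  obtain k where k: "\<And>e. env e \<Longrightarrow> \<exists>b\<in>U. (\<forall>v\<in>U. b \<prec> v \<longrightarrow> Y k v \<longrightarrow> t v = e 0) \<or>
    (\<forall>v\<in>U. b \<prec> v \<longrightarrow> Y k v \<longrightarrow> t v \<noteq> e 0)"
    by (rule decide[of A "\<lambda>v e. t v = e 0", OF t']) blast
  have tU': "trm U (\<lambda>e. t (e i))" for i
    using trm_rename[OF t, of "\<lambda>_. i"] dfn_mono[OF _ A] by (simp add: trm_def)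
  \<comment> \<open>Each single value \<open>u\<close> is avoided beyond some bound, at one common
    stage \<open>k\<close>; collection yields one bound for all values below
    \<open>b\<close>.\<close>
  have "\<exists>B\<in>U. \<forall>u\<in>U. u \<prec> b \<longrightarrow> (\<forall>v\<in>U. B \<prec> v \<longrightarrow> Y k v \<longrightarrow> t v \<noteq> u)"
  proof (rule collection)
    show "dfn U (\<lambda>e. \<forall>v\<in>U. e 1 \<prec> v \<longrightarrow> Y k v \<longrightarrow> t v \<noteq> e 0)"
      by (intro dfn_intros dfn_Y tU')
    fix u assume u: "u \<in> U" "u \<prec> b"
    then have "\<not> most (\<lambda>v. t v = u)" using neg by blast
    then show "\<exists>b\<in>U. \<forall>v\<in>U. b \<prec> v \<longrightarrow> Y k v \<longrightarrow> t v \<noteq> u"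
      using k[of "\<lambda>_. u"] u unfolding most_def by auto
  next
    fix u B B' assume "u \<in> U" "B \<in> U" "B' \<in> U" "B \<prec> B'" "\<forall>v\<in>U. B \<prec> v \<longrightarrow> Y k v \<longrightarrow> t v \<noteq> u"
    then show "\<forall>v\<in>U. B' \<prec> v \<longrightarrow> Y k v \<longrightarrow> t v \<noteq> u" using less_trans[of B B'] by blast
  qed (use b in auto)
  then obtain B where B: "B \<in> U" "\<forall>u\<in>U. u \<prec> b \<longrightarrow> (\<forall>v\<in>U. B \<prec> v \<longrightarrow> Y k v \<longrightarrow> t v \<noteq> u)" by blast
  have tU: "t v \<in> U" if "v \<in> U" for v using trm_in[OF t, of "\<lambda>_. v"] that by simp
  have "most (\<lambda>v. B \<prec> v \<and> Y k v)" unfolding most_def using B by blast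
  with b(2) have "most (\<lambda>v. t v \<prec> b \<and> B \<prec> v \<and> Y k v)" by (rule most_conj)
  from most_exists[OF this] show False using B tU by blast
qed

section \<open>The iterated ultrapower\<close>

text \<open>The iterated type: \<open>n\<close> nested quantifiers \<open>most\<close>, the one for
  entry \<open>n - 1\<close> innermost. Entries from \<open>n\<close> on keep the values they have
  in \<open>e\<close>.\<close>

primrec evn :: "nat \<Rightarrow> ((nat \<Rightarrow> 'a) \<Rightarrow> bool) \<Rightarrow> (nat \<Rightarrow> 'a) \<Rightarrow> bool" where
  "evn 0 P e = P e"
| "evn (Suc n) P e = evn n (\<lambda>e. most (\<lambda>v. P (e(n := v)))) e"

lemma evn_mono:
  "evn n P e \<Longrightarrow> env e \<Longrightarrow> (\<And>e. env e \<Longrightarrow> P e \<Longrightarrow> Q e) \<Longrightarrow> evn n Q e"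
proof (induction n arbitrary: P Q)
  case (Suc n)
  from Suc.prems(1) have "evn n (\<lambda>e. most (\<lambda>v. P (e(n := v)))) e" by simp
  then have "evn n (\<lambda>e. most (\<lambda>v. Q (e(n := v)))) e"
    using Suc.prems(2)
  proof (rule Suc.IH)
    fix e assume "env e" "most (\<lambda>v. P (e(n := v)))"
    then show "most (\<lambda>v. Q (e(n := v)))" by (elim most_mono) (rule Suc.prems(3)[OF env_upd])
  qed
  then show ?case by simp
qed simp

lemma evn_cong: "env e \<Longrightarrow> (\<And>e. env e \<Longrightarrow> P e \<longleftrightarrow> Q e) \<Longrightarrow> evn n P e \<longleftrightarrow> evn n Q e"
  using evn_mono[of n P e Q] evn_mono[of n Q e P] by blast

lemma evn_conj: "evn n P e \<Longrightarrow> evn n Q e \<Longrightarrow> env e \<Longrightarrow> evn n (\<lambda>e. P e \<and> Q e) e"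
proof (induction n arbitrary: P Q)
  case (Suc n)
  have "evn n (\<lambda>e. most (\<lambda>v. P (e(n := v))) \<and> most (\<lambda>v. Q (e(n := v)))) e"
    using Suc.prems by (intro Suc.IH) (simp_all only: evn.simps)
  then show ?case unfolding evn.simps using Suc.prems(3) by (rule evn_mono) (simp add: most_conj)
qed simp

lemma supp_comp: "supp n P \<Longrightarrow> supp n (\<lambda>e. h (P e))"
  unfolding supp_def by (intro allI impI arg_cong[of _ _ h]) blast

lemma evn_supp:
  assumes "supp n P" "n \<le> m" "env e" shows "evn m P e \<longleftrightarrow> evn n P e"
  using assms(2)
proof (induction m)
  case (Suc m)
  show ?case
  proof (cases "n = Suc m")
    case False
    with Suc have "n \<le> m" by simp
    then have "most (\<lambda>v. P (e(m := v))) \<longleftrightarrow> P e" if "env e" for e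
    proof -
      have "most (\<lambda>v. P (e(m := v))) \<longleftrightarrow> most (\<lambda>v. P e)"
        using that \<open>n \<le> m\<close> by (intro most_cong suppD[OF assms(1)]) auto
      then show ?thesis by simp
    qed
    then have "evn (Suc m) P e \<longleftrightarrow> evn m P e"
      unfolding evn.simps by (intro evn_cong[OF assms(3)])
    then show ?thesis using Suc \<open>n \<le> m\<close> by simp
  qed simp
qed simp

lemma dfn_upd: "dfn A P \<Longrightarrow> dfn A (\<lambda>e. P ((\<lambda>i. e (Suc i))(n := e 0)))"
  using dfn_rename[of A P "Suc(n := 0)"]
  by (rule back_subst[of "dfn A"]) (auto intro!: ext arg_cong[of _ _ P])

text \<open>Negation passes through each quantifier because \<open>dfn_most\<close> keeps the
  predicate inside definable.\<close>

lemma evn_not: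
  assumes "dfn A P" "env e" shows "evn n (\<lambda>e. \<not> P e) e \<longleftrightarrow> \<not> evn n P e"
  using assms(1)
proof (induction n arbitrary: P)
  case (Suc n)
  note d = dfn_upd[OF Suc.prems, of n]
  have "evn (Suc n) (\<lambda>e. \<not> P e) e \<longleftrightarrow> evn n (\<lambda>e. \<not> most (\<lambda>v. P (e(n := v)))) e"
    unfolding evn.simps by (intro evn_cong[OF assms(2)] most_not[of A "\<lambda>v e. P (e(n := v))", OF d])
  also have "\<dots> \<longleftrightarrow> \<not> evn (Suc n) P e"
    unfolding evn.simps by (rule Suc.IH[OF dfn_most[of A "\<lambda>v e. P (e(n := v))", OF d]])
  finally show ?case .
qed simp

text \<open>\<open>ev P\<close> says that \<open>P\<close> holds of the sequence \<open>c\<close> that generates \<open>N\<close>. The quantifier over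
  \<open>e 0\<close> is the outermost one, so \<open>c n\<close> realizes the type over \<open>M\<close> and \<open>c 0, \<dots>, c (n - 1)\<close>. The
  limit over \<open>n\<close> only matters for predicates without finite support, which do not occur.\<close>

definition ev :: "((nat \<Rightarrow> 'a) \<Rightarrow> bool) \<Rightarrow> bool" where
  "ev P \<longleftrightarrow> (\<exists>n. \<forall>m\<ge>n. evn m P (\<lambda>_. \<zero>))"

lemma ev_supp: "supp n P \<Longrightarrow> ev P \<longleftrightarrow> evn n P (\<lambda>_. \<zero>)"
  unfolding ev_def using evn_supp[of n P _ "\<lambda>_. \<zero>"] by (metis closed(1) env_const nat_le_linear)

lemma ev_mono: "ev P \<Longrightarrow> (\<And>e. env e \<Longrightarrow> P e \<Longrightarrow> Q e) \<Longrightarrow> ev Q"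
  unfolding ev_def using evn_mono[of _ P "\<lambda>_. \<zero>" Q] by fastforce

lemma ev_conj: "ev P \<Longrightarrow> ev Q \<Longrightarrow> ev (\<lambda>e. P e \<and> Q e)"
  unfolding ev_def
proof (elim exE)
  fix n n' assume "\<forall>m\<ge>n. evn m P (\<lambda>_. \<zero>)" "\<forall>m\<ge>n'. evn m Q (\<lambda>_. \<zero>)"
  then show "\<exists>n. \<forall>m\<ge>n. evn m (\<lambda>e. P e \<and> Q e) (\<lambda>_. \<zero>)"
    by (intro exI[of _ "max n n'"]) (auto intro: evn_conj)
qed

lemma ev_const [simp]: "ev (\<lambda>_. Q) \<longleftrightarrow> Q"
  using ev_supp[of 0 "\<lambda>_. Q"] by (simp add: supp_def)

lemma ev_all: "(\<And>e. env e \<Longrightarrow> P e) \<Longrightarrow> ev P"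
  using ev_mono[of "\<lambda>_. True" P] by simp

lemma ev_conj_iff: "ev (\<lambda>e. P e \<and> Q e) \<longleftrightarrow> ev P \<and> ev Q"
  using ev_conj[of P Q] ev_mono[of "\<lambda>e. P e \<and> Q e" P] ev_mono[of "\<lambda>e. P e \<and> Q e" Q] by blast

lemma ev_not: "dfn A P \<Longrightarrow> ev (\<lambda>e. \<not> P e) \<longleftrightarrow> \<not> ev P"
proof -
  assume P: "dfn A P"
  then obtain n where n: "supp n P" using dfn_supp by blast
  then have "supp n (\<lambda>e. \<not> P e)" by (rule supp_comp)
  with n show ?thesis using ev_supp evn_not[OF P] by simp
qed

text \<open>Representatives of the elements of \<open>N\<close>: functions of the generators that
  are definable with parameters from \<open>M\<close>. Each of them reads finitely many
  entries.\<close>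

definition D :: "((nat \<Rightarrow> 'a) \<Rightarrow> 'a) set" where "D = {f. trm U f}"

lemma D_in: "f \<in> D \<Longrightarrow> env e \<Longrightarrow> f e \<in> U"
  by (auto simp: D_def trm_in)

lemma D_supp: "f \<in> D \<Longrightarrow> \<exists>n. supp n f"
  by (auto simp: D_def trm_supp)

text \<open>An element of \<open>D\<close> is determined by a formula, a number of variables and one parameter, so
  \<open>D\<close> has no more elements up to equivalence than \<open>M\<close>.\<close>

lemma classes:
  "\<exists>nf :: ((nat \<Rightarrow> 'a) \<Rightarrow> 'a) \<Rightarrow> 'a. \<forall>f\<in>D. \<forall>g\<in>D. nf f = nf g \<longleftrightarrow> ev (\<lambda>e. f e = g e)"
proof -
  have "\<exists>p n w. w \<in> U \<and> (\<forall>e. env e \<longrightarrow> (e 0 = f (\<lambda>i. e (Suc i)) \<longleftrightarrow> sat M {} (mrg n e (\<lambda>_. w)) p))"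
    if "f \<in> D" for f
  proof -
    let ?P = "\<lambda>e. e 0 = f (\<lambda>i. e (Suc i))"
    have f: "dfn U ?P" using that by (auto simp: D_def trm_def)
    then obtain n where n: "supp n ?P" using dfn_supp by blast
    obtain Q where Q: "dfn {} Q" "\<And>r. env r \<Longrightarrow>
        \<exists>w\<in>U. \<forall>e. env e \<longrightarrow> (?P (mrg n e r) \<longleftrightarrow> Q (mrg n e (\<lambda>_. w)))"
      by (rule merge[OF f, of n]) blast
    obtain p where p: "\<And>e. env e \<Longrightarrow> Q e \<longleftrightarrow> sat M {} e p" by (rule dfn_formula[OF Q(1)]) blast
    obtain w where w: "w \<in> U" "\<And>e. env e \<Longrightarrow> ?P (mrg n e (\<lambda>_. \<zero>)) \<longleftrightarrow> Q (mrg n e (\<lambda>_. w))"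
      using Q(2)[of "\<lambda>_. \<zero>"] by auto
    have "?P e \<longleftrightarrow> ?P (mrg n e (\<lambda>_. \<zero>))" if "env e" for e
      by (rule suppD[OF n that env_mrg[OF that env_const]]) (auto simp: mrg_def)
    then have "\<forall>e. env e \<longrightarrow> (?P e \<longleftrightarrow> sat M {} (mrg n e (\<lambda>_. w)) p)" using w p by simp
    with w(1) show ?thesis by blast
  qed
  then obtain p n w where pnw: "\<And>f. f \<in> D \<Longrightarrow> w f \<in> U" "\<And>f e. f \<in> D \<Longrightarrow> env e \<Longrightarrow>
      (e 0 = f (\<lambda>i. e (Suc i)) \<longleftrightarrow> sat M {} (mrg (n f) e (\<lambda>_. w f)) (p f))"
    by metis
  \<comment> \<open>The formula and the number of variables come from a countable set and are coded
    by a numeral. Functions in \<open>D\<close> with equal codes agree at every assignment.\<close>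
  define c where "c f = pr (num (to_nat (p f, n f))) (w f)" for f
  have c: "ev (\<lambda>e. f e = g e)" if "f \<in> D" "g \<in> D" "c f = c g" for f g
  proof (rule ev_all)
    fix e assume e: "env e"
    have "p f = p g" "n f = n g" "w f = w g"
      using that pnw(1) by (auto simp: c_def num_inj)
    then show "f e = g e"
      using pnw(2)[OF that(1), of "case_nat (f e) e"] pnw(2)[OF that(2), of "case_nat (f e) e"]
        D_in that e by simp
  qed
  \<comment> \<open>The code of a chosen member of the class of \<open>f\<close>; equivalent
    functions have the same class and hence the same chosen member.\<close>
  define nf where "nf f = c (SOME g. g \<in> D \<and> ev (\<lambda>e. g e = f e))" for f
  have trans: "ev (\<lambda>e. f e = h e)" if "ev (\<lambda>e. f e = g e)" "ev (\<lambda>e. g e = h e)" for f g h :: "(nat \<Rightarrow> 'a) \<Rightarrow> 'a"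
    by (rule ev_mono[OF ev_conj[OF that]]) simp
  have sym: "ev (\<lambda>e. g e = f e)" if "ev (\<lambda>e. f e = g e)" for f g :: "(nat \<Rightarrow> 'a) \<Rightarrow> 'a"
    by (rule ev_mono[OF that]) simp
  have some: "(SOME g. g \<in> D \<and> ev (\<lambda>e. g e = f e)) \<in> D \<and>
      ev (\<lambda>e. (SOME g. g \<in> D \<and> ev (\<lambda>e. g e = f e)) e = f e)" if "f \<in> D" for f
    by (rule someI[of _ f]) (use that in simp)
  have "nf f = nf g \<longleftrightarrow> ev (\<lambda>e. f e = g e)" if fg: "f \<in> D" "g \<in> D" for f g
  proof
    assume "nf f = nf g"
    then have "ev (\<lambda>e. (SOME g. g \<in> D \<and> ev (\<lambda>e. g e = f e)) e = (SOME f. f \<in> D \<and> ev (\<lambda>e. f e = g e)) e)"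
      unfolding nf_def by (intro c) (use some fg in auto)
    then show "ev (\<lambda>e. f e = g e)" using some fg trans sym by meson
  next
    assume "ev (\<lambda>e. f e = g e)"
    then have "(\<lambda>h. h \<in> D \<and> ev (\<lambda>e. h e = f e)) = (\<lambda>h. h \<in> D \<and> ev (\<lambda>e. h e = g e))"
      using trans sym by blast
    then show "nf f = nf g" by (simp add: nf_def)
  qed
  then show ?thesis by blast
qed

text \<open>Classes are named by elements of the carrier type of \<open>M\<close> rather than by
  sets of functions, so that \<open>N\<close> is a structure over the same type.\<close>

definition nf :: "((nat \<Rightarrow> 'a) \<Rightarrow> 'a) \<Rightarrow> 'a" where
  "nf = (SOME nf. \<forall>f\<in>D. \<forall>g\<in>D. nf f = nf g \<longleftrightarrow> ev (\<lambda>e. f e = g e))"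

lemma nf_eq: "f \<in> D \<Longrightarrow> g \<in> D \<Longrightarrow> nf f = nf g \<longleftrightarrow> ev (\<lambda>e. f e = g e)"
  using someI_ex[OF classes] unfolding nf_def by blast

definition rp :: "'a \<Rightarrow> (nat \<Rightarrow> 'a) \<Rightarrow> 'a" where "rp a = (SOME f. f \<in> D \<and> nf f = a)"

lemma rp: "f \<in> D \<Longrightarrow> rp (nf f) \<in> D \<and> ev (\<lambda>e. rp (nf f) e = f e)"
  using someI[of "\<lambda>g. g \<in> D \<and> nf g = nf f" f] nf_eq unfolding rp_def by blast

section \<open>The structure \<open>N\<close> and the theorem of Los\<close>

definition N :: "'a la_structure" where
  "N = \<lparr>universe = nf ` D, zeroS = nf (\<lambda>_. \<zero>), succS = \<lambda>a. nf (\<lambda>e. \<S> (rp a e)),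
    addS = \<lambda>a b. nf (\<lambda>e. rp a e \<oplus> rp b e), mulS = \<lambda>a b. nf (\<lambda>e. rp a e \<otimes> rp b e),
    lessS = \<lambda>a b. ev (\<lambda>e. rp a e \<prec> rp b e)\<rparr>"

lemma D_intros:
  "(\<lambda>_. \<zero>) \<in> D" "f \<in> D \<Longrightarrow> (\<lambda>e. \<S> (f e)) \<in> D" "f \<in> D \<Longrightarrow> g \<in> D \<Longrightarrow> (\<lambda>e. f e \<oplus> g e) \<in> D"
  "f \<in> D \<Longrightarrow> g \<in> D \<Longrightarrow> (\<lambda>e. f e \<otimes> g e) \<in> D" "(\<lambda>e. e i) \<in> D" "a \<in> U \<Longrightarrow> (\<lambda>_. a) \<in> D"
  by (auto simp: D_def intro: dfn_intros)

lemma N_universe: "universe N = nf ` D"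
  by (simp add: N_def)

lemma N_simps:
  assumes "f \<in> D" "g \<in> D"
  shows "succS N (nf f) = nf (\<lambda>e. \<S> (f e))" "addS N (nf f) (nf g) = nf (\<lambda>e. f e \<oplus> g e)"
    "mulS N (nf f) (nf g) = nf (\<lambda>e. f e \<otimes> g e)" "lessS N (nf f) (nf g) \<longleftrightarrow> ev (\<lambda>e. f e \<prec> g e)"
proof -
  note f = rp[OF assms(1)] and g = rp[OF assms(2)]
  have fg: "ev (\<lambda>e. rp (nf f) e = f e \<and> rp (nf g) e = g e)" using f g by (simp add: ev_conj)
  show "succS N (nf f) = nf (\<lambda>e. \<S> (f e))"
    unfolding N_def using f assms by (auto simp: nf_eq D_intros elim: ev_mono)
  show "addS N (nf f) (nf g) = nf (\<lambda>e. f e \<oplus> g e)" "mulS N (nf f) (nf g) = nf (\<lambda>e. f e \<otimes> g e)"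
    unfolding N_def using f g fg assms by (auto simp: nf_eq D_intros elim!: ev_mono)
  show "lessS N (nf f) (nf g) \<longleftrightarrow> ev (\<lambda>e. f e \<prec> g e)"
  proof
    assume "lessS N (nf f) (nf g)"
    then have "ev (\<lambda>e. rp (nf f) e \<prec> rp (nf g) e)" by (simp add: N_def)
    from ev_conj[OF fg this] show "ev (\<lambda>e. f e \<prec> g e)" by (rule ev_mono) auto
  next
    assume "ev (\<lambda>e. f e \<prec> g e)"
    from ev_conj[OF fg this] have "ev (\<lambda>e. rp (nf f) e \<prec> rp (nf g) e)" by (rule ev_mono) auto
    then show "lessS N (nf f) (nf g)" by (simp add: N_def)
  qed
qed

lemmas N_succ = N_simps(1)[OF _ D_intros(1)]

lemma eval_N:
  assumes "\<And>i. f i \<in> D"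
  shows "(\<lambda>e. eval M (\<lambda>i. f i e) t) \<in> D \<and> eval N (\<lambda>i. nf (f i)) t = nf (\<lambda>e. eval M (\<lambda>i. f i e) t)"
proof (induction t)
  case Zero show ?case by (simp add: D_intros, simp add: N_def)
qed (simp_all add: assms D_intros N_succ N_simps(2,3))

lemma dfn_sat_D:
  assumes "\<And>i. f i \<in> D" "is_LA p" shows "dfn U (\<lambda>e. sat M {} (\<lambda>i. f i e) p)"
  using dfn_subst[OF _ dfn_sat[OF assms(2)], of U f] assms(1) by (simp add: D_def)

text \<open>Negation uses that the type is complete on definable predicates. For \<open>Ex\<close>
  the witness has to be an element of \<open>N\<close>: the Skolem function from
  \<open>trm_choice\<close> is definable with parameters, hence in \<open>D\<close>.\<close>

theorem Los:
  assumes "\<And>i. f i \<in> D" "is_LA p"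
  shows "sat N {} (\<lambda>i. nf (f i)) p \<longleftrightarrow> ev (\<lambda>e. sat M {} (\<lambda>i. f i e) p)"
  using assms
proof (induction p arbitrary: f)
  case (Eq s t)
  then show ?case using eval_N[of f s] eval_N[of f t] by (simp add: nf_eq)
next
  case (Lt s t)
  then show ?case using eval_N[of f s] eval_N[of f t] by (simp add: N_simps)
next
  case (Neg p)
  then show ?case using ev_not[OF dfn_sat_D[of f p]] by simp
next
  case (Conj p q)
  then show ?case by (simp add: ev_conj_iff)
next
  case (Ex p)
  have IH: "sat N {} (case_nat (nf g) (\<lambda>i. nf (f i))) p \<longleftrightarrow> ev (\<lambda>e. sat M {} (case_nat (g e) (\<lambda>i. f i e)) p)"
    if "g \<in> D" for g
  proof -
    have "sat N {} (\<lambda>i. nf (case_nat g f i)) p \<longleftrightarrow> ev (\<lambda>e. sat M {} (\<lambda>i. case_nat g f i e) p)"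
      using Ex that by (intro Ex.IH) (auto split: nat.splits)
    moreover have "(\<lambda>i. nf (case_nat g f i)) = case_nat (nf g) (\<lambda>i. nf (f i))"
      "(\<lambda>i. case_nat g f i e) = case_nat (g e) (\<lambda>i. f i e)" for e
      by (rule ext, simp split: nat.splits)+
    ultimately show ?thesis by simp
  qed
  show ?case
  proof
    assume "sat N {} (\<lambda>i. nf (f i)) (Ex p)"
    then obtain g where g: "g \<in> D" "ev (\<lambda>e. sat M {} (case_nat (g e) (\<lambda>i. f i e)) p)"
      using IH by (auto simp: N_universe)
    from g(2) show "ev (\<lambda>e. sat M {} (\<lambda>i. f i e) (Ex p))"
      by (rule ev_mono) (use D_in[OF g(1)] in auto)
  next
    assume ex: "ev (\<lambda>e. sat M {} (\<lambda>i. f i e) (Ex p))"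
    have "(\<lambda>i. case_nat (\<lambda>e. e 0) (\<lambda>i e. f i (\<lambda>i. e (Suc i))) i e) = case_nat (e 0) (\<lambda>i. f i (\<lambda>i. e (Suc i)))"
      for e by (rule ext) (simp split: nat.splits)
    moreover have "case_nat (\<lambda>e. e 0) (\<lambda>i e. f i (\<lambda>i. e (Suc i))) i \<in> D" for i
      using Ex.prems(1) by (cases i) (simp_all add: D_def trm_var trm_rename)
    ultimately have "dfn U (\<lambda>e. sat M {} (case_nat (e 0) (\<lambda>i. f i (\<lambda>i. e (Suc i)))) p)"
      using dfn_sat_D[of "case_nat (\<lambda>e. e 0) (\<lambda>i e. f i (\<lambda>i. e (Suc i)))" p] Ex.prems(2) by simp
    then obtain g where g: "trm U g" "\<And>e x. env e \<Longrightarrow> x \<in> U \<Longrightarrow> sat M {} (case_nat x (\<lambda>i. f i e)) p \<Longrightarrow>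
        sat M {} (case_nat (g e) (\<lambda>i. f i e)) p"
      by (rule trm_choice[of U "\<lambda>x e. sat M {} (case_nat x (\<lambda>i. f i e)) p"]) blast
    from ex have "ev (\<lambda>e. sat M {} (case_nat (g e) (\<lambda>i. f i e)) p)"
      by (rule ev_mono) (use g(2) in auto)
    then show "sat N {} (\<lambda>i. nf (f i)) (Ex p)" using IH[of g] g(1) by (auto simp: N_universe D_def)
  qed
qed simp

end

section \<open>Coded sequences and bounded formulas\<close>

lemma subst_lift_Var: "case_nat (Var 0) (\<lambda>i. lift_tm (Var (\<tau> i))) = (\<lambda>i. Var (case_nat 0 (\<lambda>i. Suc (\<tau> i)) i))"
  by (rule ext) (simp add: lift_tm_def split: nat.splits)

lemma fv_tm_rename: "fv_tm (subst_tm (\<lambda>i. Var (\<tau> i)) t) = \<tau> ` fv_tm t"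
  by (induction t) auto

lemma fv_rename: "fv (subst (\<lambda>i. Var (\<tau> i)) p) \<subseteq> range \<tau>"
proof (induction p arbitrary: \<tau>)
  case (Ex p)
  have "j \<in> range \<tau>" if "Suc j \<in> fv (subst (\<lambda>i. Var (case_nat 0 (\<lambda>i. Suc (\<tau> i)) i)) p)" for j
  proof -
    have "Suc j \<in> range (case_nat 0 (\<lambda>i. Suc (\<tau> i)))" using Ex that by blast
    then show ?thesis by (auto split: nat.splits)
  qed
  then show ?case by (auto simp: subst_lift_Var)
qed (auto simp: fv_tm_rename)

lemma sat_foldr_Imp: "sat M X e (foldr Imp ps q) \<longleftrightarrow> ((\<forall>p\<in>set ps. sat M X e p) \<longrightarrow> sat M X e q)"
  by (induction ps) auto

context arith
begin

lemma trm_subst: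
  assumes "trm A t" "\<And>i. trm A (h i)" shows "trm A (\<lambda>e. t (\<lambda>i. h i e))"
proof -
  have "trm A (case_nat (\<lambda>e. e 0) (\<lambda>i e. h i (\<lambda>i. e (Suc i))) i)" for i
    by (cases i) (simp_all add: trm_var trm_rename[OF assms(2)])
  from dfn_subst[of A "case_nat (\<lambda>e. e 0) (\<lambda>i e. h i (\<lambda>i. e (Suc i)))", OF this,
      of "\<lambda>e. e 0 = t (\<lambda>i. e (Suc i))"] show ?thesis
    using assms by (simp add: trm_def env_def)
qed

text \<open>A code of \<open>u\<close> elements bounded by \<open>y\<close> is extended by an
  element of \<open>K\<close> above \<open>y\<close>. The induction formula contains
  \<open>K\<close> and quantifies over codes without bound, so for a \<open>K\<close> that involves
  the predicate symbol it draws on more than bounded induction.\<close>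

lemma long_sequences:
  assumes K: "dfn U (\<lambda>e. K (e 0))" and unb: "\<And>b. b \<in> U \<Longrightarrow> \<exists>v\<in>U. b \<prec> v \<and> K v" and u: "u \<in> U"
  shows "\<exists>y\<in>U. \<exists>f. (\<forall>i\<in>U. i \<prec> u \<longrightarrow> f i \<in> U \<and> f i \<preceq> y \<and> K (f i)) \<and> inj_on f {i \<in> U. i \<prec> u}"
proof -
  have K': "dfn U (\<lambda>e. K (e i))" for i by (rule dfn_app1[OF K trm_var])
  \<comment> \<open>The coded relation need not be a function: each index has some \<open>x\<close>
    to which no other index is related, and any choice of such elements is injective.\<close>
  define Q where "Q u a b y \<longleftrightarrow> (\<forall>i\<in>U. i \<prec> u \<longrightarrow> (\<exists>x\<in>U. x \<preceq> y \<and> K x \<and> elt a b (pr i x) \<and>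
      (\<forall>i'\<in>U. i' \<prec> u \<longrightarrow> i' \<noteq> i \<longrightarrow> \<not> elt a b (pr i' x))))" for u a b y
  have "\<exists>a\<in>U. \<exists>b\<in>U. \<exists>y\<in>U. Q u a b y" using u
  proof (induction rule: dfn_induct)
    case dfn show ?case unfolding Q_def by (intro dfn_intros K' dfn_elt trm_pr)
  next
    case zero show ?case by (auto simp: Q_def)
  next
    case (suc u)
    then obtain a b y where ab: "a \<in> U" "b \<in> U" "y \<in> U" and Q: "Q u a b y" by blast
    obtain z where z: "z \<in> U" "y \<prec> z" "K z" using unb ab by blast
    have xz: "x \<prec> z" if "x \<in> U" "x \<preceq> y" for x using that z ab leq_less_trans by blast
    \<comment> \<open>The new code keeps only the pairs with \<open>i \<prec> u\<close> and
      \<open>x \<preceq> y\<close>, so that stray members of the old code do no harm, and adds the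
      pair of \<open>u\<close> and the fresh element \<open>z\<close>.\<close>
    define P where "P w \<longleftrightarrow> (\<exists>i\<in>U. \<exists>x\<in>U. i \<prec> u \<and> x \<preceq> y \<and> w = pr i x \<and> elt a b w) \<or> w = pr u z" for w
    have "dfn U (\<lambda>e. P (e 0))" unfolding P_def by (intro dfn_intros dfn_elt trm_pr ab z suc(1) pr_in)
    moreover have "pr u z \<in> U" using suc(1) z by simp
    ultimately obtain a' b' where ab': "a' \<in> U" "b' \<in> U"
      "\<And>w. w \<in> U \<Longrightarrow> w \<preceq> pr u z \<Longrightarrow> elt a' b' w \<longleftrightarrow> P w"
      using comprehension[of P "pr u z"] by blast
    have elt: "elt a' b' (pr i x) \<longleftrightarrow> (i \<prec> u \<and> x \<preceq> y \<and> elt a b (pr i x)) \<or> (i = u \<and> x = z)"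
      if "i \<in> U" "x \<in> U" "i \<prec> \<S> u" "x \<preceq> z" for i x
    proof -
      have "pr i x \<preceq> pr u z" using that suc(1) z by (intro pr_mono) (auto simp: less_S)
      then have "elt a' b' (pr i x) \<longleftrightarrow> P (pr i x)" using ab'(3) that by simp
      also have "\<dots> \<longleftrightarrow> (i \<prec> u \<and> x \<preceq> y \<and> elt a b (pr i x)) \<or> (i = u \<and> x = z)"
        unfolding P_def using that suc(1) z(1) by auto
      finally show ?thesis .
    qed
    have "Q (\<S> u) a' b' z" unfolding Q_def
    proof (intro ballI impI)
      fix i assume i: "i \<in> U" "i \<prec> \<S> u"
      show "\<exists>x\<in>U. x \<preceq> z \<and> K x \<and> elt a' b' (pr i x) \<and>
          (\<forall>i'\<in>U. i' \<prec> \<S> u \<longrightarrow> i' \<noteq> i \<longrightarrow> \<not> elt a' b' (pr i' x))"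
      proof (cases "i = u")
        case True
        have "\<not> z \<preceq> y" using xz[of z] z less_irrefl[of z] by blast
        then have "elt a' b' (pr i z) \<and> (\<forall>i'\<in>U. i' \<prec> \<S> u \<longrightarrow> i' \<noteq> i \<longrightarrow> \<not> elt a' b' (pr i' z))"
          using elt[of _ z] z i True by auto
        then show ?thesis using z by blast
      next
        case False
        then have "i \<prec> u" using i less_S suc(1) by blast
        then obtain x where x: "x \<in> U" "x \<preceq> y" "K x" "elt a b (pr i x)"
          "\<And>i'. i' \<in> U \<Longrightarrow> i' \<prec> u \<Longrightarrow> i' \<noteq> i \<Longrightarrow> \<not> elt a b (pr i' x)"
          using Q[unfolded Q_def, rule_format, OF i(1) \<open>i \<prec> u\<close>] by blast
        have "x \<prec> z" using xz x by blast
        then have "x \<noteq> z" using less_irrefl z(1) by blast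
        then have "elt a' b' (pr i x) \<and> (\<forall>i'\<in>U. i' \<prec> \<S> u \<longrightarrow> i' \<noteq> i \<longrightarrow> \<not> elt a' b' (pr i' x))"
          using elt[of _ x] x i \<open>i \<prec> u\<close> \<open>x \<prec> z\<close> by auto
        then show ?thesis using x \<open>x \<prec> z\<close> by blast
      qed
    qed
    then show ?case using ab' z by blast
  qed
  then obtain a b y where ab: "a \<in> U" "b \<in> U" "y \<in> U" and Q: "Q u a b y" by blast
  then obtain f where f: "\<And>i. i \<in> U \<Longrightarrow> i \<prec> u \<Longrightarrow> f i \<in> U \<and> f i \<preceq> y \<and> K (f i) \<and> elt a b (pr i (f i)) \<and>
      (\<forall>i'\<in>U. i' \<prec> u \<longrightarrow> i' \<noteq> i \<longrightarrow> \<not> elt a b (pr i' (f i)))"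
    unfolding Q_def by metis
  moreover have "inj_on f {i \<in> U. i \<prec> u}"
  proof (rule inj_onI, rule ccontr)
    fix i i' assume "i \<in> {i \<in> U. i \<prec> u}" "i' \<in> {i \<in> U. i \<prec> u}" "f i = f i'" "i \<noteq> i'"
    then show False using f[of i] f[of i'] by auto
  qed
  ultimately show ?thesis using ab(3) by blast
qed

section \<open>Bounded formulas depend on the predicate only up to a bound\<close>

lemma upper_bound: "finite A \<Longrightarrow> A \<subseteq> U \<Longrightarrow> \<exists>b\<in>U. \<forall>x\<in>A. x \<preceq> b"
proof (induction rule: finite_induct)
  case (insert a A)
  then obtain b where b: "b \<in> U" "\<And>x. x \<in> A \<Longrightarrow> x \<preceq> b" by auto
  have "x \<preceq> a \<oplus> b" if "x \<in> insert a A" for x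
    using that b insert leq_add[of a b] leq_add(2)[of b a] leq_trans[of x b "a \<oplus> b"] by blast
  then show ?case using b insert by (intro bexI[of _ "a \<oplus> b"]) auto
qed auto

lemma trm_eval: "trm A (\<lambda>e. eval M e t)"
  by (induction t) (auto intro: dfn_intros)

lemma eval_in [simp]: "env e \<Longrightarrow> eval M e t \<in> U"
  using trm_in[OF trm_eval] by blast

text \<open>Membership in a finite set is a finite disjunction of equations with parameters, so the
  predicate symbol can be eliminated.\<close>

lemma dfn_sat_finite:
  assumes "finite F" "F \<subseteq> U" shows "dfn U (\<lambda>e. sat M F e p)"
proof (induction p)
  case (Ind t)
  have "dfn U (\<lambda>e. eval M e t \<in> F)" using assms
  proof (induction rule: finite_induct)
    case (insert a F)
    then have "dfn U (\<lambda>e. eval M e t = a \<or> eval M e t \<in> F)" by (intro dfn_intros trm_eval) auto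
    then show ?case by (rule dfn_cong) auto
  qed (simp add: dfn_const)
  then show ?case by simp
next
  case (Ex p)
  then show ?case by (auto intro!: dfn_ex)
qed (auto intro: dfn_intros trm_eval)

lemma eval_bounded:
  "b \<in> U \<Longrightarrow> \<exists>B\<in>U. \<forall>e. env e \<longrightarrow> (\<forall>i\<in>fv_tm t. e i \<preceq> b) \<longrightarrow> eval M e t \<preceq> B"
proof (induction t)
  case (Succ t)
  then obtain B where "B \<in> U" "\<forall>e. env e \<longrightarrow> (\<forall>i\<in>fv_tm t. e i \<preceq> b) \<longrightarrow> eval M e t \<preceq> B" by blast
  then show ?case by (intro bexI[of _ "\<S> B"]) auto
next
  case (Add s t)
  then obtain B B' where "B \<in> U" "\<forall>e. env e \<longrightarrow> (\<forall>i\<in>fv_tm s. e i \<preceq> b) \<longrightarrow> eval M e s \<preceq> B"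
    "B' \<in> U" "\<forall>e. env e \<longrightarrow> (\<forall>i\<in>fv_tm t. e i \<preceq> b) \<longrightarrow> eval M e t \<preceq> B'" by blast
  then show ?case by (intro bexI[of _ "B \<oplus> B'"]) (simp_all add: add_mono)
next
  case (Mul s t)
  then obtain B B' where "B \<in> U" "\<forall>e. env e \<longrightarrow> (\<forall>i\<in>fv_tm s. e i \<preceq> b) \<longrightarrow> eval M e s \<preceq> B"
    "B' \<in> U" "\<forall>e. env e \<longrightarrow> (\<forall>i\<in>fv_tm t. e i \<preceq> b) \<longrightarrow> eval M e t \<preceq> B'" by blast
  then show ?case by (intro bexI[of _ "B \<otimes> B'"]) (simp_all add: mul_mono)
qed (auto intro: bexI[of _ \<zero>])

lemma fv_tm_lift: "fv_tm (lift_tm t) = Suc ` fv_tm t"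
  unfolding lift_tm_def by (rule fv_tm_rename)

lemma eval_lift: "eval M (case_nat a e) (lift_tm t) = eval M e t"
  by (simp add: lift_tm_def eval_subst_tm)

definition agree :: "'a \<Rightarrow> 'a set \<Rightarrow> 'a set \<Rightarrow> bool" where
  "agree B I J \<longleftrightarrow> (\<forall>x\<in>U. x \<preceq> B \<longrightarrow> (x \<in> I \<longleftrightarrow> x \<in> J))"

lemma agree_mono: "agree B' I J \<Longrightarrow> B \<preceq> B' \<Longrightarrow> B \<in> U \<Longrightarrow> B' \<in> U \<Longrightarrow> agree B I J"
  unfolding agree_def using leq_trans[of _ B B'] by blast

text \<open>The part common to both kinds of bounded quantifier. Quantified values lie below
  \<open>t\<close>, and \<open>t\<close> is bounded by some \<open>T\<close>, so the hypothesis on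
  \<open>q\<close> is used with the larger bound \<open>b \<oplus> T\<close>.\<close>

lemma bounded_quantifier_local:
  assumes b: "b \<in> U" and IH: "\<And>b. b \<in> U \<Longrightarrow> \<exists>B\<in>U. \<forall>e I J. env e \<longrightarrow> (\<forall>i\<in>fv q. e i \<preceq> b) \<longrightarrow>
    agree B I J \<longrightarrow> (sat M I e q \<longleftrightarrow> sat M J e q)"
  shows "\<exists>B\<in>U. \<forall>e I J a. env e \<longrightarrow> (\<forall>i. Suc i \<in> fv_tm (lift_tm t) \<union> fv q \<longrightarrow> e i \<preceq> b) \<longrightarrow> agree B I J \<longrightarrow>
    a \<in> U \<longrightarrow> a \<prec> eval M e t \<longrightarrow> (sat M I (case_nat a e) q \<longleftrightarrow> sat M J (case_nat a e) q)"
proof -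
  obtain T where T: "T \<in> U" "\<And>e. env e \<Longrightarrow> \<forall>i\<in>fv_tm t. e i \<preceq> b \<Longrightarrow> eval M e t \<preceq> T"
    using eval_bounded b by blast
  have bT: "x \<preceq> b \<oplus> T" if "x \<in> U" "x \<preceq> b \<or> x \<preceq> T" for x
    using that leq_trans[of x _ "b \<oplus> T"] leq_add(1)[of b T] leq_add(2)[of T b] T(1) b closed(3) by metis
  obtain B where B: "B \<in> U" "\<And>e I J. env e \<Longrightarrow> \<forall>i\<in>fv q. e i \<preceq> b \<oplus> T \<Longrightarrow> agree B I J \<Longrightarrow>
    (sat M I e q \<longleftrightarrow> sat M J e q)" using IH[of "b \<oplus> T"] T(1) b by auto
  have "sat M I (case_nat a e) q \<longleftrightarrow> sat M J (case_nat a e) q"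
    if e: "env e" "\<And>i. Suc i \<in> fv_tm (lift_tm t) \<union> fv q \<Longrightarrow> e i \<preceq> b"
      and a: "agree B I J" "a \<in> U" "a \<prec> eval M e t" for e I J a
  proof (rule B(2))
    have "eval M e t \<preceq> T" using T(2) e by (simp add: fv_tm_lift)
    then have "a \<preceq> T" using leq_trans[of a "eval M e t" T] a T e by simp
    show "\<forall>i\<in>fv q. case_nat a e i \<preceq> b \<oplus> T"
    proof
      fix i assume i: "i \<in> fv q"
      show "case_nat a e i \<preceq> b \<oplus> T"
        using bT[of a] bT[of "e (i - 1)"] \<open>a \<preceq> T\<close> a(2) e i by (cases i) auto
    qed
  qed (use e a in auto)
  then show ?thesis using B(1) by blast
qed

text \<open>Quantified values stay below values of terms, so every argument of the predicate is
  bounded in terms of \<open>b\<close>. The bound \<open>B\<close> is uniform in the assignment and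
  in both predicates.\<close>

lemma Delta0_local:
  assumes "Delta0 p" "b \<in> U"
  shows "\<exists>B\<in>U. \<forall>e I J. env e \<longrightarrow> (\<forall>i\<in>fv p. e i \<preceq> b) \<longrightarrow> agree B I J \<longrightarrow>
    (sat M I e p \<longleftrightarrow> sat M J e p)"
  using assms
proof (induction arbitrary: b)
  case (3 t)
  then obtain B where "B \<in> U" "\<forall>e. env e \<longrightarrow> (\<forall>i\<in>fv_tm t. e i \<preceq> b) \<longrightarrow> eval M e t \<preceq> B"
    using eval_bounded by blast
  then show ?case unfolding agree_def fv.simps sat.simps by (metis eval_in)
next
  case (4 p)
  then show ?case by simp
next
  case (5 p q)
  obtain B where B: "B \<in> U" "\<And>e I J. env e \<Longrightarrow> \<forall>i\<in>fv p. e i \<preceq> b \<Longrightarrow> agree B I J \<Longrightarrow>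
    (sat M I e p \<longleftrightarrow> sat M J e p)" using "5.IH"(1)[OF "5.prems"] by blast
  obtain B' where B': "B' \<in> U" "\<And>e I J. env e \<Longrightarrow> \<forall>i\<in>fv q. e i \<preceq> b \<Longrightarrow> agree B' I J \<Longrightarrow>
    (sat M I e q \<longleftrightarrow> sat M J e q)" using "5.IH"(2)[OF "5.prems"] by blast
  have "agree B I J \<and> agree B' I J" if "agree (B \<oplus> B') I J" for I J
    using that agree_mono[OF that] leq_add(1)[OF B(1) B'(1)] leq_add(2)[OF B'(1) B(1)] B(1) B'(1) by simp
  then have "\<forall>e I J. env e \<longrightarrow> (\<forall>i\<in>fv (Conj p q). e i \<preceq> b) \<longrightarrow> agree (B \<oplus> B') I J \<longrightarrow>
    (sat M I (e :: nat \<Rightarrow> 'a) (Conj p q) \<longleftrightarrow> sat M J e (Conj p q))"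
    using B(2) B'(2) by (metis UnI1 UnI2 fv.simps(5) sat.simps(5))
  then show ?case using B(1) B'(1) by (intro bexI[of _ "B \<oplus> B'"]) auto
next
  case (6 q t)
  from bounded_quantifier_local[OF "6.prems" "6.IH", of t] obtain B where "B \<in> U"
    "\<And>e I J a. env e \<Longrightarrow> \<forall>i. Suc i \<in> fv_tm (lift_tm t) \<union> fv q \<longrightarrow> e i \<preceq> b \<Longrightarrow> agree B I J \<Longrightarrow> a \<in> U \<Longrightarrow>
      a \<prec> eval M e t \<Longrightarrow> (sat M I (case_nat a e) q \<longleftrightarrow> sat M J (case_nat a e) q)" by blast
  then show ?case by (intro bexI[of _ B]) (auto simp: eval_lift)
next
  case (7 q t)
  from bounded_quantifier_local[OF "7.prems" "7.IH", of t] obtain B where "B \<in> U"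
    "\<And>e I J a. env e \<Longrightarrow> \<forall>i. Suc i \<in> fv_tm (lift_tm t) \<union> fv q \<longrightarrow> e i \<preceq> b \<Longrightarrow> agree B I J \<Longrightarrow> a \<in> U \<Longrightarrow>
      a \<prec> eval M e t \<Longrightarrow> (sat M I (case_nat a e) q \<longleftrightarrow> sat M J (case_nat a e) q)" by blast
  then show ?case by (intro bexI[of _ B]) (auto simp: eval_lift)
qed (auto intro: bexI[of _ \<zero>])

text \<open>Below any bound the predicate is finite, hence definable with parameters, and a \<open>\<Delta>\<^sub>0\<close>-formula
  only sees the predicate up to some bound.\<close>

lemma Delta0_induction:
  assumes fin: "\<And>B. B \<in> U \<Longrightarrow> finite {x \<in> I. x \<preceq> B}" and "I \<subseteq> U" and p: "Delta0 p" and s: "env s"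
  shows "sat M I s (induction_axiom p)"
proof -
  define P where "P x \<longleftrightarrow> sat M I (case_nat x s) p" for x
  have sub: "(\<lambda>i. eval M (case_nat y s) (case_nat (Succ (Var 0)) (\<lambda>i. Var (Suc i)) i)) = case_nat (\<S> y) s"
    "(\<lambda>i. eval M s (case_nat Zero Var i)) = case_nat \<zero> s" for y
    by (rule ext, simp split: nat.splits)+
  have "P a" if P0: "P \<zero>" and PS: "\<And>x. x \<in> U \<Longrightarrow> P x \<Longrightarrow> P (\<S> x)" and a: "a \<in> U" for a
  proof -
    have "finite (case_nat a s ` fv p)" "case_nat a s ` fv p \<subseteq> U"
      using finite_fv s a by (auto split: nat.splits)
    then obtain b' where b': "b' \<in> U" "\<And>i. i \<in> fv p \<Longrightarrow> case_nat a s i \<preceq> b'"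
      using upper_bound[of "case_nat a s ` fv p"] by blast
    define b where "b = a \<oplus> b'"
    have b: "b \<in> U" "a \<preceq> b" "b' \<preceq> b" using a b' leq_add by (auto simp: b_def)
    obtain B where B: "B \<in> U" "\<And>e I J. env e \<Longrightarrow> \<forall>i\<in>fv p. e i \<preceq> b \<Longrightarrow> agree B I J \<Longrightarrow>
      (sat M I e p \<longleftrightarrow> sat M J e p)"
      using Delta0_local[OF p b(1)] by blast
    define F where "F = {x \<in> I. x \<preceq> B}"
    have F: "finite F" "F \<subseteq> U" using fin[OF B(1)] \<open>I \<subseteq> U\<close> by (auto simp: F_def)
    have PF: "P x \<longleftrightarrow> sat M F (case_nat x s) p" if "x \<in> U" "x \<preceq> a" for x
      unfolding P_def
    proof (rule B(2))
      show "\<forall>i\<in>fv p. case_nat x s i \<preceq> b"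
      proof
        fix i assume i: "i \<in> fv p"
        show "case_nat x s i \<preceq> b"
        proof (cases i)
          case 0
          then show ?thesis using leq_trans[OF that(2) b(2)] that a b by simp
        next
          case (Suc j)
          then have "s j \<preceq> b'" using b'(2)[OF i] by simp
          then have "s j \<preceq> b" using b(3) by (rule leq_trans) (use s b b' in auto)
          then show ?thesis using Suc by simp
        qed
      qed
    qed (use that s in \<open>auto simp: agree_def F_def\<close>)
    have "trm U (case_nat (\<lambda>e. e 0) (\<lambda>i _. s i) i)" for i
      using s by (cases i) (simp_all add: trm_var trm_const)
    note d = dfn_subst[of U "case_nat (\<lambda>e. e 0) (\<lambda>i _. s i)", OF this dfn_sat_finite[OF F, of p]]
    have "(\<lambda>i. case_nat (\<lambda>e. e 0) (\<lambda>i _. s i) i e) = case_nat (e 0) s" for e :: "nat \<Rightarrow> 'a"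
      by (rule ext) (simp split: nat.splits)
    with d have d: "dfn U (\<lambda>e. sat M F (case_nat (e 0) s) p)" by simp
    \<comment> \<open>The induction is confined to \<open>x \<preceq> a\<close>, since
      \<open>F\<close> is known to give the right truth value only there.\<close>
    have "x \<in> U \<Longrightarrow> x \<preceq> a \<longrightarrow> sat M F (case_nat x s) p" for x
    proof (induction rule: dfn_induct)
      case dfn show ?case by (intro dfn_intros d a)
    next
      case zero show ?case using P0 PF[of \<zero>] by auto
    next
      case (suc x)
      show ?case
      proof
        assume Sx: "\<S> x \<preceq> a"
        then have "x \<preceq> a" using leq_trans[of x "\<S> x" a] less_self_S suc(1) a by simp
        then have "P x" using suc PF by blast
        then show "sat M F (case_nat (\<S> x) s) p" using PS[of x] PF[of "\<S> x"] Sx suc(1) by blast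
      qed
    qed
    then show ?thesis using PF a by blast
  qed
  then show ?thesis by (auto simp: induction_axiom_def sat_subst sub P_def)
qed

end

section \<open>Layers and indiscernibles\<close>

lemma arith_PA: "models_LA M PA \<Longrightarrow> arith M {} is_LA"
  unfolding models_def PA_def by unfold_locales (auto simp: is_LA_subst)

lemma arith_PAI: "models M X PAI \<Longrightarrow> arith M X (\<lambda>_. True)"
  unfolding models_def PAI_def by unfold_locales auto

lemma is_LA_basic: "p \<in> basic_axioms \<Longrightarrow> is_LA p"
  by (auto simp: basic_axioms_def)

lemma is_LA_induction: "is_LA p \<Longrightarrow> is_LA (induction_axiom p)"
  by (simp add: induction_axiom_def is_LA_subst)

context dtype
begin

section \<open>\<open>N\<close> as an elementary extension of \<open>M\<close>\<close>

lemma rp_N: "a \<in> universe N \<Longrightarrow> rp a \<in> D \<and> nf (rp a) = a"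
  using rp nf_eq unfolding N_universe by blast

lemma nf_in_N: "f \<in> D \<Longrightarrow> nf f \<in> universe N"
  by (simp add: N_universe)

lemma transfer:
  assumes "is_LA p" "\<And>e. env e \<Longrightarrow> sat M {} e p" "range s \<subseteq> universe N"
  shows "sat N {} s p"
proof -
  have s: "rp (s i) \<in> D" "nf (rp (s i)) = s i" for i using rp_N assms(3) by blast+
  have "ev (\<lambda>e. sat M {} (\<lambda>i. rp (s i) e) p)"
    by (rule ev_all, rule assms(2)) (simp add: env_def D_in s)
  then show ?thesis using Los[of "\<lambda>i. rp (s i)" p] s assms(1) by simp
qed

lemma wf_N: "wf_structure N"
proof -
  have "zeroS N \<in> universe N" unfolding N_universe by (simp add: N_def D_intros)
  then show ?thesis unfolding wf_structure_def by (auto simp: N_universe N_succ N_simps D_intros)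
qed

lemma arith_N: "arith N {} is_LA"
proof
  show "wf_structure N" by (rule wf_N)
next
  fix p :: fm and e :: "nat \<Rightarrow> 'a" assume "p \<in> basic_axioms" "range e \<subseteq> universe N"
  then show "sat N {} e p"
    by (intro transfer) (auto simp: is_LA_basic env_range intro: basic)
next
  fix p :: fm and e :: "nat \<Rightarrow> 'a" assume "is_LA p" "range e \<subseteq> universe N"
  then show "sat N {} e (induction_axiom p)"
    by (intro transfer) (auto simp: is_LA_induction env_range intro: induct)
qed (simp_all add: is_LA_subst)

lemma N_PA: "models_LA N PA"
  using arith.wf[OF arith_N] arith.basic[OF arith_N] arith.induct[OF arith_N]
  by (auto simp: models_def PA_def)

definition emb :: "'a \<Rightarrow> 'a" where "emb a = nf (\<lambda>_. a)"

lemma elementary_emb: "elementary_embedding emb M N"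
  unfolding elementary_embedding_def
proof (intro conjI allI impI)
  show "wf_structure M" "wf_structure N" by (rule wf, rule wf_N)
  show "emb ` universe M \<subseteq> universe N" by (auto simp: emb_def N_universe D_intros)
  fix p and e :: "nat \<Rightarrow> 'a" assume "is_LA p" "range e \<subseteq> universe M"
  moreover from this have "(\<lambda>_. e i) \<in> D" for i by (auto intro: D_intros)
  ultimately show "sat M {} e p \<longleftrightarrow> sat N {} (emb \<circ> e) p"
    using Los[of "\<lambda>i _. e i" p] by (simp add: emb_def comp_def)
qed

text \<open>\<open>Lay n\<close> is the universe of \<open>N\<^sub>n\<close>.\<close>

definition Lay :: "nat \<Rightarrow> 'a set" where "Lay n = nf ` {f \<in> D. supp n f}"

lemma LayI: "f \<in> D \<Longrightarrow> supp n f \<Longrightarrow> nf f \<in> Lay n"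
  by (simp add: Lay_def)

lemma Lay_N: "a \<in> Lay n \<Longrightarrow> a \<in> universe N"
  by (auto simp: Lay_def N_universe)

lemma Lay_mono: "a \<in> Lay n \<Longrightarrow> n \<le> m \<Longrightarrow> a \<in> Lay m"
  unfolding Lay_def using supp_mono by blast

lemma N_Lay: "a \<in> universe N \<Longrightarrow> \<exists>n. a \<in> Lay n"
  unfolding Lay_def N_universe using D_supp by blast

lemma Lay_0: "Lay 0 = emb ` U"
proof
  show "Lay 0 \<subseteq> emb ` U"
  proof
    fix a assume "a \<in> Lay 0"
    then obtain f where f: "f \<in> D" "supp 0 f" "a = nf f" by (auto simp: Lay_def)
    have "ev (\<lambda>e. f e = f (\<lambda>_. \<zero>))" by (intro ev_all suppD[OF f(2)]) auto
    moreover have "f (\<lambda>_. \<zero>) \<in> U" using D_in[OF f(1)] by simp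
    ultimately show "a \<in> emb ` U" using f nf_eq[of f "\<lambda>_. f (\<lambda>_. \<zero>)"] by (auto simp: emb_def D_intros)
  qed
  show "emb ` U \<subseteq> Lay 0" by (auto simp: emb_def Lay_def supp_def D_intros)
qed

lemma trm_upd:
  assumes "f \<in> D" "env e" shows "trm U (\<lambda>E. f (e(n := E 0)))"
proof -
  have "trm U (\<lambda>E. if i = n then E 0 else e i)" for i
    using assms(2) by (cases "i = n") (simp_all add: trm_var trm_const)
  from trm_subst[of U f "\<lambda>i E. if i = n then E 0 else e i", OF _ this] show ?thesis
    using assms(1) unfolding D_def fun_upd_def by simp
qed

lemma dfn_graph_upd:
  assumes "f \<in> D" shows "dfn U (\<lambda>e. e 0 = f ((\<lambda>i. e (Suc (Suc i)))(n := e 1)))"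
proof -
  have "dfn U (\<lambda>e. e 0 = f (\<lambda>i. e (Suc i)))" using assms by (simp add: D_def trm_def)
  from dfn_rename[OF this, of "case_nat 0 ((\<lambda>i. Suc (Suc i))(n := 1))"]
  show ?thesis by (rule back_subst[of "dfn U"]) (auto intro!: ext arg_cong[of _ _ f])
qed

lemma supp_upd: "supp (Suc n) f \<Longrightarrow> v \<in> U \<Longrightarrow> supp n (\<lambda>e. f (e(n := v)))"
  unfolding supp_def by (auto simp: less_Suc_eq)

lemma evn_Suc_ev: "supp (Suc n) P \<Longrightarrow> ev P \<longleftrightarrow> evn n (\<lambda>e. most (\<lambda>v. P (e(n := v)))) (\<lambda>_. \<zero>)"
  using ev_supp[of "Suc n" P] by simp

lemma supp_most:
  assumes "\<And>v. v \<in> U \<Longrightarrow> supp n (P v)" shows "supp n (\<lambda>e. most (\<lambda>v. P v e))"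
  unfolding supp_def
proof (intro allI impI)
  fix e e' assume e: "env e" "env e'" "\<forall>i<n. e i = e' i"
  show "most (\<lambda>v. P v e) = most (\<lambda>v. P v e')"
  proof (rule most_cong)
    fix v assume "v \<in> U"
    from suppD[OF assms[OF this] e(1,2)] e(3) show "P v e = P v e'" by blast
  qed
qed

lemma supp_2: "supp n f \<Longrightarrow> supp n g \<Longrightarrow> supp n (\<lambda>e. h (f e) (g e))"
  unfolding supp_def by metis

lemma dfn_value:
  assumes "f \<in> D" shows "dfn U (\<lambda>e. most (\<lambda>v. f ((\<lambda>i. e (Suc i))(n := v)) = e 0))"
proof -
  have "dfn U (\<lambda>e. e 1 = f ((\<lambda>i. e (Suc (Suc i)))(n := e 0)))"
    using dfn_rename[OF dfn_graph_upd[OF assms, of n], of "case_nat 1 (case_nat 0 (\<lambda>i. Suc (Suc i)))"]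
    by simp
  then have "dfn U (\<lambda>e. f ((\<lambda>i. e (Suc (Suc i)))(n := e 0)) = e 1)"
    by (rule dfn_cong) auto
  then show ?thesis by (intro dfn_most) simp
qed

text \<open>If \<open>f\<close> is constant on the type in entry \<open>m\<close>, then its constant
  value is a definable function of the earlier entries. That this function reads no entry from
  \<open>m\<close> on follows from the last property of \<open>trm_choice\<close>.\<close>

lemma supp_drop:
  assumes f: "f \<in> D" "supp (Suc m) f" and ev: "ev (\<lambda>e. \<exists>u\<in>U. most (\<lambda>v. f (e(m := v)) = u))"
  shows "\<exists>g\<in>D. supp m g \<and> ev (\<lambda>e. f e = g e)"
proof -
  obtain g where g: "trm U g" "\<And>e x. env e \<Longrightarrow> x \<in> U \<Longrightarrow> most (\<lambda>v. f (e(m := v)) = x) \<Longrightarrow>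
      most (\<lambda>v. f (e(m := v)) = g e)"
    "\<And>e e'. env e \<Longrightarrow> env e' \<Longrightarrow>
      (\<And>x. x \<in> U \<Longrightarrow> most (\<lambda>v. f (e(m := v)) = x) \<longleftrightarrow> most (\<lambda>v. f (e'(m := v)) = x)) \<Longrightarrow> g e = g e'"
    by (rule trm_choice[of U "\<lambda>x e. most (\<lambda>v. f (e(m := v)) = x)", OF dfn_value[OF f(1)]]) blast
  have sup: "supp m (\<lambda>e. most (\<lambda>v. f (e(m := v)) = x))" for x
    by (intro supp_most supp_comp[of m "\<lambda>e. f (e(m := _))" "\<lambda>y. y = x"] supp_upd f)
  have "supp m g" unfolding supp_def
  proof (intro allI impI)
    fix e e' assume e: "env e" "env e'" "\<forall>i<m. e i = e' i"
    then have "most (\<lambda>v. f (e(m := v)) = x) \<longleftrightarrow> most (\<lambda>v. f (e'(m := v)) = x)" for x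
      using suppD[OF sup e(1,2)] by blast
    with e show "g e = g e'" by (intro g(3))
  qed
  moreover have "ev (\<lambda>e. f e = g e)"
  proof -
    have "supp m (\<lambda>e. \<exists>u\<in>U. most (\<lambda>v. f (e(m := v)) = u))"
      unfolding supp_def
    proof (intro allI impI bex_cong refl)
      fix e e' u assume "env e" "env e'" "\<forall>i<m. e i = e' i"
      then show "most (\<lambda>v. f (e(m := v)) = u) = most (\<lambda>v. f (e'(m := v)) = u)"
        using suppD[OF sup] by blast
    qed
    then have "evn m (\<lambda>e. \<exists>u\<in>U. most (\<lambda>v. f (e(m := v)) = u)) (\<lambda>_. \<zero>)" using ev ev_supp by blast
    then have "evn m (\<lambda>e. most (\<lambda>v. f (e(m := v)) = g (e(m := v)))) (\<lambda>_. \<zero>)"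
    proof (rule evn_mono)
      fix e assume e: "env e" "\<exists>u\<in>U. most (\<lambda>v. f (e(m := v)) = u)"
      then have "most (\<lambda>v. f (e(m := v)) = g e)" using g(2) by blast
      moreover have "g (e(m := v)) = g e" if "v \<in> U" for v
        using \<open>supp m g\<close> by (rule suppD) (use e that in auto)
      ultimately show "most (\<lambda>v. f (e(m := v)) = g (e(m := v)))" by (elim most_mono) simp
    qed simp
    moreover have "supp (Suc m) (\<lambda>e. f e = g e)"
      using f(2) supp_mono[OF \<open>supp m g\<close>]
      by (intro supp_2[where f = f and g = g and h = "(=)"]) auto
    ultimately show ?thesis by (simp add: evn_Suc_ev)
  qed
  ultimately show ?thesis using g(1) by (auto simp: D_def)
qed

text \<open>Suppose \<open>f\<close> is below \<open>g\<close> and reads entry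
  \<open>k \<ge> n\<close>, which \<open>g\<close> does not read. Then \<open>f\<close> is bounded
  along that entry, hence constant there by \<open>most_bounded\<close>, and
  \<open>supp_drop\<close> removes the entry. Repeating this brings the support down to
  \<open>n\<close>.\<close>

lemma Lay_initial:
  assumes "a \<in> universe N" "b \<in> Lay n" "lessS N a b" shows "a \<in> Lay n"
proof -
  obtain g where g: "g \<in> D" "supp n g" "b = nf g" using assms(2) by (auto simp: Lay_def)
  have "f \<in> D \<Longrightarrow> supp k f \<Longrightarrow> ev (\<lambda>e. f e \<prec> g e) \<Longrightarrow> nf f \<in> Lay n" for k f
  proof (induction k arbitrary: f)
    case 0
    then show ?case using LayI Lay_mono by blast
  next
    case (Suc k)
    show ?case
    proof (cases "Suc k \<le> n")
      case True
      then show ?thesis using Suc.prems LayI Lay_mono by blast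
    next
      case False
      then have k: "n \<le> k" by simp
      then have "supp (Suc k) (\<lambda>e. f e \<prec> g e)"
        using Suc.prems(2) supp_mono[OF g(2), of "Suc k"]
        by (intro supp_2[where f = f and g = g and h = "lessS M"]) auto
      then have "evn k (\<lambda>e. most (\<lambda>v. f (e(k := v)) \<prec> g (e(k := v)))) (\<lambda>_. \<zero>)"
        using Suc.prems(3) by (simp add: evn_Suc_ev)
      then have "evn k (\<lambda>e. \<exists>u\<in>U. most (\<lambda>v. f (e(k := v)) = u)) (\<lambda>_. \<zero>)"
      proof (rule evn_mono)
        fix e assume e: "env e" "most (\<lambda>v. f (e(k := v)) \<prec> g (e(k := v)))"
        have "g (e(k := v)) = g e" if "v \<in> U" for v
          using g(2) by (rule suppD) (use e that k in auto)
        then have "most (\<lambda>v. f (e(k := v)) \<prec> g e)" using e(2) by (elim most_mono) simp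
        then show "\<exists>u\<in>U. most (\<lambda>v. f (e(k := v)) = u)"
          using most_bounded[where t = "\<lambda>v. f (e(k := v))", OF trm_upd[OF Suc.prems(1) e(1)]]
            D_in[OF g(1) e(1)] by blast
      qed simp
      moreover have "supp k (\<lambda>e. \<exists>u\<in>U. most (\<lambda>v. f (e(k := v)) = u))"
        unfolding supp_def
      proof (intro allI impI bex_cong refl most_cong)
        fix e e' u v assume "env e" "env e'" "\<forall>i<k. e i = e' i" "v \<in> U"
        then have "f (e(k := v)) = f (e'(k := v))"
          using suppD[OF supp_upd[OF Suc.prems(2)]] by blast
        then show "(f (e(k := v)) = u) = (f (e'(k := v)) = u)" by simp
      qed
      ultimately have "ev (\<lambda>e. \<exists>u\<in>U. most (\<lambda>v. f (e(k := v)) = u))" by (simp add: ev_supp)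
      then obtain f' where f': "f' \<in> D" "supp k f'" "ev (\<lambda>e. f e = f' e)"
        using supp_drop Suc.prems by blast
      have "ev (\<lambda>e. f' e \<prec> g e)" by (rule ev_mono[OF ev_conj[OF f'(3) Suc.prems(3)]]) auto
      then have "nf f' \<in> Lay n" using Suc.IH f' by blast
      then show ?thesis using nf_eq[OF Suc.prems(1) f'(1)] f'(3) by simp
    qed
  qed
  moreover obtain f where "f \<in> D" "a = nf f" using assms(1) by (auto simp: N_universe)
  moreover from this obtain k where "supp k f" using D_supp by blast
  ultimately show ?thesis using assms(3) g by (simp add: N_simps)
qed

lemma end_extension: "elementary_end_extension emb M N"
  unfolding elementary_end_extension_def
proof (intro conjI ballI)
  show "elementary_embedding emb M N" by (rule elementary_emb)
  fix a b assume a: "a \<in> U" and b: "b \<in> universe N - emb ` U"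
  have "emb a \<in> Lay 0" "emb a \<in> universe N" using a Lay_0 Lay_N by blast+
  then show "lessS N (emb a) b"
    using arith.linear[OF arith_N, of "emb a" b] b Lay_initial[of b "emb a" 0] Lay_0 a by blast
qed

section \<open>The generators: cofinality and indiscernibility\<close>

definition c :: "nat \<Rightarrow> 'a" where "c n = nf (\<lambda>e. e n)"

lemma c_N: "c n \<in> universe N"
  by (simp add: c_def nf_in_N D_intros)

lemma c_Lay: "c n \<in> Lay (Suc n)"
  unfolding c_def by (intro LayI D_intros) (auto simp: supp_def)

lemma Lay_less_c:
  assumes "a \<in> Lay n" shows "lessS N a (c n)"
proof -
  obtain f where f: "f \<in> D" "supp n f" "a = nf f" using assms by (auto simp: Lay_def)
  have "supp (Suc n) (\<lambda>e. e n)" by (simp add: supp_def)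
  then have "supp (Suc n) (\<lambda>e. f e \<prec> e n)"
    using supp_mono[OF f(2), of "Suc n"] by (intro supp_2[where f = f and h = "lessS M"]) auto
  moreover have "evn n (\<lambda>e. most (\<lambda>v. f (e(n := v)) \<prec> (e(n := v)) n)) (\<lambda>_. \<zero>)"
  proof (rule evn_mono)
    show "evn n (\<lambda>_. True) (\<lambda>_. \<zero>)" using evn_supp[of 0 "\<lambda>_. True" n "\<lambda>_. \<zero>"] by (simp add: supp_def)
    fix e assume e: "env e"
    then have "f (e(n := v)) = f e" if "v \<in> U" for v
      using that by (intro suppD[OF f(2)]) auto
    then show "most (\<lambda>v. f (e(n := v)) \<prec> (e(n := v)) n)"
      using most_above[OF D_in[OF f(1) e]] by (auto elim!: most_mono)
  qed simp
  ultimately have "ev (\<lambda>e. f e \<prec> e n)" by (simp add: evn_Suc_ev)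
  then show ?thesis using f by (simp add: c_def N_simps D_intros)
qed

lemma c_less: "lessS N (c m) (c n) \<longleftrightarrow> m < n"
proof -
  have *: "lessS N (c m) (c n)" if "m < n" for m n
    using Lay_less_c Lay_mono[OF c_Lay] that by simp
  then show ?thesis
    using arith.less_irrefl[OF arith_N c_N[of m]] arith.less_asym[OF arith_N _ _ c_N c_N, of m n]
    by (cases m n rule: linorder_cases) auto
qed

lemma c_notin_Lay: "c n \<notin> Lay n"
  using Lay_less_c c_less by blast

text \<open>The same quantifier \<open>most\<close> is used at every place, and an increasing
  \<open>\<kappa>\<close> preserves the nesting order. Places outside the range of
  \<open>\<kappa>\<close> carry dummy quantifiers, which vanish.\<close>

lemma evn_indiscernible:
  assumes "supp n P" "\<And>i j. i < j \<Longrightarrow> j < n \<Longrightarrow> \<kappa> i < \<kappa> j" "\<And>i. i < n \<Longrightarrow> \<kappa> i < m" "env e"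
  shows "evn m (\<lambda>e. P (\<lambda>i. e (\<kappa> i))) e \<longleftrightarrow> evn n P e"
  using assms(1-3)
proof (induction n arbitrary: m P)
  case 0
  have "supp 0 (\<lambda>e. P (\<lambda>i. e (\<kappa> i)))" unfolding supp_def
  proof (intro allI impI)
    fix e e' :: "nat \<Rightarrow> 'a" assume "env e" "env e'"
    then show "P (\<lambda>i. e (\<kappa> i)) = P (\<lambda>i. e' (\<kappa> i))" by (rule suppD[OF 0(1) env_comp env_comp]) simp
  qed
  then have "evn m (\<lambda>e. P (\<lambda>i. e (\<kappa> i))) e \<longleftrightarrow> P (\<lambda>i. e (\<kappa> i))"
    using evn_supp[of 0 _ m e] assms(4) by simp
  also have "\<dots> \<longleftrightarrow> P e" using assms(4) by (intro suppD[OF 0(1)]) auto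
  finally show ?case by simp
next
  case (Suc n)
  let ?k = "\<kappa> n" and ?P = "\<lambda>e. P (\<lambda>i. e (\<kappa> i))"
  let ?Q = "\<lambda>e. most (\<lambda>v. P (e(n := v)))"
  have less: "\<kappa> i < ?k" if "i < n" for i using Suc.prems(2) that by simp
  have "supp (Suc ?k) ?P" unfolding supp_def
  proof (intro allI impI)
    fix e e' assume e: "env e" "env e'" "\<forall>i<Suc ?k. e i = e' i"
    then show "?P e = ?P e'"
      using less by (intro suppD[OF Suc.prems(1)]) (auto simp: less_Suc_eq)
  qed
  \<comment> \<open>Nothing beyond \<open>\<kappa> n\<close> is read, so the quantifier for
    \<open>\<kappa> n\<close> may be taken as the innermost one.\<close>
  then have "evn m ?P e \<longleftrightarrow> evn (Suc ?k) ?P e"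
    using evn_supp Suc.prems(3)[of n] assms(4) by simp
  also have "\<dots> \<longleftrightarrow> evn ?k (\<lambda>e. ?Q (\<lambda>i. e (\<kappa> i))) e"
    unfolding evn.simps
  proof (intro evn_cong assms(4) most_cong)
    fix e v assume e: "env e" "v \<in> U"
    show "P (\<lambda>i. (e(?k := v)) (\<kappa> i)) = P ((\<lambda>i. e (\<kappa> i))(n := v))"
    proof (rule suppD[OF Suc.prems(1) env_comp[OF env_upd[OF e(2,1)]] env_upd[OF e(2) env_comp[OF e(1)]]])
      fix i assume "i < Suc n"
      then show "(e(?k := v)) (\<kappa> i) = ((\<lambda>i. e (\<kappa> i))(n := v)) i"
        using less[of i] by (cases "i = n") auto
    qed
  qed
  also have "\<dots> \<longleftrightarrow> evn n ?Q e"
    using Suc.prems less by (intro Suc.IH supp_most supp_upd) auto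
  finally show ?case by simp
qed

text \<open>Indiscernibility lies in the fact that the right-hand side does not mention
  \<open>\<kappa>\<close>.\<close>

lemma c_indiscernible:
  assumes p: "is_LA p" "fv p \<subseteq> {..<n}"
    and x: "\<And>i. i < n \<Longrightarrow> x i = c (\<kappa> i)" "\<And>i j. i < j \<Longrightarrow> j < n \<Longrightarrow> \<kappa> i < \<kappa> j"
  shows "sat N I x p \<longleftrightarrow> evn n (\<lambda>e. sat M {} e p) (\<lambda>_. \<zero>)"
proof -
  obtain m where m: "\<And>i. i < n \<Longrightarrow> \<kappa> i < m"
    using finite_nat_set_iff_bounded[of "\<kappa> ` {..<n}"] by auto
  have sp: "supp n (\<lambda>e. sat M {} e p)"
    unfolding supp_def by (intro allI impI sat_cong_fv) (use p(2) in auto)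
  have sp': "supp m (\<lambda>e. sat M {} (\<lambda>i. e (\<kappa> i)) p)" unfolding supp_def
    by (intro allI impI sat_cong_fv) (use p(2) m in auto)
  have "sat N I x p \<longleftrightarrow> sat N {} x p" by (rule sat_LA_cong[OF p(1)])
  also have "\<dots> \<longleftrightarrow> sat N {} (\<lambda>i. nf (\<lambda>e. e (\<kappa> i))) p"
    using p(2) x(1) by (intro sat_cong_fv) (auto simp: c_def)
  also have "\<dots> \<longleftrightarrow> ev (\<lambda>e. sat M {} (\<lambda>i. e (\<kappa> i)) p)"
    using Los[of "\<lambda>i e. e (\<kappa> i)" p] p(1) D_intros(5) by simp
  also have "\<dots> \<longleftrightarrow> evn m (\<lambda>e. sat M {} (\<lambda>i. e (\<kappa> i)) p) (\<lambda>_. \<zero>)" by (rule ev_supp[OF sp'])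
  also have "\<dots> \<longleftrightarrow> evn n (\<lambda>e. sat M {} e p) (\<lambda>_. \<zero>)"
    using evn_indiscernible[OF sp x(2) m] by simp
  finally show ?thesis .
qed

lemma range_c_sorted:
  assumes "\<And>i. i < n \<Longrightarrow> x i \<in> range c" "\<And>i. i < n - 1 \<Longrightarrow> lessS N (x i) (x (Suc i))"
  obtains \<kappa> where "\<And>i. i < n \<Longrightarrow> x i = c (\<kappa> i)" "\<And>i j. i < j \<Longrightarrow> j < n \<Longrightarrow> \<kappa> i < \<kappa> j"
proof -
  have "\<exists>k. x i = c k" if "i < n" for i using assms(1)[OF that] by blast
  then obtain \<kappa> where k: "\<And>i. i < n \<Longrightarrow> x i = c (\<kappa> i)" by metis
  have "\<kappa> i < \<kappa> (Suc i)" if "Suc i < n" for i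
  proof -
    have "lessS N (c (\<kappa> i)) (c (\<kappa> (Suc i)))" using assms(2)[of i] k[of i] k[of "Suc i"] that by simp
    then show ?thesis by (simp add: c_less)
  qed
  then have "\<kappa> i < \<kappa> j" if "i < j" "j < n" for i j
    using that(1,2)
  proof (induction j)
    case (Suc j)
    then show ?case by (cases "i = j") (auto intro: order.strict_trans[of _ "\<kappa> j"])
  qed simp
  with k show ?thesis by (rule that)
qed

lemma PAI0_N: "models N (range c) PAI0"
proof -
  have I: "range c \<subseteq> universe N" using c_N by blast
  have 1: "sat N (range c) e p" if "p \<in> PA" "range e \<subseteq> universe N" for p e
  proof -
    have "is_LA p" using that(1) by (auto simp: PA_def is_LA_basic is_LA_induction)
    then show ?thesis using N_PA that sat_LA_cong unfolding models_def by blast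
  qed
  have 2: "sat N (range c) e (induction_axiom p)" if "Delta0 p" "range e \<subseteq> universe N" for p e
  proof (rule arith.Delta0_induction[OF arith_N _ I that(1)])
    show "arith.env N e" using that(2) arith.env_range[OF arith_N] by blast
    fix B assume "B \<in> universe N"
    then obtain n where "B \<in> Lay n" using N_Lay by blast
    then have B: "lessS N B (c n)" by (rule Lay_less_c)
    have "k < n" if "lessS N (c k) B \<or> c k = B" for k
      using that B arith.less_trans[OF arith_N, of "c k" B "c n"] c_N \<open>B \<in> universe N\<close> c_less by blast
    then have "{x \<in> range c. lessS N x B \<or> x = B} \<subseteq> c ` {..<n}" by auto
    then show "finite {x \<in> range c. lessS N x B \<or> x = B}" by (rule finite_subset) simp
  qed
  have "\<exists>y\<in>universe N. y \<in> range c \<and> lessS N a y" if a: "a \<in> universe N" for a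
    using N_Lay[OF a] Lay_less_c c_N by blast
  then have 3: "sat N (range c) e unbounded_axiom" for e by (simp add: unbounded_axiom_def)
  have 4: "sat N (range c) e (indiscernibility_axiom n p)" if p: "is_LA p" "fv p \<subseteq> {..<n}" for e n p
    unfolding indiscernibility_axiom_def sat_foldr_Imp
  proof
    assume "\<forall>q\<in>set (map (\<lambda>i. Ind (Var i)) [0..<2 * n] @ map (\<lambda>i. Lt (Var i) (Var (Suc i))) [0..<n - 1] @
         map (\<lambda>i. Lt (Var (n + i)) (Var (n + Suc i))) [0..<n - 1]). sat N (range c) e q"
    then have I: "\<And>i. i < 2 * n \<Longrightarrow> e i \<in> range c" and x: "\<And>i. i < n - 1 \<Longrightarrow> lessS N (e i) (e (Suc i))"
      and y: "\<And>i. i < n - 1 \<Longrightarrow> lessS N (e (n + i)) (e (n + Suc i))"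
      by (auto simp: ball_Un)
    obtain \<kappa> where k: "\<And>i. i < n \<Longrightarrow> e i = c (\<kappa> i)" "\<And>i j. i < j \<Longrightarrow> j < n \<Longrightarrow> \<kappa> i < \<kappa> j"
      by (rule range_c_sorted[of n e, OF I x]) auto
    obtain \<kappa>' where k': "\<And>i. i < n \<Longrightarrow> e (n + i) = c (\<kappa>' i)" "\<And>i j. i < j \<Longrightarrow> j < n \<Longrightarrow> \<kappa>' i < \<kappa>' j"
      by (rule range_c_sorted[of n "\<lambda>i. e (n + i)", OF I y]) auto
    have "sat N (range c) e p \<longleftrightarrow> sat N (range c) (\<lambda>i. e (n + i)) p"
      using c_indiscernible[OF p k] c_indiscernible[OF p, of "\<lambda>i. e (n + i)" \<kappa>', OF k'] by simp
    then show "sat N (range c) e (Iff p (subst (\<lambda>i. Var (n + i)) p))" by (simp add: sat_subst)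
  qed
  show ?thesis unfolding models_def
  proof (intro conjI ballI allI impI)
    fix p and e :: "nat \<Rightarrow> 'a" assume "p \<in> PAI0" "range e \<subseteq> universe N"
    moreover from this have "p \<in> PA \<or> (\<exists>q. p = induction_axiom q \<and> Delta0 q) \<or> p = unbounded_axiom \<or>
        (\<exists>n q. p = indiscernibility_axiom n q \<and> is_LA q \<and> fv q \<subseteq> {..<n})"
      by (auto simp: PAI0_def indiscernibility_axioms_def)
    ultimately show "sat N (range c) e p" using 1 2 3 4 by metis
  qed (rule wf_N, rule I)
qed

text \<open>As a function of entry \<open>n\<close> alone, \<open>f\<close> is given by a
  parameter-free relation \<open>R\<close> and one parameter \<open>w\<close>, which absorbs the
  other entries of \<open>e\<close> and the parameters of \<open>f\<close>. So parameters can be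
  quantified over.\<close>

lemma graph_parameter:
  assumes "f \<in> D"
  obtains R where "dfn {} (\<lambda>e. R (e 0) (e 1) (e 2))"
    "\<And>e. env e \<Longrightarrow> \<exists>w\<in>U. \<forall>x\<in>U. \<forall>v\<in>U. x = f (e(n := v)) \<longleftrightarrow> R x v w"
proof -
  obtain Q where Q: "dfn {} Q" "\<And>r. env r \<Longrightarrow> \<exists>w\<in>U. \<forall>e. env e \<longrightarrow>
      (mrg 2 e r 0 = f ((\<lambda>i. mrg 2 e r (Suc (Suc i)))(n := mrg 2 e r 1)) \<longleftrightarrow> Q (mrg 2 e (\<lambda>_. w)))"
    using merge[OF dfn_graph_upd[OF assms, of n], of 2] by blast
  define R where "R x v w = Q (mrg 2 (case_nat x (\<lambda>_. v)) (\<lambda>_. w))" for x v w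
  have "(\<lambda>i. e (if i = 0 then 0 else if i = 1 then 1 else 2)) = mrg 2 (case_nat (e 0) (\<lambda>_. e 1)) (\<lambda>_. e 2)"
    for e :: "nat \<Rightarrow> 'a" by (rule ext) (auto simp: mrg_def split: nat.splits)
  then have "dfn {} (\<lambda>e. R (e 0) (e 1) (e 2))"
    using dfn_rename[OF Q(1), of "\<lambda>i. if i = 0 then 0 else if i = 1 then 1 else 2"]
    unfolding R_def by simp
  moreover have "\<exists>w\<in>U. \<forall>x\<in>U. \<forall>v\<in>U. x = f (e(n := v)) \<longleftrightarrow> R x v w" if "env e" for e
  proof -
    let ?r = "case_nat \<zero> (case_nat \<zero> e)"
    have "env ?r" using that by simp
    then obtain w where w: "w \<in> U" "\<And>e'. env e' \<Longrightarrow> mrg 2 e' ?r 0 =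
        f ((\<lambda>i. mrg 2 e' ?r (Suc (Suc i)))(n := mrg 2 e' ?r 1)) \<longleftrightarrow> Q (mrg 2 e' (\<lambda>_. w))"
      using Q(2) by blast
    have "x = f (e(n := v)) \<longleftrightarrow> R x v w" if "x \<in> U" "v \<in> U" for x v
      using w(2)[of "case_nat x (\<lambda>_. v)"] that unfolding R_def by (simp add: mrg_def)
    with w(1) show ?thesis by blast
  qed
  ultimately show ?thesis by (rule that)
qed

text \<open>If \<open>f\<close> is not constant on the type then it tends to infinity there, so that the parameter
  \<open>w\<close> of \<open>f\<close> and \<open>g\<close> is smaller than the value of \<open>f\<close>. Quantifying over the smaller parameters
  bounds the value of \<open>g\<close> by a parameter-free function of the value of \<open>f\<close>.\<close>

lemma same_layer_M:
  assumes f: "f \<in> D" and g: "g \<in> D"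
  obtains H where "dfn {} (\<lambda>e. H (e 0) (e 1))"
    "\<And>x. x \<in> U \<Longrightarrow> \<exists>z\<in>U. \<forall>y\<in>U. H x y \<longrightarrow> y \<prec> z"
    "\<And>e. env e \<Longrightarrow> \<not> (\<exists>u\<in>U. most (\<lambda>v. f (e(n := v)) = u)) \<Longrightarrow> most (\<lambda>v. H (f (e(n := v))) (g (e(n := v))))"
proof -
  obtain Rf where Rf: "dfn {} (\<lambda>e. Rf (e 0) (e 1) (e 2))"
    "\<And>e. env e \<Longrightarrow> \<exists>w\<in>U. \<forall>x\<in>U. \<forall>v\<in>U. x = f (e(n := v)) \<longleftrightarrow> Rf x v w"
    using graph_parameter[OF f] by blast
  obtain Rg where Rg: "dfn {} (\<lambda>e. Rg (e 0) (e 1) (e 2))"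
    "\<And>e. env e \<Longrightarrow> \<exists>w\<in>U. \<forall>x\<in>U. \<forall>v\<in>U. x = g (e(n := v)) \<longleftrightarrow> Rg x v w"
    using graph_parameter[OF g] by blast
  note Rf' = dfn_app3[OF dfn_mono[OF Rf(1) empty_subsetI]]
    and Rg' = dfn_app3[OF dfn_mono[OF Rg(1) empty_subsetI]]
  \<comment> \<open>Entry 0 is a bound and entry 1 a parameter. The stage \<open>k\<close> that
    decides \<open>L\<close> works for all bounds and parameters, so that \<open>Inf\<close> can
    refer to this one stage and is first-order.\<close>
  define L where "L v e \<longleftrightarrow> (\<exists>x\<in>U. (x \<prec> e 0 \<or> x = e 0) \<and> Rf x v (e 1))" for v and e :: "nat \<Rightarrow> 'a"
  have "dfn U (\<lambda>e. L (e 0) (\<lambda>i. e (Suc i)))" unfolding L_def by (intro dfn_intros Rf')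
  then obtain k where k: "\<And>e. env e \<Longrightarrow> \<exists>b\<in>U. (\<forall>v\<in>U. b \<prec> v \<longrightarrow> Y k v \<longrightarrow> L v e) \<or>
      (\<forall>v\<in>U. b \<prec> v \<longrightarrow> Y k v \<longrightarrow> \<not> L v e)" by (rule decide) blast
  define Inf where "Inf w \<longleftrightarrow> (\<forall>z\<in>U. \<exists>b\<in>U. \<forall>v\<in>U. b \<prec> v \<longrightarrow> Y k v \<longrightarrow> (\<forall>x\<in>U. Rf x v w \<longrightarrow> z \<prec> x))" for w
  \<comment> \<open>For an arbitrary parameter, \<open>Rg\<close> need not be the graph of a
    function. \<open>Fun\<close> demands that the related values are at least bounded, so that
    collection applies to all parameters below \<open>x\<close>.\<close>
  define Fun where "Fun w v \<longleftrightarrow> (\<exists>z\<in>U. \<forall>y\<in>U. Rg y v w \<longrightarrow> y \<prec> z)" for w v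
  define H where "H x y \<longleftrightarrow> (\<exists>w\<in>U. \<exists>w'\<in>U. \<exists>v\<in>U. w \<prec> x \<and> w' \<prec> x \<and> Y k v \<and> Rf x v w \<and> Inf w \<and>
      Rg y v w' \<and> Fun w' v)" for x y
  have Inf: "dfn A (\<lambda>e. Inf (s e))" if "trm A s" for A s
    by (rule dfn_app1[OF _ that], unfold Inf_def, intro dfn_intros Rf' dfn_Y)
  have Fun: "dfn A (\<lambda>e. Fun (s e) (t e))" if "trm A s" "trm A t" for A s t
    by (rule dfn_app2[OF _ that], unfold Fun_def, intro dfn_intros Rg')
  have H: "dfn {} (\<lambda>e. H (e 0) (e 1))"
    unfolding H_def by (intro dfn_intros Rf' Rg' dfn_Y Inf Fun)
  have bound: "\<exists>z\<in>U. \<forall>y\<in>U. H x y \<longrightarrow> y \<prec> z" if x: "x \<in> U" for x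
  proof -
    \<comment> \<open>If \<open>Inf w\<close> holds, the elements of \<open>Y k\<close> at which the
      value \<open>x\<close> occurs are bounded. Collection is used three times: for these elements
      over \<open>w\<close>, then for \<open>y\<close> over the parameter of \<open>g\<close>, then
      for \<open>y\<close> over \<open>v\<close>.\<close>
    have "\<exists>B\<in>U. \<forall>w\<in>U. w \<prec> x \<longrightarrow> (\<forall>v\<in>U. Y k v \<longrightarrow> Rf x v w \<longrightarrow> Inf w \<longrightarrow> v \<prec> B)"
    proof (rule collection)
      show "dfn U (\<lambda>e. \<forall>v\<in>U. Y k v \<longrightarrow> Rf x v (e 0) \<longrightarrow> Inf (e 0) \<longrightarrow> v \<prec> e 1)"
        by (intro dfn_intros Rf' dfn_Y Inf x)
      fix w assume w: "w \<in> U"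
      show "\<exists>b\<in>U. \<forall>v\<in>U. Y k v \<longrightarrow> Rf x v w \<longrightarrow> Inf w \<longrightarrow> v \<prec> b"
      proof (cases "Inf w")
        case True
        then obtain b where b: "b \<in> U" "\<And>v. v \<in> U \<Longrightarrow> b \<prec> v \<Longrightarrow> Y k v \<Longrightarrow> \<forall>x'\<in>U. Rf x' v w \<longrightarrow> x \<prec> x'"
          using True[unfolded Inf_def, rule_format, OF x] by blast
        have "v \<prec> \<S> b" if "v \<in> U" "Y k v" "Rf x v w" for v
        proof -
          have "\<not> b \<prec> v" using b(2)[of v] that x less_irrefl by blast
          then show ?thesis using not_less[of b v] b(1) that(1) less_S by blast
        qed
        then show ?thesis using b(1) by (intro bexI[of _ "\<S> b"]) auto
      qed (auto intro: bexI[of _ \<zero>])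
    next
      fix w b b' assume "w \<in> U" "b \<in> U" "b' \<in> U" "b \<prec> b'"
        "\<forall>v\<in>U. Y k v \<longrightarrow> Rf x v w \<longrightarrow> Inf w \<longrightarrow> v \<prec> b"
      then show "\<forall>v\<in>U. Y k v \<longrightarrow> Rf x v w \<longrightarrow> Inf w \<longrightarrow> v \<prec> b'" using less_trans[of _ b b'] by blast
    qed (rule x)
    then obtain B where B: "B \<in> U" "\<And>w v. w \<in> U \<Longrightarrow> w \<prec> x \<Longrightarrow> v \<in> U \<Longrightarrow> Y k v \<Longrightarrow> Rf x v w \<Longrightarrow> Inf w \<Longrightarrow> v \<prec> B"
      by blast
    have inner: "\<exists>z\<in>U. \<forall>w\<in>U. w \<prec> x \<longrightarrow> (\<forall>y\<in>U. Rg y v w \<longrightarrow> Fun w v \<longrightarrow> y \<prec> z)" if v: "v \<in> U" for v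
    proof (rule collection)
      show "dfn U (\<lambda>e. \<forall>y\<in>U. Rg y v (e 0) \<longrightarrow> Fun (e 0) v \<longrightarrow> y \<prec> e 1)"
        by (intro dfn_intros Rg' Fun v)
      fix w assume "w \<in> U"
      show "\<exists>z\<in>U. \<forall>y\<in>U. Rg y v w \<longrightarrow> Fun w v \<longrightarrow> y \<prec> z"
      proof (cases "Fun w v")
        case True
        then show ?thesis unfolding Fun_def by blast
      next
        case False
        then show ?thesis using closed(1) by blast
      qed
    next
      fix w b b' assume "w \<in> U" "b \<in> U" "b' \<in> U" "b \<prec> b'" "\<forall>y\<in>U. Rg y v w \<longrightarrow> Fun w v \<longrightarrow> y \<prec> b"
      then show "\<forall>y\<in>U. Rg y v w \<longrightarrow> Fun w v \<longrightarrow> y \<prec> b'" using less_trans[of _ b b'] by blast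
    qed (rule x)
    have "\<exists>z\<in>U. \<forall>v\<in>U. v \<prec> B \<longrightarrow> (\<forall>w\<in>U. w \<prec> x \<longrightarrow> (\<forall>y\<in>U. Rg y v w \<longrightarrow> Fun w v \<longrightarrow> y \<prec> z))"
    proof (rule collection)
      show "dfn U (\<lambda>e. \<forall>w\<in>U. w \<prec> x \<longrightarrow> (\<forall>y\<in>U. Rg y (e 0) w \<longrightarrow> Fun w (e 0) \<longrightarrow> y \<prec> e 1))"
        by (intro dfn_intros Rg' Fun x)
      fix v b b' assume "v \<in> U" "b \<in> U" "b' \<in> U" "b \<prec> b'"
        "\<forall>w\<in>U. w \<prec> x \<longrightarrow> (\<forall>y\<in>U. Rg y v w \<longrightarrow> Fun w v \<longrightarrow> y \<prec> b)"
      then show "\<forall>w\<in>U. w \<prec> x \<longrightarrow> (\<forall>y\<in>U. Rg y v w \<longrightarrow> Fun w v \<longrightarrow> y \<prec> b')"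
        using less_trans[of _ b b'] by blast
    qed (use inner B in auto)
    then obtain z where z: "z \<in> U" "\<And>v w y. v \<in> U \<Longrightarrow> v \<prec> B \<Longrightarrow> w \<in> U \<Longrightarrow> w \<prec> x \<Longrightarrow> y \<in> U \<Longrightarrow>
        Rg y v w \<Longrightarrow> Fun w v \<Longrightarrow> y \<prec> z" by blast
    have "y \<prec> z" if y: "y \<in> U" "H x y" for y
    proof -
      obtain w w' v where "w \<in> U" "w' \<in> U" "v \<in> U" "w \<prec> x" "w' \<prec> x" "Y k v" "Rf x v w" "Inf w"
        "Rg y v w'" "Fun w' v" using y(2) unfolding H_def by blast
      then show ?thesis using z(2)[of v w' y] B(2)[of w v] y(1) by blast
    qed
    with z(1) show ?thesis by blast
  qed
  have "most (\<lambda>v. H (f (e(n := v))) (g (e(n := v))))"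
    if e: "env e" and nc: "\<not> (\<exists>u\<in>U. most (\<lambda>v. f (e(n := v)) = u))" for e
  proof -
    define t where "t v = f (e(n := v))" for v
    define s where "s v = g (e(n := v))" for v
    have t: "trm U (\<lambda>E. t (E 0))" unfolding t_def by (rule trm_upd[OF f e])
    have tU: "t v \<in> U" "s v \<in> U" if "v \<in> U" for v using that e D_in f g by (auto simp: t_def s_def)
    obtain w where w: "w \<in> U" "\<And>x v. x \<in> U \<Longrightarrow> v \<in> U \<Longrightarrow> x = t v \<longleftrightarrow> Rf x v w"
      using Rf(2)[OF e] unfolding t_def by blast
    obtain w' where w': "w' \<in> U" "\<And>x v. x \<in> U \<Longrightarrow> v \<in> U \<Longrightarrow> x = s v \<longleftrightarrow> Rg x v w'"
      using Rg(2)[OF e] unfolding s_def by blast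
    have not_bdd: "\<not> most (\<lambda>v. t v \<prec> z)" if "z \<in> U" for z
      using most_bounded[OF t subset_refl that] nc unfolding t_def by blast
    have large: "most (\<lambda>v. z \<prec> t v)" if z: "z \<in> U" for z
    proof -
      have "dfn U (\<lambda>e. t (e 0) \<prec> \<S> z)" by (intro dfn_intros t z)
      from most_not[of U "\<lambda>v _. t v \<prec> \<S> z", OF this e]
      have "most (\<lambda>v. \<not> t v \<prec> \<S> z)" using not_bdd z by simp
      then show ?thesis
      proof (rule most_mono)
        fix v assume "v \<in> U" "\<not> t v \<prec> \<S> z"
        then show "z \<prec> t v" using tU(1)[of v] z not_less[of "t v" "\<S> z"] S_leq_iff[of z "t v"] by auto
      qed
    qed
    \<comment> \<open>Stage \<open>k\<close> decides whether \<open>t\<close> stays at or below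
      \<open>z\<close>; since \<open>t\<close> is unbounded on the type, the decision is
      negative.\<close>
    have "Inf w" unfolding Inf_def
    proof
      fix z assume z: "z \<in> U"
      have L: "L v (case_nat z (\<lambda>_. w)) \<longleftrightarrow> t v \<prec> \<S> z" if "v \<in> U" for v
        unfolding L_def using w(2)[of _ v] tU(1)[OF that] that z by (auto simp: less_S)
      obtain b where b: "b \<in> U" "(\<forall>v\<in>U. b \<prec> v \<longrightarrow> Y k v \<longrightarrow> t v \<prec> \<S> z) \<or>
          (\<forall>v\<in>U. b \<prec> v \<longrightarrow> Y k v \<longrightarrow> \<not> t v \<prec> \<S> z)"
        using k[of "case_nat z (\<lambda>_. w)"] z w(1) L by auto
      moreover have "\<not> (\<forall>v\<in>U. b \<prec> v \<longrightarrow> Y k v \<longrightarrow> t v \<prec> \<S> z)"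
        using not_bdd[of "\<S> z"] z b(1) unfolding most_def by blast
      ultimately have nb: "\<And>v. v \<in> U \<Longrightarrow> b \<prec> v \<Longrightarrow> Y k v \<Longrightarrow> \<not> t v \<prec> \<S> z" by blast
      have "z \<prec> x" if "v \<in> U" "b \<prec> v" "Y k v" "x \<in> U" "Rf x v w" for v x
        using nb[OF that(1-3)] w(2)[of x v] that z linear[of x z] less_S by blast
      then show "\<exists>b\<in>U. \<forall>v\<in>U. b \<prec> v \<longrightarrow> Y k v \<longrightarrow> (\<forall>x\<in>U. Rf x v w \<longrightarrow> z \<prec> x)" using b(1) by blast
    qed
    have "Fun w' v" if "v \<in> U" for v
      unfolding Fun_def
    proof (rule bexI[of _ "\<S> (s v)"])
      have "y \<prec> \<S> (s v)" if y: "y \<in> U" "Rg y v w'" for y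
        using w'(2)[OF y(1) \<open>v \<in> U\<close>] y(2) tU(2)[OF \<open>v \<in> U\<close>] by simp
      then show "\<forall>y\<in>U. Rg y v w' \<longrightarrow> y \<prec> \<S> (s v)" by blast
    qed (use tU(2)[OF that] in simp)
    then have H: "H (t v) (s v)" if v: "v \<in> U" "Y k v" "w \<prec> t v" "w' \<prec> t v" for v
    proof -
      have "Rf (t v) v w" "Rg (s v) v w'"
        using w(2)[OF tU(1)[OF v(1)] v(1)] w'(2)[OF tU(2)[OF v(1)] v(1)] by simp_all
      then show ?thesis
        unfolding H_def using v w(1) w'(1) \<open>Inf w\<close> \<open>\<And>v. v \<in> U \<Longrightarrow> Fun w' v\<close> by blast
    qed
    have "most (\<lambda>v. Y k v)" unfolding most_def by blast
    from most_conj[OF this most_conj[OF large[OF w(1)] large[OF w'(1)]]]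
    have "most (\<lambda>v. H (t v) (s v))" by (rule most_mono) (use H in blast)
    then show ?thesis unfolding t_def s_def .
  qed
  with H bound show ?thesis by (rule that)
qed

text \<open>A representative of \<open>a\<close> is not constant in entry \<open>n\<close> on the
  type, as \<open>supp_drop\<close> would otherwise put \<open>a\<close> into \<open>Lay n\<close>;
  so \<open>same_layer_M\<close> applies. That \<open>p\<close> bounds \<open>y\<close> in terms of
  \<open>x\<close> is a first-order sentence and transfers from \<open>M\<close> to
  \<open>N\<close>.\<close>

lemma same_layer:
  assumes a: "a \<in> Lay (Suc n)" "a \<notin> Lay n" and b: "b \<in> Lay (Suc n)"
  obtains p where "is_LA p" "fv p \<subseteq> {..<2}" "sat N {} (case_nat a (\<lambda>_. b)) p"
    "\<And>x. x \<in> universe N \<Longrightarrow> \<exists>z\<in>universe N. \<forall>y\<in>universe N. sat N {} (case_nat x (\<lambda>_. y)) p \<longrightarrow> lessS N y z"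
proof -
  obtain f where f: "f \<in> D" "supp (Suc n) f" "a = nf f" using a by (auto simp: Lay_def)
  obtain g where g: "g \<in> D" "supp (Suc n) g" "b = nf g" using b by (auto simp: Lay_def)
  obtain H where H: "dfn {} (\<lambda>e. H (e 0) (e 1))"
    "\<And>x. x \<in> U \<Longrightarrow> \<exists>z\<in>U. \<forall>y\<in>U. H x y \<longrightarrow> y \<prec> z"
    "\<And>e. env e \<Longrightarrow> \<not> (\<exists>u\<in>U. most (\<lambda>v. f (e(n := v)) = u)) \<Longrightarrow> most (\<lambda>v. H (f (e(n := v))) (g (e(n := v))))"
    using same_layer_M[OF f(1) g(1), of n] by blast
  obtain q where q: "is_LA q" "\<And>e. env e \<Longrightarrow> H (e 0) (e 1) \<longleftrightarrow> sat M {} e q"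
    using dfn_formula[OF H(1)] by blast
  \<comment> \<open>Indices above 1 are collapsed to 1, so that \<open>p\<close> fits the
    indiscernibility axiom for pairs.\<close>
  define p where "p = subst (\<lambda>i. Var (min i 1)) q"
  have p: "is_LA p" "fv p \<subseteq> {..<2}"
    using q(1) fv_rename[of "\<lambda>i. min i 1" q] by (auto simp: p_def is_LA_subst)
  have sat_p: "sat M {} (case_nat x (\<lambda>_. y)) p \<longleftrightarrow> H x y" if "x \<in> U" "y \<in> U" for x y
  proof -
    have "env (\<lambda>i. case_nat x (\<lambda>_. y) (min i 1))" by (rule env_comp[OF env_case[OF that(1) env_const[OF that(2)]]])
    from q(2)[OF this] show ?thesis by (simp add: p_def sat_subst)
  qed
  have nc: "ev (\<lambda>e. \<not> (\<exists>u\<in>U. most (\<lambda>v. f (e(n := v)) = u)))"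
  proof -
    have "\<not> ev (\<lambda>e. \<exists>u\<in>U. most (\<lambda>v. f (e(n := v)) = u))"
    proof
      assume "ev (\<lambda>e. \<exists>u\<in>U. most (\<lambda>v. f (e(n := v)) = u))"
      then obtain h where "h \<in> D" "supp n h" "ev (\<lambda>e. f e = h e)" using supp_drop f by blast
      then have "a \<in> Lay n" using LayI[of h n] nf_eq[OF f(1), of h] f(3) by simp
      with a(2) show False ..
    qed
    moreover have "dfn U (\<lambda>e. \<exists>u\<in>U. most (\<lambda>v. f (e(n := v)) = u))"
      by (rule dfn_ex, rule dfn_value[OF f(1)])
    ultimately show ?thesis using ev_not by blast
  qed
  have "supp n (\<lambda>e. \<not> (\<exists>u\<in>U. most (\<lambda>v. f (e(n := v)) = u)))"
    unfolding supp_def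
  proof (intro allI impI arg_cong[of _ _ Not] bex_cong refl most_cong)
    fix e e' u v assume "env e" "env e'" "\<forall>i<n. e i = e' i" "v \<in> U"
    then have "f (e(n := v)) = f (e'(n := v))" using suppD[OF supp_upd[OF f(2)]] by blast
    then show "(f (e(n := v)) = u) = (f (e'(n := v)) = u)" by simp
  qed
  with nc have "evn n (\<lambda>e. \<not> (\<exists>u\<in>U. most (\<lambda>v. f (e(n := v)) = u))) (\<lambda>_. \<zero>)" using ev_supp by blast
  then have "evn n (\<lambda>e. most (\<lambda>v. H (f (e(n := v))) (g (e(n := v))))) (\<lambda>_. \<zero>)"
    by (rule evn_mono) (rule env_const, simp, rule H(3))
  moreover have "supp (Suc n) (\<lambda>e. H (f e) (g e))"
    using f(2) g(2) by (rule supp_2)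
  ultimately have "ev (\<lambda>e. H (f e) (g e))" by (simp add: evn_Suc_ev)
  then have "ev (\<lambda>e. sat M {} (case_nat (f e) (\<lambda>_. g e)) p)"
    by (rule ev_mono) (use sat_p D_in f g in blast)
  moreover have "(\<lambda>i. case_nat f (\<lambda>_. g) i e) = case_nat (f e) (\<lambda>_. g e)" for e
    by (rule ext) (simp split: nat.splits)
  moreover have "(\<lambda>i. nf (case_nat f (\<lambda>_. g) i)) = case_nat a (\<lambda>_. b)"
    by (rule ext) (simp add: f g split: nat.splits)
  moreover have "case_nat f (\<lambda>_. g) i \<in> D" for i using f g by (cases i) auto
  ultimately have sat: "sat N {} (case_nat a (\<lambda>_. b)) p"
    using Los[of "case_nat f (\<lambda>_. g)" p] p(1) by simp
  \<comment> \<open>Under the three quantifiers of \<open>?q\<close> the indices 2, 1, 0 stand for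
    \<open>x\<close>, \<open>z\<close>, \<open>y\<close>.\<close>
  let ?p' = "subst (\<lambda>i. if i = 0 then Var 2 else Var 0) p"
  let ?q = "All (Ex (All (Imp ?p' (Lt (Var 0) (Var 1)))))"
  have shift: "(\<lambda>i. eval S (case_nat y (case_nat z (case_nat x e))) (if i = 0 then Var 2 else Var 0)) =
      case_nat x (\<lambda>_. y)" for S :: "'a la_structure" and x y z e
    by (rule ext) (simp split: nat.splits)
  have sat_q: "sat S {} e ?q \<longleftrightarrow> (\<forall>x\<in>universe S. \<exists>z\<in>universe S. \<forall>y\<in>universe S.
      sat S {} (case_nat x (\<lambda>_. y)) p \<longrightarrow> lessS S y z)" for S :: "'a la_structure" and e
    by (simp add: sat_subst shift)
  have "sat M {} e ?q" for e unfolding sat_q using H(2) sat_p by meson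
  moreover have "is_LA ?q" using p(1) by (simp add: is_LA_subst)
  ultimately have "sat N {} (\<lambda>_. a) ?q"
    using Lay_N[OF a(1)] by (intro transfer) auto
  then have "\<exists>z\<in>universe N. \<forall>y\<in>universe N. sat N {} (case_nat x (\<lambda>_. y)) p \<longrightarrow> lessS N y z"
    if "x \<in> universe N" for x unfolding sat_q using that by blast
  with p sat show ?thesis by (rule that)
qed

text \<open>An unbounded set of indiscernibles cannot contain two elements of the same layer, since the
  larger one would be bounded by a parameter-free function of the smaller one.\<close>

lemma one_per_layer:
  assumes J: "models N J PAI" and j: "j \<in> J" "j' \<in> J" "lessS N j j'"
    and n: "j \<in> Lay (Suc n)" "j \<notin> Lay n" "j' \<in> Lay (Suc n)"
  shows False
proof -
  have JN: "J \<subseteq> universe N" using J by (simp add: models_def)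
  obtain p where p: "is_LA p" "fv p \<subseteq> {..<2}" "sat N {} (case_nat j (\<lambda>_. j')) p"
    "\<And>x. x \<in> universe N \<Longrightarrow> \<exists>z\<in>universe N. \<forall>y\<in>universe N. sat N {} (case_nat x (\<lambda>_. y)) p \<longrightarrow> lessS N y z"
    by (rule same_layer[OF n]) blast
  obtain z where z: "z \<in> universe N" "\<And>y. y \<in> universe N \<Longrightarrow> sat N {} (case_nat j (\<lambda>_. y)) p \<Longrightarrow> lessS N y z"
    using p(4)[OF subsetD[OF JN j(1)]] by blast
  have "sat N J (\<lambda>_. z) unbounded_axiom" using J z(1) by (auto simp: models_def PAI_def)
  then obtain y where y: "y \<in> J" "lessS N z y" using z(1) by (auto simp: unbounded_axiom_def)
  have "j \<in> universe N" "j' \<in> universe N" "y \<in> universe N" using j y JN by auto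
  note U = this z(1)
  have "lessS N j' z" using z(2) p(3) U by blast
  then have "lessS N j y" using j(3) y(2) arith.less_trans[OF arith_N] U by metis
  \<comment> \<open>Entries 0 and 1 hold the pair \<open>j\<close>, \<open>j'\<close>, and entries 2
    and 3 the pair \<open>j\<close>, \<open>y\<close>. Indiscernibility carries \<open>p\<close>
    from the first pair to the second, which puts \<open>y\<close> below \<open>z\<close>, although
    \<open>y\<close> was chosen above \<open>z\<close>.\<close>
  define e where "e = (\<lambda>i::nat. if i = 0 \<or> i = 2 then j else if i = 1 then j' else y)"
  have "range e \<subseteq> universe N" using U by (auto simp: e_def)
  then have "sat N J e (indiscernibility_axiom 2 p)"
    using J p unfolding models_def PAI_def indiscernibility_axioms_def by blast
  moreover have "sat N J e q" if "q \<in> set (map (\<lambda>i. Ind (Var i)) [0..<2 * 2] @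
      map (\<lambda>i. Lt (Var i) (Var (Suc i))) [0..<2 - 1] @
      map (\<lambda>i. Lt (Var (2 + i)) (Var (2 + Suc i))) [0..<2 - 1])" for q
    using that j y \<open>lessS N j y\<close> by (auto simp: e_def)
  ultimately have "sat N J e (Iff p (subst (\<lambda>i. Var (2 + i)) p))"
    unfolding indiscernibility_axiom_def sat_foldr_Imp by blast
  then have "sat N J e p \<longleftrightarrow> sat N J (\<lambda>i. e (2 + i)) p" by (auto simp: sat_subst)
  moreover have "sat N J e p \<longleftrightarrow> sat N {} (case_nat j (\<lambda>_. j')) p"
    unfolding sat_LA_cong[OF p(1), of N J _ "{}"]
    using p(2) by (intro sat_cong_fv) (auto simp: e_def split: nat.splits dest!: subsetD)
  moreover have "sat N J (\<lambda>i. e (2 + i)) p \<longleftrightarrow> sat N {} (case_nat j (\<lambda>_. y)) p"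
    unfolding sat_LA_cong[OF p(1), of N J _ "{}"]
    using p(2) by (intro sat_cong_fv) (auto simp: e_def split: nat.splits dest!: subsetD)
  ultimately have "lessS N y z" using p(3) z(2) U by blast
  then show False using y(2) arith.less_asym[OF arith_N] U by blast
qed

section \<open>Counting an unbounded set of indiscernibles layer by layer\<close>

lemma not_PAI_N: "\<not> has_expansion N PAI"
proof
  assume "has_expansion N PAI"
  then obtain J where J: "models N J PAI" by (auto simp: has_expansion_def)
  note NJ = arith_PAI[OF J]
  have JN: "J \<subseteq> universe N" using J by (simp add: models_def)
  \<comment> \<open>\<open>one_per_layer\<close> gives no information about the part of
    \<open>J\<close> inside the image of \<open>M\<close>; cutting at \<open>c 0\<close> removes
    that part.\<close>
  define K where "K v \<longleftrightarrow> v \<in> J \<and> lessS N (c 0) v" for v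
  have "arith.dfn N J (\<lambda>_. True) (universe N) (\<lambda>e. K (e 0))"
  proof -
    have "arith.dfn N J (\<lambda>_. True) (universe N) (\<lambda>e. sat N J e (Ind (Var 0)))"
      by (rule arith.dfn_sat[OF NJ]) simp
    moreover have "arith.dfn N J (\<lambda>_. True) (universe N) (\<lambda>e. lessS N (c 0) (e 0))"
      by (intro arith.dfn_less[OF NJ] arith.trm_const[OF NJ] arith.trm_var[OF NJ] c_N)
    ultimately show ?thesis unfolding K_def using arith.dfn_conj[OF NJ] by fastforce
  qed
  moreover have "\<exists>v\<in>universe N. lessS N b v \<and> K v" if b: "b \<in> universe N" for b
  proof -
    have unb: "\<exists>y\<in>J. lessS N x y" if "x \<in> universe N" for x
    proof -
      have "sat N J (\<lambda>_. x) unbounded_axiom" using J that by (auto simp: models_def PAI_def)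
      then show ?thesis using that by (auto simp: unbounded_axiom_def)
    qed
    \<comment> \<open>An element above the sum is above both \<open>b\<close> and
      \<open>c 0\<close>.\<close>
    obtain y where y: "y \<in> J" "lessS N (addS N b (c 0)) y"
      using unb arith.closed(3)[OF arith_N b c_N] by blast
    have le: "lessS N b (addS N b (c 0)) \<or> b = addS N b (c 0)"
      "lessS N (c 0) (addS N b (c 0)) \<or> c 0 = addS N b (c 0)"
      using arith.leq_add[OF arith_N] b c_N by blast+
    have "y \<in> universe N" using y(1) JN by blast
    then show ?thesis unfolding K_def using y
        arith.leq_less_trans[OF arith_N le(1) y(2)] arith.leq_less_trans[OF arith_N le(2) y(2)]
        arith.closed(3)[OF arith_N b c_N] b c_N by blast
  qed
  ultimately obtain y f where y: "y \<in> universe N" and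
    f: "\<And>i. i \<in> universe N \<Longrightarrow> lessS N i (c 0) \<Longrightarrow> f i \<in> universe N \<and> (lessS N (f i) y \<or> f i = y) \<and> K (f i)"
    "inj_on f {i \<in> universe N. lessS N i (c 0)}"
    using arith.long_sequences[OF NJ, of K "c 0"] c_N by blast
  let ?S = "{i \<in> universe N. lessS N i (c 0)}" and ?T = "{v \<in> universe N. (lessS N v y \<or> v = y) \<and> K v}"
  have emb_S: "emb x \<in> ?S" if "x \<in> U" for x
    using that Lay_less_c[of "emb x" 0] Lay_0 Lay_N by blast
  \<comment> \<open>The images of the numerals are distinct and lie below \<open>c 0\<close>,
    whether or not \<open>M\<close> has nonstandard elements.\<close>
  have "inj (\<lambda>k. emb (num k))"
  proof (rule injI)
    fix k l assume "emb (num k) = emb (num l)"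
    then show "k = l" by (simp add: emb_def nf_eq D_intros num_inj)
  qed
  then have "infinite (range (\<lambda>k. emb (num k)))" using finite_imageD infinite_UNIV_nat by blast
  moreover have "range (\<lambda>k. emb (num k)) \<subseteq> ?S" using emb_S num_in by blast
  ultimately have "infinite ?S" using finite_subset by blast
  then have "infinite (f ` ?S)" using f(2) finite_imageD by blast
  moreover have "f ` ?S \<subseteq> ?T" using f(1) by blast
  ultimately have inf: "infinite ?T" using finite_subset by blast
  obtain m where m: "y \<in> Lay m" using N_Lay[OF y] by blast
  \<comment> \<open>The index of the layer of \<open>v\<close>, meaning that \<open>v\<close> enters
    in passing from \<open>Lay (l v)\<close> to \<open>Lay (Suc (l v))\<close>. For
    \<open>l v = 0\<close> minimality says nothing, and \<open>v \<notin> Lay 0\<close> comes from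
    \<open>c 0\<close> being below \<open>v\<close>.\<close>
  define l where "l v = (LEAST l. v \<in> Lay (Suc l))" for v
  have T: "l v < m \<and> v \<in> Lay (Suc (l v)) \<and> v \<notin> Lay (l v)" if v: "v \<in> ?T" for v
  proof -
    have "v \<in> Lay m" using v m Lay_initial by blast
    have v0: "v \<notin> Lay 0"
    proof
      assume "v \<in> Lay 0"
      then have "c 0 \<in> Lay 0" using v Lay_initial[OF c_N] by (auto simp: K_def)
      then show False using c_notin_Lay by blast
    qed
    then have "m \<noteq> 0" using \<open>v \<in> Lay m\<close> by (cases m) auto
    then have vm: "v \<in> Lay (Suc (m - 1))" using \<open>v \<in> Lay m\<close> by simp
    have "v \<notin> Lay (l v)"
    proof (cases "l v")
      case (Suc k)
      then show ?thesis using not_less_Least[of k "\<lambda>l. v \<in> Lay (Suc l)"] by (simp add: l_def)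
    qed (use v0 in simp)
    moreover have "v \<in> Lay (Suc (l v))" unfolding l_def using vm by (rule LeastI)
    moreover have "l v \<le> m - 1" unfolding l_def using vm by (rule Least_le)
    ultimately show ?thesis using \<open>m \<noteq> 0\<close> by simp
  qed
  have "inj_on l ?T"
  proof (rule inj_onI, rule ccontr)
    fix v v' assume v: "v \<in> ?T" "v' \<in> ?T" "l v = l v'" "v \<noteq> v'"
    then have "lessS N v v' \<or> lessS N v' v" using arith.linear[OF arith_N, of v v'] by blast
    then show False
      using one_per_layer[OF J, of v v' "l v"] one_per_layer[OF J, of v' v "l v"] T[OF v(1)] T[OF v(2)] v
      by (auto simp: K_def)
  qed
  moreover have "l ` ?T \<subseteq> {..<m}" using T by blast
  ultimately have "finite ?T" using finite_imageD finite_subset by blast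
  with inf show False ..
qed

end

theorem theorem6p2:
  fixes M :: "'a la_structure"
  assumes "models_LA M PA"
  shows "\<exists>(N :: 'a la_structure) j.
           elementary_end_extension j M N \<and> has_expansion N PAI0 \<and> \<not> has_expansion N PAI"
proof -
  interpret arith M "{}" is_LA by (rule arith_PA[OF assms])
  show ?thesis
  proof (rule definable_type)
    fix Y :: "nat \<Rightarrow> 'a \<Rightarrow> bool"
    assume "\<And>k. dfn {} (\<lambda>e. Y k (e 0))" "\<And>k v. v \<in> U \<Longrightarrow> Y (Suc k) v \<Longrightarrow> Y k v"
      "\<And>k b. b \<in> U \<Longrightarrow> \<exists>v\<in>U. b \<prec> v \<and> Y k v"
      "\<And>R. dfn {} (\<lambda>e. R (e 0) (e 1)) \<Longrightarrow> \<exists>k. \<forall>y\<in>U. \<exists>b\<in>U.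
        (\<forall>v\<in>U. b \<prec> v \<longrightarrow> Y k v \<longrightarrow> R v y) \<or> (\<forall>v\<in>U. b \<prec> v \<longrightarrow> Y k v \<longrightarrow> \<not> R v y)"
    then interpret dtype M Y by unfold_locales
    show ?thesis using end_extension PAI0_N not_PAI_N unfolding has_expansion_def by blast
  qed
qed

end
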